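(* Let $X$ be the random field on $U^2$ of the context (finite or $\sigma$-finite measure space case), $Y(s)=X(s,s)$ its diagonal, and let $t\in U$. Suppose there exists a function $h:U\to\mathbb{R}$ such that all the following hold (with $r$ always positive and such that $t+r\in U$). (1) $v\mapsto f(s,v,x)$ is differentiable for all $(v,s)\in U^2$ and almost all $x\in E$; its derivative (with respect to the second argument) is denoted $f'_v$. (2) Finite case: there exists $\delta>\frac dc-1$ such that $\sup_{s\in U}\int_E[\sup_{w\in U}|f(s,w,x)|^{\alpha(w)}]^{1+\delta}\hat m(dx)<\infty$, and there exists $\delta>\frac dc-1$ such that $\sup_{s\in U}\int_E[\sup_{w\in U}|f'_v(s,w,x)|^{\alpha(w)}]^{1+\delta}\hat m(dx)<\infty$. $\sigma$-finite case: there exists $\delta>\frac dc-1$ such that $\sup_{s\in U}\int_E[\sup_{w\in U}|f(s,w,x)|^{\alpha(w)}]^{1+\delta}\rho(x)^\delta m(dx)<\infty$; there exists $\delta>\frac dc-1$ such that $\sup_{s\in U}\int_E[\sup_{w\in U}|f'_v(s,w,x)|^{\alpha(w)}]^{1+\delta}\rho(x)^\delta m(dx)<\infty$; there exists $\delta>\frac dc-1$ such that $\sup_{s\in U}\int_E[\sup_{w\in U}|f(s,w,x)\log\rho(x)|^{\alpha(w)}]^{1+\delta}\rho(x)^\delta m(dx)<\infty$. (3) There is $K>0$ such that $|f(v,u,x)|\le K$ and $|f'_v(v,u,x)|\le K$ for all $u,v\in U$, $x\in E$. (4) There are $\varepsilon_0\in(0,1)$, $K>0$ such that $\frac{1}{r^{h(t)-1/\alpha(t)}}|f(t+r,t,x)-f(t,t,x)|\le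 K$ for all $r<\varepsilon_0$, $x\in E$. (5) There is $p\in(\alpha(t),2)$, $p\ge1$, such that for every $\varepsilon>0$ there is $K>0$ with $\frac{1}{r^{1+p(h(t)-1/\alpha(t))}}\int_E|f(t+r,t,x)-f(t,t,x)|^p\,m(dx)\le K$ for all $r\le\varepsilon$. (6) For every $\varepsilon>0$ there is $K>0$ such that for all $r\le\varepsilon$: $\int_E|f(t+r,t,x)|^2m(dx)\le K$, $\int_E|f(t+r,t+r,x)|^2m(dx)\le K$, and $\frac1{r^2}\int_E|f(t+r,t+r,x)-f(t+r,t,x)|^2m(dx)\le K$. (7) $\inf_{v\in U}\int_E f(v,v,x)^2\,m(dx)>0$. (8) There is a positive function $g$ on $U$ such that $\lim_{r\to0}\frac{1}{r^{1+2(h(t)-1/\alpha(t))}}\int_E(f(t+r,t,x)-f(t,t,x))^2m(dx)=g(t)$. Then, almost surely, $\mathcal{H}_t\le h(t)$, where $$\mathcal{H}_t=\sup\Big\{\gamma:\lim_{r\to0}\frac{|Y(t+r)-Y(t)|}{|r|^\gamma}=0\Big\}$$ is the pointwise Hölder exponent of $Y$ at $t$.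
   Context: Setting. $U\subset\mathbb{R}$ is an open interval; $\alpha:U\to[c,d]\subset(0,2)$ is $C^1$; $b:U\to\mathbb{R}$ is $C^1$ and bounded. For a measure space $(E,\mathcal{E},m)$, $\mathcal{F}_\alpha(E,\mathcal{E},m)$ is the set of measurable $g:E\to\mathbb{R}$ with $\int_E|g|^\alpha dm<\infty$. For all $(t,u)\in U^2$, $f(t,u,\cdot)\in\mathcal{F}_{\alpha(u)}(E,\mathcal{E},m)$. $(\Gamma_i)_{i\ge1}$ are the arrival times of a Poisson process with unit rate; $(V_i)_{i\ge1}$ are i.i.d. with law $\hat m$ on $E$; $(\gamma_i)_{i\ge1}$ are i.i.d. with $P(\gamma_i=1)=P(\gamma_i=-1)=1/2$; the three sequences are independent. $C_\eta=\big(\int_0^\infty x^{-\eta}\sin x\,dx\big)^{-1}$. Finite case: $m$ is finite, $\hat m=m/m(E)$, and $X(t,u)=b(u)\,m(E)^{1/\alpha(u)}C_{\alpha(u)}^{1/\alpha(u)}\sum_{i\ge1}\gamma_i\Gamma_i^{-1/\alpha(u)}f(t,u,V_i)$. $\sigma$-finite case: $m$ is $\sigma$-finite, $\rho:E\to\mathbb{R}_+$ is such that $\hat m(dx)=\frac1{\rho(x)}m(dx)$ is a probability measure, and $X(t,u)=b(u)\,C_{\alpha(u)}^{1/\alpha(u)}\sum_{i\ge1}\gamma_i\Gamma_i^{-1/\alpha(u)}\rho(V_i)^{1/\alpha(u)}f(t,u,V_i)$.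
   Formalization: Two hypotheses are added because the claim fails without them: b(t) ≠ 0 (if b = 0 then Y = 0 and H_t = ∞), and h(t) < 1 + 1/α(t) (f(s,u,x) = 1 + ((s−u−x)_+)^2 on [0,1] with α constant, b = 1, h = 2 + 1/α meets (1)–(8), but Y is constant). *)

theory Defs
  imports "HOL-Probability.Probability"
begin

definition F_class :: "real \<Rightarrow> 'e measure \<Rightarrow> ('e \<Rightarrow> real) set" where
  "F_class a m = {g \<in> borel_measurable m. (\<integral>\<^sup>+x. ennreal (\<bar>g x\<bar> powr a) \<partial>m) < \<infinity>}"

text \<open>
  For \<open>\<eta> \<le> 1\<close> the integral below converges only conditionally at infinity. The
  Henstock--Kurzweil integral over the half-line agrees with the improper integral, whereas
  the Lebesgue integral would not exist.
\<close>

definition C_const :: "real \<Rightarrow> real" where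
  "C_const \<eta> = inverse (integral {0<..} (\<lambda>x. x powr (- \<eta>) * sin x))"

definition normalized :: "'e measure \<Rightarrow> 'e measure" where
  "normalized m = scale_measure (1 / emeasure m (space m)) m"

definition iid_law :: "'w measure \<Rightarrow> 'a measure \<Rightarrow> (nat \<Rightarrow> 'w \<Rightarrow> 'a) \<Rightarrow> bool" where
  "iid_law M \<mu> X \<longleftrightarrow> prob_space.indep_vars M (\<lambda>_. \<mu>) X UNIV \<and> (\<forall>i. distr M \<mu> (X i) = \<mu>)"

text \<open>
  All sequences are indexed from 0: \<open>\<Gamma> 0\<close>, \<open>V 0\<close>, \<open>\<gamma> 0\<close> are the first terms.
  A Poisson process of unit rate is taken to be the counting process whose waiting times
  \<open>\<Gamma> 0\<close>, \<open>\<Gamma> 1 - \<Gamma> 0\<close>, \<open>\<Gamma> 2 - \<Gamma> 1\<close>, ... are i.i.d. exponential with parameter 1.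
\<close>

definition waiting_time :: "(nat \<Rightarrow> 'w \<Rightarrow> real) \<Rightarrow> nat \<Rightarrow> 'w \<Rightarrow> real" where
  "waiting_time \<Gamma> i \<omega> = (case i of 0 \<Rightarrow> \<Gamma> 0 \<omega> | Suc j \<Rightarrow> \<Gamma> (Suc j) \<omega> - \<Gamma> j \<omega>)"

definition unit_poisson_arrivals :: "'w measure \<Rightarrow> (nat \<Rightarrow> 'w \<Rightarrow> real) \<Rightarrow> bool" where
  "unit_poisson_arrivals M \<Gamma> \<longleftrightarrow>
     iid_law M (density lborel (exponential_density 1)) (waiting_time \<Gamma>)"

definition iid_signs :: "'w measure \<Rightarrow> (nat \<Rightarrow> 'w \<Rightarrow> real) \<Rightarrow> bool" where
  "iid_signs M \<gamma> \<longleftrightarrow> prob_space.indep_vars M (\<lambda>_. borel) \<gamma> UNIV \<and>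
     (\<forall>i. \<P>(\<omega> in M. \<gamma> i \<omega> = 1) = 1/2 \<and> \<P>(\<omega> in M. \<gamma> i \<omega> = -1) = 1/2)"

definition events_of_sequence ::
    "'w measure \<Rightarrow> 'a measure \<Rightarrow> (nat \<Rightarrow> 'w \<Rightarrow> 'a) \<Rightarrow> 'w set set" where
  "events_of_sequence M N X =
     sets (vimage_algebra (space M) (\<lambda>\<omega> i. X i \<omega>) (\<Pi>\<^sub>M i\<in>(UNIV :: nat set). N))"

text \<open>
  The list in the last conjunct only serves to index the three generated sigma-algebras:
  \<open>indep_vars\<close> is not applicable to random variables with different codomain types.
\<close>

definition driving_sequences ::
    "'w measure \<Rightarrow> 'e measure \<Rightarrow> (nat \<Rightarrow> 'w \<Rightarrow> real) \<Rightarrow> (nat \<Rightarrow> 'w \<Rightarrow> 'e)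
      \<Rightarrow> (nat \<Rightarrow> 'w \<Rightarrow> real) \<Rightarrow> bool" where
  "driving_sequences M mhat \<Gamma> V \<gamma> \<longleftrightarrow>
     prob_space M \<and>
     unit_poisson_arrivals M \<Gamma> \<and>
     iid_law M mhat V \<and>
     iid_signs M \<gamma> \<and>
     prob_space.indep_sets M
       (\<lambda>k. [events_of_sequence M borel \<Gamma>, events_of_sequence M mhat V,
             events_of_sequence M borel \<gamma>] ! k) {..<3}"

text \<open>
  Where the random series diverges, \<open>suminf\<close> is a fixed unspecified number. For every fixed
  \<open>(t, u)\<close> this concerns only an event of probability 0.
\<close>

definition field_finite ::
    "(real \<Rightarrow> real) \<Rightarrow> (real \<Rightarrow> real) \<Rightarrow> 'e measure \<Rightarrow> (real \<Rightarrow> real \<Rightarrow> 'e \<Rightarrow> real)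
      \<Rightarrow> (nat \<Rightarrow> 'w \<Rightarrow> real) \<Rightarrow> (nat \<Rightarrow> 'w \<Rightarrow> 'e) \<Rightarrow> (nat \<Rightarrow> 'w \<Rightarrow> real)
      \<Rightarrow> real \<Rightarrow> real \<Rightarrow> 'w \<Rightarrow> real" where
  "field_finite b \<alpha> m f \<Gamma> V \<gamma> t u \<omega> =
     b u * measure m (space m) powr (1 / \<alpha> u) * C_const (\<alpha> u) powr (1 / \<alpha> u) *
     (\<Sum>i. \<gamma> i \<omega> * \<Gamma> i \<omega> powr (- 1 / \<alpha> u) * f t u (V i \<omega>))"

definition field_sigma_finite ::
    "(real \<Rightarrow> real) \<Rightarrow> (real \<Rightarrow> real) \<Rightarrow> ('e \<Rightarrow> real) \<Rightarrow> (real \<Rightarrow> real \<Rightarrow> 'e \<Rightarrow> real)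
      \<Rightarrow> (nat \<Rightarrow> 'w \<Rightarrow> real) \<Rightarrow> (nat \<Rightarrow> 'w \<Rightarrow> 'e) \<Rightarrow> (nat \<Rightarrow> 'w \<Rightarrow> real)
      \<Rightarrow> real \<Rightarrow> real \<Rightarrow> 'w \<Rightarrow> real" where
  "field_sigma_finite b \<alpha> \<rho> f \<Gamma> V \<gamma> t u \<omega> =
     b u * C_const (\<alpha> u) powr (1 / \<alpha> u) *
     (\<Sum>i. \<gamma> i \<omega> * \<Gamma> i \<omega> powr (- 1 / \<alpha> u) * \<rho> (V i \<omega>) powr (1 / \<alpha> u) * f t u (V i \<omega>))"

definition deriv_snd :: "(real \<Rightarrow> real \<Rightarrow> 'e \<Rightarrow> real) \<Rightarrow> real \<Rightarrow> real \<Rightarrow> 'e \<Rightarrow> real" where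
  "deriv_snd f s v x = deriv (\<lambda>w. f s w x) v"

text \<open>
  The inner supremum is a supremum of reals, so these conditions are meaningful only where
  \<open>w \<mapsto> \<phi> s w x\<close> is bounded on \<open>U\<close>. They are used together with uniform bounds on \<open>f\<close> and on
  \<open>deriv_snd f\<close>, which guarantee this. In the second condition the weight \<open>\<rho>\<^sup>\<delta>\<close> involves the
  same \<open>\<delta>\<close> as the exponent.
\<close>

definition sup_moment_finite ::
    "real set \<Rightarrow> (real \<Rightarrow> real) \<Rightarrow> real \<Rightarrow> 'e measure \<Rightarrow> (real \<Rightarrow> real \<Rightarrow> 'e \<Rightarrow> real) \<Rightarrow> bool" where
  "sup_moment_finite U \<alpha> q mhat \<phi> \<longleftrightarrow>
     (\<exists>\<delta>>q. (SUP s\<in>U. \<integral>\<^sup>+x. ennreal ((SUP w\<in>U. \<bar>\<phi> s w x\<bar> powr \<alpha> w) powr (1 + \<delta>)) \<partial>mhat) < \<infinity>)"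

definition sup_moment_sigma_finite ::
    "real set \<Rightarrow> (real \<Rightarrow> real) \<Rightarrow> real \<Rightarrow> 'e measure \<Rightarrow> ('e \<Rightarrow> real)
      \<Rightarrow> (real \<Rightarrow> real \<Rightarrow> 'e \<Rightarrow> real) \<Rightarrow> bool" where
  "sup_moment_sigma_finite U \<alpha> q m \<rho> \<phi> \<longleftrightarrow>
     (\<exists>\<delta>>q. (SUP s\<in>U. \<integral>\<^sup>+x. ennreal ((SUP w\<in>U. \<bar>\<phi> s w x\<bar> powr \<alpha> w) powr (1 + \<delta>) * \<rho> x powr \<delta>) \<partial>m)
        < \<infinity>)"

definition finite_case ::
    "real set \<Rightarrow> real \<Rightarrow> real \<Rightarrow> (real \<Rightarrow> real) \<Rightarrow> (real \<Rightarrow> real) \<Rightarrow> 'e measure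
      \<Rightarrow> (real \<Rightarrow> real \<Rightarrow> 'e \<Rightarrow> real) \<Rightarrow> 'w measure \<Rightarrow> (nat \<Rightarrow> 'w \<Rightarrow> real) \<Rightarrow> (nat \<Rightarrow> 'w \<Rightarrow> 'e)
      \<Rightarrow> (nat \<Rightarrow> 'w \<Rightarrow> real) \<Rightarrow> (real \<Rightarrow> real \<Rightarrow> 'w \<Rightarrow> real) \<Rightarrow> bool" where
  "finite_case U c d \<alpha> b m f M \<Gamma> V \<gamma> X \<longleftrightarrow>
     finite_measure m \<and>
     driving_sequences M (normalized m) \<Gamma> V \<gamma> \<and>
     X = field_finite b \<alpha> m f \<Gamma> V \<gamma> \<and>
     sup_moment_finite U \<alpha> (d / c - 1) (normalized m) f \<and>
     sup_moment_finite U \<alpha> (d / c - 1) (normalized m) (deriv_snd f)"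

definition sigma_finite_case ::
    "real set \<Rightarrow> real \<Rightarrow> real \<Rightarrow> (real \<Rightarrow> real) \<Rightarrow> (real \<Rightarrow> real) \<Rightarrow> 'e measure \<Rightarrow> ('e \<Rightarrow> real)
      \<Rightarrow> (real \<Rightarrow> real \<Rightarrow> 'e \<Rightarrow> real) \<Rightarrow> 'w measure \<Rightarrow> (nat \<Rightarrow> 'w \<Rightarrow> real) \<Rightarrow> (nat \<Rightarrow> 'w \<Rightarrow> 'e)
      \<Rightarrow> (nat \<Rightarrow> 'w \<Rightarrow> real) \<Rightarrow> (real \<Rightarrow> real \<Rightarrow> 'w \<Rightarrow> real) \<Rightarrow> bool" where
  "sigma_finite_case U c d \<alpha> b m \<rho> f M \<Gamma> V \<gamma> X \<longleftrightarrow>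
     sigma_finite_measure m \<and>
     \<rho> \<in> borel_measurable m \<and> (\<forall>x\<in>space m. 0 < \<rho> x) \<and>
     prob_space (density m (\<lambda>x. ennreal (1 / \<rho> x))) \<and>
     driving_sequences M (density m (\<lambda>x. ennreal (1 / \<rho> x))) \<Gamma> V \<gamma> \<and>
     X = field_sigma_finite b \<alpha> \<rho> f \<Gamma> V \<gamma> \<and>
     sup_moment_sigma_finite U \<alpha> (d / c - 1) m \<rho> f \<and>
     sup_moment_sigma_finite U \<alpha> (d / c - 1) m \<rho> (deriv_snd f) \<and>
     sup_moment_sigma_finite U \<alpha> (d / c - 1) m \<rho> (\<lambda>s w x. f s w x * ln (\<rho> x))"

text \<open>
  The supremum is taken in the extended reals: it is \<open>\<infinity>\<close> for a locally constant function and
  \<open>-\<infinity>\<close> if no real exponent qualifies.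
\<close>

definition pointwise_holder_exponent :: "(real \<Rightarrow> real) \<Rightarrow> real \<Rightarrow> ereal" where
  "pointwise_holder_exponent y t =
     Sup {ereal \<beta> |\<beta>. ((\<lambda>r. \<bar>y (t + r) - y t\<bar> / \<bar>r\<bar> powr \<beta>) \<longlongrightarrow> 0) (at 0)}"

end

theory Submission
  imports Defs
begin

text \<open>
  Given \<open>\<Gamma>\<close> and \<open>V\<close>, the increment \<open>Y (t + r) - Y t\<close> is a Rademacher series \<open>\<Sum>i. \<gamma> i * A i\<close>. By the
  Erdos--Littlewood--Offord inequality it lies in an interval of length \<open>2\<epsilon>\<close> with probability at most
  \<open>(N choose N div 2) / 2 ^ N\<close> as soon as \<open>N\<close> coefficients exceed \<open>\<epsilon>\<close> in modulus. Put \<open>H = h t - 1 / \<alpha> t\<close>.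
  Conditions (4), (5), (8) give \<open>m E\<^sub>r \<ge> c' * r\<close> for the set \<open>E\<^sub>r\<close> on which \<open>f (t + r) t\<close> and \<open>f t t\<close> differ by
  at least \<open>c * r powr H\<close>, and since \<open>H < 1\<close> the variation in the second argument is negligible there.
  For \<open>\<beta> > h t\<close> the indices with \<open>V i \<in> E\<^sub>r\<close> and \<open>r powr \<theta> \<le> \<rho> (V i) / \<Gamma> i \<le> 1\<close>, for a suitable \<open>\<theta> > 1\<close>,
  have \<open>\<bar>A i\<bar> \<ge> r powr \<beta>\<close>; their expected number is of order \<open>r powr (1 - \<theta>)\<close>, and their number tends to
  infinity in probability. Hence \<open>\<bar>Y (t + r) - Y t\<bar> < r powr \<beta>\<close> has probability tending to 0, and almost
  surely this event fails for arbitrarily small \<open>r\<close>.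
\<close>

text \<open>The signs are independent of the pair (\<open>\<Gamma>\<close>, \<open>V\<close>), so
  the joint law is a product and Fubini provides the conditioning. The \<open>\<Gamma> i\<close>
  depend on one another, which obstructs counting large coefficients; with probability near 1 they
  stay between \<open>Suc i / 2\<close> and \<open>4 * Suc i\<close> from some index
  \<open>n\<^sub>0\<close> on, and on that event bounds on \<open>\<rho> (V i) / \<Gamma> i\<close>
  follow from deterministic bounds on \<open>\<rho> (V i)\<close>. The count then involves the
  independent \<open>V i\<close> alone. With \<open>\<eta> = \<beta> - h t\<close> the exponent is
  \<open>\<theta> = 1 + \<alpha> t * \<eta> / 2\<close>: the threshold contributes
  \<open>r powr (1 / \<alpha> t + \<eta> / 2)\<close> to a coefficient, the other half of
  \<open>\<eta>\<close> absorbs constants, and \<open>\<theta> > 1\<close> makes the expected count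
  diverge. Convergence in probability suffices because an upper bound on the exponent only asks for
  one sequence of radii along which the increment is large infinitely often. The two cases are one
  series: in the finite case the weight is 1 and the total mass moves into the prefactor.\<close>

section \<open>Antichains and signed sums\<close>

text \<open>The Lubell--Yamamoto--Meshalkin inequality with denominators cleared, which makes it inductive.\<close>

lemma sum_antichain_fact_le:
  fixes X :: "'a set"
  assumes "finite X" "A \<subseteq> Pow X" "\<And>F G. F \<in> A \<Longrightarrow> G \<in> A \<Longrightarrow> F \<subseteq> G \<Longrightarrow> F = G"
  shows "(\<Sum>F\<in>A. fact (card F) * fact (card X - card F)) \<le> (fact (card X) :: nat)"
  using assms
proof (induction "card X" arbitrary: X A)
  case 0
  then have "A \<subseteq> {{}}" by auto
  then have "A = {} \<or> A = {{}}" by auto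
  with 0 show ?case by auto
next
  case (Suc n X A)
  have finA: "finite A"
    using Suc.prems by (meson finite_Pow_iff finite_subset)
  show ?case
  \<comment> \<open>The full set misses no point and would drop out of the double count below. An
    antichain containing it is a singleton, so this case is settled apart.\<close>
  proof (cases "X \<in> A")
    case True
    then have "A = {X}" using Suc.prems by blast
    then show ?thesis by simp
  next
    case False
    have fin: "finite F" "card F \<le> n" if "F \<in> A" for F
    proof -
      have "F \<subset> X" using that False Suc.prems by blast
      then show "finite F" "card F \<le> n"
        using psubset_card_mono[of X F] Suc.hyps(2) Suc.prems(1) by (auto simp: finite_subset)
    qed
    \<comment> \<open>Double counting of pairs of a set F and a point x outside F: there are
      \<open>Suc n - card F\<close> such points, exactly the factor that turns
      \<open>fact (n - card F)\<close> into \<open>fact (card X - card F)\<close>. For fixed x, the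
      members that avoid x form an antichain on \<open>X - {x}\<close>.\<close>
    have "(\<Sum>F\<in>A. fact (card F) * fact (card X - card F) :: nat)
        = (\<Sum>F\<in>A. \<Sum>x\<in>X. if x \<notin> F then fact (card F) * fact (n - card F) else 0)"
    proof (rule sum.cong)
      fix F assume F: "F \<in> A"
      have "(\<Sum>x\<in>X. if x \<notin> F then fact (card F) * fact (n - card F) else 0 :: nat)
          = card (X - F) * (fact (card F) * fact (n - card F))"
        using Suc.prems(1) by (simp add: sum.If_cases Diff_eq Collect_neg_eq)
      also have "card (X - F) = Suc (n - card F)"
        using F fin[OF F] Suc.prems Suc.hyps(2) by (subst card_Diff_subset) auto
      also have "\<dots> * (fact (card F) * fact (n - card F)) = (fact (card F) * fact (Suc (n - card F)) :: nat)"
        by (simp add: algebra_simps)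
      also have "Suc (n - card F) = card X - card F"
        using fin[OF F] Suc.hyps(2) by simp
      finally show "fact (card F) * fact (card X - card F) =
          (\<Sum>x\<in>X. if x \<notin> F then fact (card F) * fact (n - card F) else 0 :: nat)" by simp
    qed simp
    also have "\<dots> = (\<Sum>x\<in>X. \<Sum>F\<in>{F\<in>A. x \<notin> F}. fact (card F) * fact (n - card F))"
      unfolding sum.inter_filter[OF finA] by (rule sum.swap)
    also have "\<dots> \<le> (\<Sum>x\<in>X. fact n)"
    proof (rule sum_mono)
      fix x assume x: "x \<in> X"
      have c: "n = card (X - {x})" using x Suc.hyps(2) Suc.prems(1) by simp
      have "(\<Sum>F\<in>{F\<in>A. x \<notin> F}. fact (card F) * fact (card (X - {x}) - card F)) \<le> (fact (card (X - {x})) :: nat)"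
        by (rule Suc.hyps(1)) (use c Suc.prems in auto)
      then show "(\<Sum>F\<in>{F\<in>A. x \<notin> F}. fact (card F) * fact (n - card F)) \<le> (fact n :: nat)"
        by (simp flip: c)
    qed
    also have "\<dots> = fact (card X)" by (simp flip: Suc.hyps(2))
    finally show ?thesis .
  qed
qed

text \<open>Sperner's theorem: each summand of the preceding inequality is a factorial divided by a
  binomial coefficient, hence smallest at the middle layer.\<close>

lemma card_antichain_le:
  fixes X :: "'a set"
  assumes "finite X" "A \<subseteq> Pow X" "\<And>F G. F \<in> A \<Longrightarrow> G \<in> A \<Longrightarrow> F \<subseteq> G \<Longrightarrow> F = G"
  shows "card A \<le> card X choose (card X div 2)"
proof -
  let ?n = "card X"
  let ?h = "fact (?n div 2) * fact (?n - ?n div 2) :: nat"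
  have *: "?h \<le> fact (card F) * fact (?n - card F)" if "F \<in> A" for F
  proof -
    have le: "card F \<le> ?n" using that assms by (auto intro: card_mono)
    have "fact (card F) * fact (?n - card F) * (?n choose (?n div 2))
        \<ge> fact (card F) * fact (?n - card F) * (?n choose card F)"
      by (intro mult_left_mono binomial_maximum) auto
    also have "fact (card F) * fact (?n - card F) * (?n choose card F) = fact ?n"
      using binomial_fact_lemma[OF le] .
    also have "fact ?n = ?h * (?n choose (?n div 2))"
      using binomial_fact_lemma[of "?n div 2" ?n] by simp
    finally show ?thesis by simp
  qed
  have "card A * ?h \<le> (\<Sum>F\<in>A. fact (card F) * fact (?n - card F))"
    using sum_mono[of A "\<lambda>_. ?h"] * by simp
  also have "\<dots> \<le> fact ?n" by (rule sum_antichain_fact_le[OF assms])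
  also have "fact ?n = (?n choose (?n div 2)) * ?h"
    using binomial_fact_lemma[of "?n div 2" ?n] by (simp add: mult_ac)
  finally show ?thesis by simp
qed

text \<open>J is the set of signs that are flipped. After a symmetric difference with the set of
  negative coefficients all weights are positive, so comparable sets give values of
  \<open>s - 2 * (\<Sum>i\<in>J. c i)\<close> at least \<open>2 * \<epsilon>\<close> apart. Two such
  values cannot both lie in an open interval of that length; the admissible sets form an
  antichain.\<close>

lemma card_signed_sums_le:
  fixes c :: "'a \<Rightarrow> real"
  assumes fin: "finite I" and c: "\<And>i. i \<in> I \<Longrightarrow> \<epsilon> \<le> \<bar>c i\<bar>" and \<epsilon>: "0 < \<epsilon>"
  shows "card {J. J \<subseteq> I \<and> \<bar>s - 2 * (\<Sum>i\<in>J. c i)\<bar> < \<epsilon>} \<le> card I choose (card I div 2)"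
proof -
  define N where "N = {i\<in>I. c i < 0}"
  define \<phi> where "\<phi> J = (J - N) \<union> (N - J)" for J
  define A where "A = {J. J \<subseteq> I \<and> \<bar>s - 2 * (\<Sum>i\<in>J. c i)\<bar> < \<epsilon>}"
  have \<phi>\<phi>: "\<phi> (\<phi> J) = J" for J by (auto simp: \<phi>_def)
  then have inj: "inj_on \<phi> A" by (metis inj_onI)
  have \<phi>I: "\<phi> J \<subseteq> I" if "J \<subseteq> I" for J using that by (auto simp: \<phi>_def N_def)
  have w: "(\<Sum>i\<in>J. c i) = (\<Sum>i\<in>\<phi> J. \<bar>c i\<bar>) - (\<Sum>i\<in>N. \<bar>c i\<bar>)" if J: "J \<subseteq> I" for J
  proof -
    have fJ: "finite J" "finite N" using J fin finite_subset unfolding N_def by auto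
    have u: "(\<Sum>i\<in>\<phi> J. \<bar>c i\<bar>) = (\<Sum>i\<in>J - N. \<bar>c i\<bar>) + (\<Sum>i\<in>N - J. \<bar>c i\<bar>)"
      unfolding \<phi>_def by (rule sum.union_disjoint) (use fJ in auto)
    have "(\<Sum>i\<in>J. c i) = (\<Sum>i\<in>J - N. c i) + (\<Sum>i\<in>J \<inter> N. c i)"
      using sum.Int_Diff[OF fJ(1), of c N] by simp
    also have "(\<Sum>i\<in>J - N. c i) = (\<Sum>i\<in>J - N. \<bar>c i\<bar>)"
      by (rule sum.cong) (use J in \<open>auto simp: N_def\<close>)
    also have "(\<Sum>i\<in>J \<inter> N. c i) = - (\<Sum>i\<in>J \<inter> N. \<bar>c i\<bar>)"
      unfolding sum_negf[symmetric] by (rule sum.cong) (auto simp: N_def)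
    also have "(\<Sum>i\<in>J \<inter> N. \<bar>c i\<bar>) = (\<Sum>i\<in>N. \<bar>c i\<bar>) - (\<Sum>i\<in>N - J. \<bar>c i\<bar>)"
      using sum.Int_Diff[OF fJ(2), of "\<lambda>i. \<bar>c i\<bar>" J] by (simp add: Int_commute)
    finally show ?thesis using u by simp
  qed
  have "card (\<phi> ` A) \<le> card I choose (card I div 2)"
  proof (rule card_antichain_le[OF fin])
    show "\<phi> ` A \<subseteq> Pow I" using \<phi>I by (auto simp: A_def)
    fix F G assume FG: "F \<in> \<phi> ` A" "G \<in> \<phi> ` A" "F \<subseteq> G"
    then obtain J K where J: "J \<in> A" "F = \<phi> J" and K: "K \<in> A" "G = \<phi> K" by auto
    show "F = G"
    proof (rule ccontr)
      assume "F \<noteq> G"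
      with FG obtain j where j: "j \<in> G" "j \<notin> F" by auto
      have GI: "G \<subseteq> I" using K \<phi>I by (auto simp: A_def)
      then have fG: "finite G" using fin finite_subset by auto
      have "(\<Sum>i\<in>F. \<bar>c i\<bar>) + \<epsilon> \<le> (\<Sum>i\<in>F. \<bar>c i\<bar>) + \<bar>c j\<bar>" using c j GI by auto
      also have "\<dots> = (\<Sum>i\<in>insert j F. \<bar>c i\<bar>)"
        using j fG FG by (subst sum.insert) (auto simp: finite_subset)
      also have "\<dots> \<le> (\<Sum>i\<in>G. \<bar>c i\<bar>)" using fG FG j by (intro sum_mono2) auto
      finally have "(\<Sum>i\<in>J. c i) + \<epsilon> \<le> (\<Sum>i\<in>K. c i)"
        using w[of J] w[of K] J K by (simp add: A_def)
      moreover have "\<bar>s - 2 * (\<Sum>i\<in>J. c i)\<bar> < \<epsilon>" "\<bar>s - 2 * (\<Sum>i\<in>K. c i)\<bar> < \<epsilon>"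
        using J K by (auto simp: A_def)
      ultimately show False by linarith
    qed
  qed
  then show ?thesis using card_image[OF inj] by (simp add: A_def)
qed

text \<open>The squared form keeps the induction free of roots. Consecutive central coefficients
  have ratio 2 (2n + 1) / (n + 1), and the step closes by (2n + 1)(2n + 3) \<le> (2n + 2)^2.\<close>

lemma central_binomial_sq_le: "(real (2 * n choose n))\<^sup>2 * (2 * n + 1) \<le> (2 ^ (2 * n))\<^sup>2"
proof (induction n)
  case (Suc n)
  have rec: "real (Suc n) * real (2 * Suc n choose Suc n) = 2 * (2 * n + 1) * real (2 * n choose n)"
  proof -
    have "Suc n * (2 * Suc n choose Suc n) = 2 * (2 * n + 1) * (2 * n choose n)"
      using Suc_times_binomial_eq[of "2 * n + 1" n] binomial_symmetric[of n "2 * n + 1"]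
        Suc_times_binomial_eq[of "2 * n" n]
      by (simp add: algebra_simps)
    then show ?thesis by (metis of_nat_mult of_nat_numeral of_nat_add of_nat_1)
  qed
  define p q where "p = real (2 * n choose n)" and "q = real (2 * Suc n choose Suc n)"
  have pq: "real (Suc n) * q = 2 * (2 * n + 1) * p"
    using rec by (simp only: p_def q_def)
  have "(real (Suc n))\<^sup>2 * (q\<^sup>2 * (2 * Suc n + 1)) = (real (Suc n) * q)\<^sup>2 * (2 * n + 3)"
    by (simp add: power_mult_distrib)
  also have "\<dots> = 4 * ((2 * n + 1) * (2 * n + 3)) * (p\<^sup>2 * (2 * n + 1))"
    unfolding pq by (simp add: power2_eq_square algebra_simps)
  also have "\<dots> \<le> 4 * ((2 * n + 1) * (2 * n + 3)) * ((2::real) ^ (2 * n))\<^sup>2"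
    using Suc by (intro mult_left_mono) (auto simp: p_def)
  also have "\<dots> \<le> 16 * (real (Suc n))\<^sup>2 * (2 ^ (2 * n))\<^sup>2"
    by (intro mult_right_mono) (auto simp: power2_eq_square algebra_simps)
  also have "\<dots> = (real (Suc n))\<^sup>2 * (2 ^ (2 * Suc n))\<^sup>2"
    by (simp add: power2_eq_square algebra_simps)
  finally show ?case
    unfolding q_def[symmetric] by (simp del: of_nat_Suc mult_Suc_right)
qed simp

text \<open>The ratio is at most \<open>1 / sqrt n\<close>. An odd n = 2k + 1 has the same ratio as
  the even number 2k + 2, since the middle coefficient of the latter is twice that of the
  former.\<close>

lemma middle_binomial_ratio_tendsto_0: "(\<lambda>n. real (n choose (n div 2)) / 2 ^ n) \<longlonglongrightarrow> 0"
proof -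
  have even: "real (2 * k choose k) / 2 ^ (2 * k) \<le> 1 / sqrt (2 * k + 1)" for k
  proof -
    have "real (2 * k choose k) * sqrt (2 * k + 1) \<le> 2 ^ (2 * k)"
      by (rule power2_le_imp_le) (use central_binomial_sq_le[of k] in \<open>auto simp: power_mult_distrib\<close>)
    then show ?thesis by (simp add: field_simps)
  qed
  have "real (n choose (n div 2)) / 2 ^ n \<le> 1 / sqrt (real n)" if "n > 0" for n
  proof (cases "even n")
    case True
    then obtain k where k: "n = 2 * k" by auto
    have "1 / sqrt (2 * k + 1) \<le> 1 / sqrt (real n)" using k that by (intro divide_left_mono) auto
    then show ?thesis using even[of k] k by simp
  next
    case False
    then obtain k where k: "n = 2 * k + 1" by (elim oddE)
    have "2 * (n choose k) = 2 * Suc k choose Suc k"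
      using k binomial_symmetric[of k n] by simp
    then have "real (n choose (n div 2)) / 2 ^ n = real (2 * Suc k choose Suc k) / 2 ^ (2 * Suc k)"
      using k by (simp add: field_simps)
    also have "\<dots> \<le> 1 / sqrt (2 * Suc k + 1)" by (rule even)
    also have "\<dots> \<le> 1 / sqrt (real n)" using k by (intro divide_left_mono) auto
    finally show ?thesis .
  qed
  then have le: "eventually (\<lambda>n. real (n choose (n div 2)) / 2 ^ n \<le> 1 / sqrt (real n)) sequentially"
    by (auto simp: eventually_at_top_linorder intro!: exI[of _ 1])
  have "(\<lambda>n. 1 / sqrt (real n)) \<longlonglongrightarrow> 0"
    by (intro tendsto_divide_0[OF tendsto_const] filterlim_at_top_imp_at_infinity
        filterlim_compose[OF sqrt_at_top] filterlim_real_sequentially)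
  then show ?thesis
    by (rule tendsto_sandwich[OF _ le tendsto_const, rotated]) auto
qed

section \<open>Rademacher series\<close>

text \<open>Concentration on signs and invariance under every deterministic flip pin down the Haar
  measure on sign sequences. All estimates on Rademacher series below are averages over flips, so
  independence is recorded only in this form.\<close>

locale sign_space = prob_space L for L :: "(nat \<Rightarrow> real) measure" +
  assumes sets_L [measurable_cong]: "sets L = sets (PiM UNIV (\<lambda>_. borel))"
    and flip: "(\<And>i. \<sigma> i = 1 \<or> \<sigma> i = -1) \<Longrightarrow> distr L L (\<lambda>x i. \<sigma> i * x i) = L"
    and AE_sign: "AE x in L. \<forall>i. x i = 1 \<or> x i = -1"
begin

lemma space_L [simp]: "space L = UNIV"
  using sets_eq_imp_space_eq[OF sets_L] by (simp add: space_PiM PiE_def)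

lemma measurable_flip [measurable]: "(\<lambda>x i. \<sigma> i * x i) \<in> L \<rightarrow>\<^sub>M L"
proof -
  have "(\<lambda>x i. \<sigma> i * x i) \<in> L \<rightarrow>\<^sub>M PiM UNIV (\<lambda>_. borel)"
    by (rule measurable_PiM_single') auto
  then show ?thesis by (simp add: measurable_cong_sets[OF refl sets_L])
qed

lemma prob_flip:
  assumes "\<And>i. \<sigma> i = 1 \<or> \<sigma> i = -1" and [measurable]: "A \<in> sets L"
  shows "prob {x. (\<lambda>i. \<sigma> i * x i) \<in> A} = prob A"
proof -
  have "prob A = measure (distr L L (\<lambda>x i. \<sigma> i * x i)) A"
    by (simp add: flip[OF assms(1)])
  also have "\<dots> = prob {x. (\<lambda>i. \<sigma> i * x i) \<in> A}"
    by (subst measure_distr) (auto simp: vimage_def)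
  finally show ?thesis by simp
qed

lemma integral_flip:
  fixes g :: "(nat \<Rightarrow> real) \<Rightarrow> real"
  assumes "\<And>i. \<sigma> i = 1 \<or> \<sigma> i = -1" and [measurable]: "g \<in> borel_measurable L"
  shows "(\<integral>x. g (\<lambda>i. \<sigma> i * x i) \<partial>L) = (\<integral>x. g x \<partial>L)"
proof -
  have "(\<integral>x. g x \<partial>L) = (\<integral>x. g x \<partial>(distr L L (\<lambda>x i. \<sigma> i * x i)))"
    by (simp add: flip[OF assms(1)])
  also have "\<dots> = (\<integral>x. g (\<lambda>i. \<sigma> i * x i) \<partial>L)"
    by (subst integral_distr) auto
  finally show ?thesis by simp
qed

lemma integrable_coord_mult: "integrable L (\<lambda>x. x i * x j)"
proof (rule integrable_const_bound[where B=1])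
  show "AE x in L. norm (x i * x j) \<le> 1"
    using AE_sign by eventually_elim (metis abs_1 abs_minus_cancel abs_mult mult_1 norm_of_real order_refl real_norm_def)
qed simp

lemma expectation_coord_mult: "expectation (\<lambda>x. x i * x j) = (if i = j then 1 else 0)"
proof (cases "i = j")
  case True
  have "expectation (\<lambda>x. x i * x j) = expectation (\<lambda>x. 1)"
    by (rule integral_cong_AE) (use AE_sign in \<open>auto simp: True elim!: eventually_mono, metis mult_minus_left mult_minus_right mult_1 minus_minus\<close>)
  then show ?thesis using True prob_space by simp
next
  case False
  \<comment> \<open>Flipping coordinate i alone negates the product but preserves its expectation,
    which is therefore 0.\<close>
  let ?\<sigma> = "\<lambda>k. if k = i then -1 else 1 :: real"
  have "expectation (\<lambda>x. x i * x j) = expectation (\<lambda>x. (?\<sigma> i * x i) * (?\<sigma> j * x j))"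
    using integral_flip[of ?\<sigma> "\<lambda>x. x i * x j"] by simp
  then show ?thesis using False by simp
qed

lemma expectation_sum_sq:
  assumes "finite I"
  shows "expectation (\<lambda>x. (\<Sum>i\<in>I. x i * a i)\<^sup>2) = (\<Sum>i\<in>I. (a i)\<^sup>2)"
    and "integrable L (\<lambda>x. (\<Sum>i\<in>I. x i * a i)\<^sup>2)"
proof -
  have eq: "(\<Sum>i\<in>I. x i * a i)\<^sup>2 = (\<Sum>i\<in>I. \<Sum>j\<in>I. (x i * x j) * (a i * a j))" for x
    by (simp add: power2_eq_square sum_product mult_ac)
  show "integrable L (\<lambda>x. (\<Sum>i\<in>I. x i * a i)\<^sup>2)"
    unfolding eq by (intro Bochner_Integration.integrable_sum integrable_mult_left integrable_coord_mult)
  have "expectation (\<lambda>x. (\<Sum>i\<in>I. x i * a i)\<^sup>2) = (\<Sum>i\<in>I. \<Sum>j\<in>I. expectation (\<lambda>x. x i * x j) * (a i * a j))"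
    unfolding eq
    by (subst Bochner_Integration.integral_sum
        | intro Bochner_Integration.integrable_sum integrable_mult_left integrable_coord_mult sum.cong refl
        | simp)+
  also have "\<dots> = (\<Sum>i\<in>I. (a i)\<^sup>2)"
    using assms by (simp add: expectation_coord_mult if_distrib[of "\<lambda>z. z * _"] sum.delta power2_eq_square cong: if_cong)
  finally show "expectation (\<lambda>x. (\<Sum>i\<in>I. x i * a i)\<^sup>2) = (\<Sum>i\<in>I. (a i)\<^sup>2)" .
qed

lemma prob_sum_gt_le:
  assumes "finite I" "0 < \<epsilon>"
  shows "prob {x. \<epsilon> < \<bar>\<Sum>i\<in>I. x i * a i\<bar>} \<le> (\<Sum>i\<in>I. (a i)\<^sup>2) / \<epsilon>\<^sup>2"
proof -
  have "prob {x. \<epsilon> < \<bar>\<Sum>i\<in>I. x i * a i\<bar>} \<le> prob {x \<in> space L. \<epsilon>\<^sup>2 \<le> (\<Sum>i\<in>I. x i * a i)\<^sup>2}"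
  proof (rule finite_measure_mono)
    show "{x. \<epsilon> < \<bar>\<Sum>i\<in>I. x i * a i\<bar>} \<subseteq> {x \<in> space L. \<epsilon>\<^sup>2 \<le> (\<Sum>i\<in>I. x i * a i)\<^sup>2}"
      using assms power_mono[of \<epsilon> "\<bar>\<Sum>i\<in>I. x i * a i\<bar>" 2 for x] by auto
  qed measurable
  also have "\<dots> \<le> expectation (\<lambda>x. (\<Sum>i\<in>I. x i * a i)\<^sup>2) / \<epsilon>\<^sup>2"
    using assms by (intro integral_Markov_inequality_measure[where A="{}"] expectation_sum_sq) auto
  finally show ?thesis using expectation_sum_sq(1)[OF assms(1)] by simp
qed

text \<open>After the first passage above \<open>\<epsilon>\<close>, reflecting the remaining signs shows that the
  sum stays above \<open>\<epsilon>\<close> with conditional probability at least one half.\<close>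

lemma prob_max_sum_gt_le:
  "prob {x. \<exists>k\<in>{n..m}. \<epsilon> < \<bar>\<Sum>i=n..<k. x i * a i\<bar>} \<le> 2 * prob {x. \<epsilon> < \<bar>\<Sum>i=n..<m. x i * a i\<bar>}"
proof -
  define T where "T k x = (\<Sum>i=n..<k. x i * a i)" for k and x :: "nat \<Rightarrow> real"
  have [measurable]: "T k \<in> borel_measurable L" for k by (simp add: T_def [abs_def])
  define B where "B k = {x. \<epsilon> < \<bar>T k x\<bar> \<and> (\<forall>j\<in>{n..<k}. \<bar>T j x\<bar> \<le> \<epsilon>)}" for k
  define G where "G k = B k \<inter> {x. \<epsilon> < \<bar>T m x\<bar>}" for k
  have Bm [measurable]: "B k \<in> sets L" for k
  proof -
    have "B k = {x\<in>space L. \<epsilon> < \<bar>T k x\<bar> \<and> (\<forall>j\<in>{n..<k}. \<bar>T j x\<bar> \<le> \<epsilon>)}" by (simp add: B_def)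
    also have "\<dots> \<in> sets L" by measurable
    finally show ?thesis .
  qed
  have Tm [measurable]: "{x. \<epsilon> < \<bar>T k x\<bar>} \<in> sets L" for k
  proof -
    have "{x. \<epsilon> < \<bar>T k x\<bar>} = {x\<in>space L. \<epsilon> < \<bar>T k x\<bar>}" by simp
    also have "\<dots> \<in> sets L" by measurable
    finally show ?thesis .
  qed
  have Gm [measurable]: "G k \<in> sets L" for k unfolding G_def by measurable
  have half: "prob (B k) \<le> 2 * prob (G k)" if k: "k \<in> {n..m}" for k
  proof -
    define \<sigma> where "\<sigma> i = (if k \<le> i then -1 else 1 :: real)" for i
    have \<sigma>: "\<sigma> i = 1 \<or> \<sigma> i = -1" for i by (auto simp: \<sigma>_def)
    have T1: "T j (\<lambda>i. \<sigma> i * x i) = T j x" if "j \<le> k" for j x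
      unfolding T_def by (rule sum.cong) (use that in \<open>auto simp: \<sigma>_def\<close>)
    have T2: "T m (\<lambda>i. \<sigma> i * x i) = 2 * T k x - T m x" for x
    proof -
      have "T m y = T k y + (\<Sum>i=k..<m. y i * a i)" for y
        unfolding T_def using k by (intro sum.atLeastLessThan_concat[symmetric]) auto
      moreover have "(\<Sum>i=k..<m. \<sigma> i * x i * a i) = - (\<Sum>i=k..<m. x i * a i)"
        unfolding sum_negf[symmetric] by (rule sum.cong) (auto simp: \<sigma>_def)
      ultimately show ?thesis using T1[of k x] by simp
    qed
    have meas: "{x. (\<lambda>i. \<sigma> i * x i) \<in> G k} \<in> sets L"
    proof -
      have "{x. (\<lambda>i. \<sigma> i * x i) \<in> G k} = {x\<in>space L. (\<lambda>i. \<sigma> i * x i) \<in> G k}" by simp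
      also have "\<dots> \<in> sets L" by measurable
      finally show ?thesis .
    qed
    \<comment> \<open>\<open>T m\<close> and its reflection have mean \<open>T k\<close>, so on
      \<open>B k\<close> at least one of the two exceeds \<open>\<epsilon>\<close> in modulus.
      Membership in \<open>B k\<close> involves only coordinates before k and is unaffected by the
      reflection.\<close>
    have "B k \<subseteq> G k \<union> {x. (\<lambda>i. \<sigma> i * x i) \<in> G k}"
      by (auto simp: G_def B_def T1 T2)
    then have "prob (B k) \<le> prob (G k \<union> {x. (\<lambda>i. \<sigma> i * x i) \<in> G k})"
      by (intro finite_measure_mono) (use meas in auto)
    also have "\<dots> \<le> prob (G k) + prob {x. (\<lambda>i. \<sigma> i * x i) \<in> G k}"
      by (intro measure_Un_le) (use meas in auto)
    also have "\<dots> = 2 * prob (G k)" using prob_flip[OF \<sigma>] by simp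
    finally show ?thesis .
  qed
  have first: "\<exists>k\<in>{n..m}. x \<in> B k" if "\<exists>k\<in>{n..m}. \<epsilon> < \<bar>T k x\<bar>" for x
  proof -
    define k where "k = (LEAST k. n \<le> k \<and> \<epsilon> < \<bar>T k x\<bar>)"
    from that obtain k' where k': "k' \<in> {n..m}" "\<epsilon> < \<bar>T k' x\<bar>" by auto
    have "n \<le> k \<and> \<epsilon> < \<bar>T k x\<bar>" unfolding k_def by (rule LeastI[of _ k']) (use k' in auto)
    moreover have "k \<le> k'" unfolding k_def by (rule Least_le) (use k' in auto)
    moreover have "\<bar>T j x\<bar> \<le> \<epsilon>" if "j \<in> {n..<k}" for j
      using not_less_Least[of j "\<lambda>k. n \<le> k \<and> \<epsilon> < \<bar>T k x\<bar>"] that by (auto simp: k_def)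
    ultimately show ?thesis using k' by (auto simp: B_def intro!: bexI[of _ k])
  qed
  have disj: "disjoint_family_on G {n..m}"
  proof -
    have "G j \<inter> G k = {}" if "n \<le> j" "j < k" for j k
      using that by (force simp: G_def B_def not_less[symmetric])
    then show ?thesis
      unfolding disjoint_family_on_def by (metis Int_commute atLeastAtMost_iff linorder_neqE_nat)
  qed
  have "prob {x. \<exists>k\<in>{n..m}. \<epsilon> < \<bar>T k x\<bar>} \<le> prob (\<Union>k\<in>{n..m}. B k)"
    by (intro finite_measure_mono) (use first in auto)
  also have "\<dots> \<le> (\<Sum>k\<in>{n..m}. prob (B k))" by (intro finite_measure_subadditive_finite) auto
  also have "\<dots> \<le> (\<Sum>k\<in>{n..m}. 2 * prob (G k))" by (intro sum_mono half)
  also have "\<dots> = 2 * prob (\<Union>k\<in>{n..m}. G k)"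
    using disj by (subst finite_measure_finite_Union) (auto simp: sum_distrib_left)
  also have "\<dots> \<le> 2 * prob {x. \<epsilon> < \<bar>T m x\<bar>}"
    by (intro mult_left_mono finite_measure_mono) (auto simp: G_def)
  finally show ?thesis by (simp add: T_def)
qed

text \<open>The maximal inequality and Chebyshev's bound control the oscillation of the partial sums
  after n by the tail of the squares. The tails tend to 0, so almost surely the partial sums are
  Cauchy.\<close>

lemma AE_summable_signs:
  assumes a: "summable (\<lambda>i. (a i)\<^sup>2)"
  shows "AE x in L. summable (\<lambda>i. x i * a i)"
proof -
  define D where "D n e = {x. \<exists>k\<ge>n. e < \<bar>\<Sum>i=n..<k. x i * a i\<bar>}" for n :: nat and e :: real
  have Dm [measurable]: "D n e \<in> sets L" for n e
  proof -
    have "D n e = {x\<in>space L. \<exists>k\<in>{n..}. e < \<bar>\<Sum>i=n..<k. x i * a i\<bar>}" by (auto simp: D_def)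
    also have "\<dots> \<in> sets L" by measurable
    finally show ?thesis .
  qed
  have D_le: "prob (D n e) \<le> 2 * (\<Sum>i. (a (i + n))\<^sup>2) / e\<^sup>2" if e: "e > 0" for n e
  proof -
    define E where "E m = {x. \<exists>k\<in>{n..m}. e < \<bar>\<Sum>i=n..<k. x i * a i\<bar>}" for m
    have Em: "range E \<subseteq> sets L"
    proof safe
      fix m
      have "E m = {x\<in>space L. \<exists>k\<in>{n..m}. e < \<bar>\<Sum>i=n..<k. x i * a i\<bar>}" by (auto simp: E_def)
      also have "\<dots> \<in> sets L" by measurable
      finally show "E m \<in> sets L" .
    qed
    have "(\<lambda>m. prob (E m)) \<longlonglongrightarrow> prob (\<Union>m. E m)"
      by (rule finite_Lim_measure_incseq[OF Em]) (force simp: incseq_def E_def)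
    also have "(\<Union>m. E m) = D n e" by (force simp: E_def D_def)
    finally have lim: "(\<lambda>m. prob (E m)) \<longlonglongrightarrow> prob (D n e)" .
    have "prob (E m) \<le> 2 * (\<Sum>i. (a (i + n))\<^sup>2) / e\<^sup>2" for m
    proof -
      have "prob (E m) \<le> 2 * ((\<Sum>i=n..<m. (a i)\<^sup>2) / e\<^sup>2)"
        unfolding E_def using prob_max_sum_gt_le[of n m e a] prob_sum_gt_le[of "{n..<m}" e a] e by simp
      also have "(\<Sum>i=n..<m. (a i)\<^sup>2) \<le> (\<Sum>i. (a (i + n))\<^sup>2)"
      proof (cases "n \<le> m")
        case True
        have "(\<Sum>i=n..<m. (a i)\<^sup>2) = (\<Sum>i<m - n. (a (i + n))\<^sup>2)"
          using True sum.shift_bounds_nat_ivl[of "\<lambda>i. (a i)\<^sup>2" 0 n "m - n"] by (simp add: atLeast0LessThan)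
        also have "\<dots> \<le> (\<Sum>i. (a (i + n))\<^sup>2)"
          using summable_ignore_initial_segment[OF a, of n] by (intro sum_le_suminf) auto
        finally show ?thesis .
      qed (use summable_ignore_initial_segment[OF a, of n] in \<open>auto intro!: suminf_nonneg\<close>)
      finally show ?thesis using e by (simp add: divide_right_mono)
    qed
    then show ?thesis using lim by (intro LIMSEQ_le_const2[OF lim]) auto
  qed
  have "AE x in L. \<exists>n. x \<notin> D n e" if e: "e > 0" for e
  proof -
    have Im: "(\<Inter>n. D n e) \<in> sets L" by measurable
    have "(\<lambda>n. 2 * (\<Sum>i. (a (i + n))\<^sup>2) / e\<^sup>2) \<longlonglongrightarrow> 2 * 0 / e\<^sup>2"
      by (intro tendsto_divide tendsto_mult tendsto_const suminf_exist_split2[OF a]) (use e in auto)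
    moreover have "prob (\<Inter>n. D n e) \<le> 2 * (\<Sum>i. (a (i + n))\<^sup>2) / e\<^sup>2" for n
      by (rule order_trans[OF finite_measure_mono D_le[OF e, of n]]) auto
    ultimately have "prob (\<Inter>n. D n e) \<le> 0"
      by (intro LIMSEQ_le_const[where X="\<lambda>n. 2 * (\<Sum>i. (a (i + n))\<^sup>2) / e\<^sup>2"]) auto
    then have "prob (\<Inter>n. D n e) = 0" using measure_nonneg[of L "\<Inter>n. D n e"] by linarith
    then have "AE x in L. x \<notin> (\<Inter>n. D n e)"
      using Im by (subst AE_iff_measurable[OF Im]) (auto simp: emeasure_eq_measure)
    then show ?thesis by eventually_elim auto
  qed
  then have "AE x in L. \<forall>j::nat. \<exists>n. x \<notin> D n (1 / Suc j)"
    unfolding AE_all_countable by simp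
  then show ?thesis
  proof eventually_elim
    fix x assume x: "\<forall>j::nat. \<exists>n. x \<notin> D n (1 / Suc j)"
    show "summable (\<lambda>i. x i * a i)"
      unfolding summable_Cauchy
    proof (intro allI impI)
      fix e :: real assume "0 < e"
      then obtain j :: nat where j: "1 / Suc j < e / 2" using nat_approx_posE[of "e/2"] by auto
      obtain n where n: "x \<notin> D n (1 / Suc j)" using x by auto
      have "norm (\<Sum>i=p..<q. x i * a i) < e" if p: "p \<ge> n" for p q
      proof (cases "p \<le> q")
        case True
        have "(\<Sum>i=n..<q. x i * a i) = (\<Sum>i=n..<p. x i * a i) + (\<Sum>i=p..<q. x i * a i)"
          using True p by (intro sum.atLeastLessThan_concat[symmetric]) auto
        moreover have "\<bar>\<Sum>i=n..<q. x i * a i\<bar> \<le> 1 / Suc j" "\<bar>\<Sum>i=n..<p. x i * a i\<bar> \<le> 1 / Suc j"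
          using n p True by (auto simp: D_def not_less)
        ultimately show ?thesis using j by auto
      qed (use \<open>0 < e\<close> in auto)
      then show "\<exists>N. \<forall>m\<ge>N. \<forall>n. norm (sum (\<lambda>i. x i * a i) {m..<n}) < e" by blast
    qed
  qed
qed

text \<open>By flip invariance, \<open>2 ^ card I * prob A\<close> is the expected number of sets
  \<open>J \<subseteq> I\<close> whose flip leads into the event. For each outcome the combinatorial
  count bounds that number; the coefficients outside I only enter the common shift
  \<open>s\<close>.\<close>

lemma prob_suminf_lt_le:
  assumes fin: "finite I" and \<epsilon>: "0 < \<epsilon>" and a: "\<And>i. i \<in> I \<Longrightarrow> \<epsilon> \<le> \<bar>a i\<bar>"
    and summ: "AE x in L. summable (\<lambda>i. x i * a i)"
  shows "prob {x. \<bar>\<Sum>i. x i * a i\<bar> < \<epsilon>} \<le> (card I choose (card I div 2)) / 2 ^ card I"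
proof -
  define A where "A = {x. \<bar>\<Sum>i. x i * a i\<bar> < \<epsilon>}"
  define \<sigma> where "\<sigma> J i = (if i \<in> J then -1 else 1 :: real)" for J and i :: nat
  have \<sigma>: "\<sigma> J i = 1 \<or> \<sigma> J i = -1" for J i by (auto simp: \<sigma>_def)
  have "A = {x\<in>space L. \<bar>\<Sum>i. x i * a i\<bar> < \<epsilon>}" by (simp add: A_def)
  also have "\<dots> \<in> sets L" by measurable
  finally have Am [measurable]: "A \<in> sets L" .
  have FAm [measurable]: "{x. (\<lambda>i. \<sigma> J i * x i) \<in> A} \<in> sets L" for J
  proof -
    have "{x. (\<lambda>i. \<sigma> J i * x i) \<in> A} = {x\<in>space L. (\<lambda>i. \<sigma> J i * x i) \<in> A}" by simp
    also have "\<dots> \<in> sets L" by measurable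
    finally show ?thesis .
  qed
  have count: "(\<Sum>J\<in>Pow I. indicator {x. (\<lambda>i. \<sigma> J i * x i) \<in> A} x) \<le> real (card I choose (card I div 2))"
    if x: "\<forall>i. x i = 1 \<or> x i = -1" and s: "summable (\<lambda>i. x i * a i)" for x
  proof -
    have eq: "(\<lambda>i. \<sigma> J i * x i) \<in> A \<longleftrightarrow> \<bar>(\<Sum>i. x i * a i) - 2 * (\<Sum>i\<in>J. x i * a i)\<bar> < \<epsilon>" if J: "J \<subseteq> I" for J
    proof -
      have fJ: "finite J" using J fin finite_subset by auto
      have "(\<lambda>i. if i \<in> J then 2 * (x i * a i) else 0) sums (\<Sum>i\<in>J. 2 * (x i * a i))"
        by (rule sums_If_finite_set[OF fJ])
      from sums_diff[OF summable_sums[OF s] this]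
      have "(\<lambda>i. \<sigma> J i * x i * a i) sums ((\<Sum>i. x i * a i) - 2 * (\<Sum>i\<in>J. x i * a i))"
        by (subst sums_cong) (auto simp: \<sigma>_def sum_distrib_left)
      then show ?thesis by (simp add: A_def sums_iff)
    qed
    have "(\<Sum>J\<in>Pow I. indicator {x. (\<lambda>i. \<sigma> J i * x i) \<in> A} x :: real)
        = card {J\<in>Pow I. (\<lambda>i. \<sigma> J i * x i) \<in> A}"
      using fin by (simp add: indicator_def sum.If_cases Int_def)
    also have "{J\<in>Pow I. (\<lambda>i. \<sigma> J i * x i) \<in> A}
        = {J. J \<subseteq> I \<and> \<bar>(\<Sum>i. x i * a i) - 2 * (\<Sum>i\<in>J. x i * a i)\<bar> < \<epsilon>}"
      using eq by auto
    also have "card \<dots> \<le> card I choose (card I div 2)"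
    proof (rule card_signed_sums_le[OF fin _ \<epsilon>])
      fix i assume "i \<in> I"
      then show "\<epsilon> \<le> \<bar>x i * a i\<bar>" using a[of i] x[rule_format, of i] by (auto simp: abs_mult)
    qed
    finally show ?thesis by simp
  qed
  have "2 ^ card I * prob A = (\<Sum>J\<in>Pow I. prob {x. (\<lambda>i. \<sigma> J i * x i) \<in> A})"
    using prob_flip[OF \<sigma> Am] fin by (simp add: card_Pow)
  also have "\<dots> = expectation (\<lambda>x. \<Sum>J\<in>Pow I. indicator {x. (\<lambda>i. \<sigma> J i * x i) \<in> A} x)"
    by (subst Bochner_Integration.integral_sum) (auto simp: emeasure_eq_measure)
  also have "\<dots> \<le> expectation (\<lambda>x. real (card I choose (card I div 2)))"
  proof (rule integral_mono_AE)
    show "AE x in L. (\<Sum>J\<in>Pow I. indicator {x. (\<lambda>i. \<sigma> J i * x i) \<in> A} x) \<le> real (card I choose (card I div 2))"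
      using AE_sign summ by eventually_elim (rule count)
  qed (auto simp: emeasure_eq_measure)
  also have "\<dots> = card I choose (card I div 2)" using prob_space by simp
  finally show ?thesis by (simp add: A_def field_simps)
qed

end

section \<open>The normalising constant\<close>

text \<open>Moving the second argument of the field only requires prefactors and exponents to change
  by O(r). This notion is closed under products and compositions and spares a differentiation under
  the integral sign for the normalising constant.\<close>

definition lipschitz_at :: "(real \<Rightarrow> real) \<Rightarrow> real \<Rightarrow> bool" where
  "lipschitz_at \<phi> x \<longleftrightarrow> (\<exists>K. \<forall>\<^sub>F y in nhds x. \<bar>\<phi> y - \<phi> x\<bar> \<le> K * \<bar>y - x\<bar>)"

lemma lipschitz_at_tendsto:
  assumes "lipschitz_at \<phi> x"
  shows "(\<phi> \<longlongrightarrow> \<phi> x) (nhds x)"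
proof -
  obtain K where K: "\<forall>\<^sub>F y in nhds x. \<bar>\<phi> y - \<phi> x\<bar> \<le> K * \<bar>y - x\<bar>"
    using assms by (auto simp: lipschitz_at_def)
  have "((\<lambda>y. K * \<bar>y - x\<bar>) \<longlongrightarrow> K * \<bar>x - x\<bar>) (nhds x)"
    by (intro tendsto_intros filterlim_ident)
  then have "((\<lambda>y. K * \<bar>y - x\<bar>) \<longlongrightarrow> 0) (nhds x)" by simp
  then have "((\<lambda>y. \<phi> y - \<phi> x) \<longlongrightarrow> 0) (nhds x)"
    by (rule Lim_null_comparison[rotated]) (use K in simp)
  then show ?thesis by (simp add: LIM_zero_iff)
qed

lemma lipschitz_at_mult:
  assumes "lipschitz_at \<phi> x" "lipschitz_at \<psi> x"
  shows "lipschitz_at (\<lambda>y. \<phi> y * \<psi> y) x"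
proof -
  obtain K L where K: "\<forall>\<^sub>F y in nhds x. \<bar>\<phi> y - \<phi> x\<bar> \<le> K * \<bar>y - x\<bar>"
    and L: "\<forall>\<^sub>F y in nhds x. \<bar>\<psi> y - \<psi> x\<bar> \<le> L * \<bar>y - x\<bar>"
    using assms by (auto simp: lipschitz_at_def)
  have "\<forall>\<^sub>F y in nhds x. \<bar>\<phi> y\<bar> < \<bar>\<phi> x\<bar> + 1"
    by (rule order_tendstoD[OF tendsto_rabs[OF lipschitz_at_tendsto[OF assms(1)]]]) simp
  with K L have "\<forall>\<^sub>F y in nhds x. \<bar>\<phi> y * \<psi> y - \<phi> x * \<psi> x\<bar> \<le> ((\<bar>\<phi> x\<bar> + 1) * L + \<bar>\<psi> x\<bar> * K) * \<bar>y - x\<bar>"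
  proof eventually_elim
    case (elim y)
    have "\<phi> y * \<psi> y - \<phi> x * \<psi> x = \<phi> y * (\<psi> y - \<psi> x) + \<psi> x * (\<phi> y - \<phi> x)"
      by (simp add: algebra_simps)
    then have "\<bar>\<phi> y * \<psi> y - \<phi> x * \<psi> x\<bar> \<le> \<bar>\<phi> y\<bar> * \<bar>\<psi> y - \<psi> x\<bar> + \<bar>\<psi> x\<bar> * \<bar>\<phi> y - \<phi> x\<bar>"
      by (metis abs_mult abs_triangle_ineq)
    also have "\<dots> \<le> (\<bar>\<phi> x\<bar> + 1) * (L * \<bar>y - x\<bar>) + \<bar>\<psi> x\<bar> * (K * \<bar>y - x\<bar>)"
      using elim by (intro add_mono mult_mono) auto
    finally show ?case by (simp add: algebra_simps)
  qed
  then show ?thesis unfolding lipschitz_at_def by blast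
qed

lemma lipschitz_at_compose:
  assumes "lipschitz_at \<phi> x" "lipschitz_at \<psi> (\<phi> x)"
  shows "lipschitz_at (\<lambda>y. \<psi> (\<phi> y)) x"
proof -
  obtain K L where K: "\<forall>\<^sub>F y in nhds x. \<bar>\<phi> y - \<phi> x\<bar> \<le> K * \<bar>y - x\<bar>"
    and L: "\<forall>\<^sub>F z in nhds (\<phi> x). \<bar>\<psi> z - \<psi> (\<phi> x)\<bar> \<le> L * \<bar>z - \<phi> x\<bar>"
    using assms by (auto simp: lipschitz_at_def)
  have "\<forall>\<^sub>F y in nhds x. \<bar>\<psi> (\<phi> y) - \<psi> (\<phi> x)\<bar> \<le> L * \<bar>\<phi> y - \<phi> x\<bar>"
    using eventually_compose_filterlim[OF L lipschitz_at_tendsto[OF assms(1)]] .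
  with K have "\<forall>\<^sub>F y in nhds x. \<bar>\<psi> (\<phi> y) - \<psi> (\<phi> x)\<bar> \<le> (\<bar>L\<bar> * K) * \<bar>y - x\<bar>"
  proof eventually_elim
    case (elim y)
    have "L * \<bar>\<phi> y - \<phi> x\<bar> \<le> \<bar>L\<bar> * (K * \<bar>y - x\<bar>)"
      using elim by (intro mult_mono) auto
    with elim show ?case by simp
  qed
  then show ?thesis unfolding lipschitz_at_def by blast
qed

lemma lipschitz_at_differentiable:
  assumes "(\<phi> has_real_derivative D) (at x)"
  shows "lipschitz_at \<phi> x"
proof -
  have "((\<lambda>y. (\<phi> y - \<phi> x) / (y - x)) \<longlongrightarrow> D) (at x)"
    using assms by (simp add: has_field_derivative_iff)
  then have "\<forall>\<^sub>F y in at x. \<bar>(\<phi> y - \<phi> x) / (y - x)\<bar> < \<bar>D\<bar> + 1"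
    by (intro order_tendstoD[OF tendsto_rabs]) auto
  then have "\<forall>\<^sub>F y in at x. \<bar>\<phi> y - \<phi> x\<bar> \<le> (\<bar>D\<bar> + 1) * \<bar>y - x\<bar>"
  proof (rule eventually_elim2[OF _ eventually_neq_at_within[of x x UNIV]])
    fix y assume "\<bar>(\<phi> y - \<phi> x) / (y - x)\<bar> < \<bar>D\<bar> + 1" "y \<noteq> x"
    then show "\<bar>\<phi> y - \<phi> x\<bar> \<le> (\<bar>D\<bar> + 1) * \<bar>y - x\<bar>" by (simp add: field_simps)
  qed
  then have "\<forall>\<^sub>F y in nhds x. \<bar>\<phi> y - \<phi> x\<bar> \<le> (\<bar>D\<bar> + 1) * \<bar>y - x\<bar>"
    unfolding eventually_at_filter by eventually_elim force
  then show ?thesis unfolding lipschitz_at_def by blast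
qed

lemma lipschitz_at_cong:
  assumes "\<forall>\<^sub>F y in nhds x. \<phi> y = \<psi> y"
  shows "lipschitz_at \<phi> x \<longleftrightarrow> lipschitz_at \<psi> x"
proof -
  have "\<phi> x = \<psi> x" using assms by (rule eventually_nhds_x_imp_x)
  moreover have "(\<forall>\<^sub>F y in nhds x. \<bar>\<phi> y - \<phi> x\<bar> \<le> K * \<bar>y - x\<bar>) \<longleftrightarrow> (\<forall>\<^sub>F y in nhds x. \<bar>\<psi> y - \<psi> x\<bar> \<le> K * \<bar>y - x\<bar>)" for K
    by (rule eventually_cong[OF assms]) (simp add: \<open>\<phi> x = \<psi> x\<close>)
  ultimately show ?thesis by (simp add: lipschitz_at_def)
qed

lemma powr_le_sum_powr:
  fixes x :: real
  assumes "0 < x" "a \<le> b" "b \<le> c"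
  shows "x powr b \<le> x powr a + x powr c"
proof (cases "1 \<le> x")
  case True
  then have "x powr b \<le> x powr c" using assms by (intro powr_mono) auto
  then show ?thesis by (simp add: add_increasing)
next
  case False
  then have "x powr b \<le> x powr a" using assms by (intro powr_mono') auto
  then show ?thesis by (simp add: add_increasing2)
qed

text \<open>The tangent inequality at the larger point; taking the sum of both exponentials makes
  the bound symmetric in \<open>a\<close> and \<open>b\<close>.\<close>

lemma abs_exp_diff_le: "\<bar>exp a - exp b\<bar> \<le> \<bar>a - b\<bar> * (exp a + exp (b::real))"
proof -
  have *: "exp a - exp b \<le> (a - b) * exp a" for a b :: real
  proof -
    have "exp a * (1 + (b - a)) \<le> exp a * exp (b - a)"
      by (intro mult_left_mono exp_ge_add_one_self) auto
    then show ?thesis by (simp add: exp_diff algebra_simps)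
  qed
  have **: "\<bar>exp a - exp b\<bar> \<le> \<bar>a - b\<bar> * (exp a + exp b)" if "b \<le> a" for a b :: real
  proof -
    have "(a - b) * exp a \<le> (a - b) * (exp a + exp b)" using that by (intro mult_left_mono) auto
    then show ?thesis using *[of a b] that by simp
  qed
  show ?thesis
    using **[of a b] **[of b a] by (cases "b \<le> a") (simp_all add: abs_minus_commute add.commute)
qed

text \<open>The logarithm produced by a change of exponent is dominated by
  \<open>(x powr - \<delta> + x powr \<delta>) / \<delta>\<close>. One \<open>\<delta>\<close> pays
  for the distance from \<open>p\<close> to \<open>u\<close>, a second one for the logarithm. The 6
  is 2 from the two exponentials times 3 from expanding \<open>P * Q\<close>.\<close>

lemma abs_powr_diff_le:
  fixes x :: real
  assumes x: "0 < x" and \<delta>: "0 < \<delta>" and u: "\<bar>u - p\<bar> \<le> \<delta>"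
  shows "\<bar>x powr u - x powr p\<bar> \<le> \<bar>u - p\<bar> * (6 / \<delta>) * (x powr (p - 2 * \<delta>) + x powr (p + 2 * \<delta>))"
proof -
  define P where "P = x powr (p - \<delta>) + x powr (p + \<delta>)"
  define Q where "Q = x powr (- \<delta>) + x powr \<delta>"
  have ln: "\<bar>ln x\<bar> \<le> Q / \<delta>"
  proof -
    have "\<delta> * ln x \<le> x powr \<delta>" "- \<delta> * ln x \<le> x powr (- \<delta>)"
      using x ln_le_minus_one[of "x powr \<delta>"] ln_le_minus_one[of "x powr (- \<delta>)"] by (auto simp: ln_powr)
    then have "\<delta> * \<bar>ln x\<bar> \<le> Q"
      by (cases "0 \<le> ln x") (simp_all add: Q_def add_increasing add_increasing2)
    then show ?thesis using \<delta> by (simp add: field_simps)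
  qed
  have "\<bar>x powr u - x powr p\<bar> \<le> \<bar>u * ln x - p * ln x\<bar> * (x powr u + x powr p)"
    using abs_exp_diff_le[of "u * ln x" "p * ln x"] x by (simp add: powr_def)
  also have "\<bar>u * ln x - p * ln x\<bar> = \<bar>u - p\<bar> * \<bar>ln x\<bar>"
    by (simp add: abs_mult flip: left_diff_distrib)
  also have "\<bar>u - p\<bar> * \<bar>ln x\<bar> * (x powr u + x powr p) \<le> \<bar>u - p\<bar> * (Q / \<delta>) * (P + P)"
    unfolding P_def using ln u \<delta> x
    by (intro mult_mono add_mono powr_le_sum_powr) (auto simp: Q_def abs_if split: if_splits)
  also have "\<dots> = \<bar>u - p\<bar> * (2 / \<delta>) * (P * Q)" by simp
  also have "\<dots> \<le> \<bar>u - p\<bar> * (2 / \<delta>) * (3 * (x powr (p - 2 * \<delta>) + x powr (p + 2 * \<delta>)))"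
  proof (rule mult_left_mono)
    have "P * Q = x powr (p - 2 * \<delta>) + 2 * x powr p + x powr (p + 2 * \<delta>)"
      by (simp add: P_def Q_def algebra_simps flip: powr_add)
    also have "\<dots> \<le> 3 * (x powr (p - 2 * \<delta>) + x powr (p + 2 * \<delta>))"
      using powr_le_sum_powr[of x "p - 2 * \<delta>" p "p + 2 * \<delta>"] x \<delta> by simp
    finally show "P * Q \<le> 3 * (x powr (p - 2 * \<delta>) + x powr (p + 2 * \<delta>))" .
  qed (use \<delta> in auto)
  finally show ?thesis by (simp add: algebra_simps)
qed

section \<open>The normalising constant as an absolutely convergent integral\<close>

text \<open>What integration by parts makes of \<open>x powr (- \<eta>) * sin x\<close>, with
  \<open>1 - cos x\<close> as primitive of the sine. It is nonnegative and, for
  \<open>0 < \<eta>\<close> and \<open>\<eta> < 2\<close>, absolutely integrable, so dominated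
  estimates apply to it but not to the original integrand.\<close>

definition cos_kernel :: "real \<Rightarrow> real \<Rightarrow> real" where
  "cos_kernel \<eta> x = (1 - cos x) * x powr (- \<eta> - 1)"

definition cos_integral :: "real \<Rightarrow> real" where
  "cos_integral \<eta> = integral {0..} (cos_kernel \<eta>)"

lemma one_minus_cos_le: "1 - cos x \<le> x\<^sup>2 / (2::real)"
proof -
  have "1 - cos x = 2 * (sin (x / 2))\<^sup>2" using cos_double_sin[of "x / 2"] by simp
  also have "(sin (x / 2))\<^sup>2 \<le> (x / 2)\<^sup>2"
    using abs_sin_x_le_abs_x[of "x / 2"] unfolding abs_le_square_iff .
  finally show ?thesis by (simp add: power2_eq_square)
qed

lemma cos_kernel_nonneg: "0 \<le> cos_kernel \<eta> x"
  by (simp add: cos_kernel_def)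

lemma cos_kernel_integrable:
  assumes "0 < \<eta>" "\<eta> < 2"
  shows "cos_kernel \<eta> integrable_on {0..}"
proof -
  have meas: "cos_kernel \<eta> \<in> borel_measurable (lebesgue_on S)" if "S \<in> sets lebesgue" for S
    unfolding cos_kernel_def [abs_def]
    by (intro measurable_restrict_space1 measurable_completion) measurable
  have "cos_kernel \<eta> integrable_on {0..1}"
  proof (rule measurable_bounded_by_integrable_imp_integrable_real[OF meas])
    show "(\<lambda>x. x powr (1 - \<eta>)) integrable_on {0..1}"
      using assms by (intro integrable_on_powr_from_0) auto
    fix x :: real assume "x \<in> {0..1}"
    have "cos_kernel \<eta> x \<le> x\<^sup>2 / 2 * x powr (- \<eta> - 1)"
      unfolding cos_kernel_def by (intro mult_right_mono one_minus_cos_le) auto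
    also have "\<dots> \<le> x\<^sup>2 * x powr (- \<eta> - 1)" by (intro mult_right_mono) auto
    also have "\<dots> = x powr (1 - \<eta>)"
      using \<open>x \<in> {0..1}\<close> by (cases "x = 0") (auto simp flip: powr_numeral powr_add)
    finally show "\<bar>cos_kernel \<eta> x\<bar> \<le> x powr (1 - \<eta>)" using cos_kernel_nonneg[of \<eta> x] by simp
  qed auto
  moreover have "cos_kernel \<eta> integrable_on {1..}"
  proof (rule measurable_bounded_by_integrable_imp_integrable_real[OF meas])
    show "(\<lambda>x. 2 * x powr (- \<eta> - 1)) integrable_on {1..}"
      using has_integral_powr_to_inf[of "- \<eta> - 1" 1] assms
      by (intro integrable_on_mult_right) auto
    fix x :: real
    have "cos_kernel \<eta> x \<le> 2 * x powr (- \<eta> - 1)"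
      unfolding cos_kernel_def using cos_ge_minus_one[of x] by (intro mult_right_mono) auto
    then show "\<bar>cos_kernel \<eta> x\<bar> \<le> 2 * x powr (- \<eta> - 1)" using cos_kernel_nonneg[of \<eta> x] by simp
  qed auto
  ultimately have "cos_kernel \<eta> integrable_on ({0..1} \<union> {1..})"
    by (rule integrable_Un[rotated]) (auto intro: negligible_subset[of "{1}"])
  also have "{0..1} \<union> {1..} = {0::real..}" by auto
  finally show ?thesis .
qed

lemma cos_integral_pos:
  assumes "0 < \<eta>" "\<eta> < 2"
  shows "0 < cos_integral \<eta>"
proof -
  let ?c = "(1 - cos 1) * 2 powr (- \<eta> - 1)"
  have c1: "cos 1 < (1::real)" using cos_monotone_0_pi[of 0 1] pi_gt3 by simp
  have "0 < ?c" using c1 by simp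
  also have "?c = integral {1..2::real} (\<lambda>_. ?c)" by simp
  also have "\<dots> \<le> integral {1..2} (cos_kernel \<eta>)"
  proof (rule integral_le)
    show "cos_kernel \<eta> integrable_on {1..2}"
      unfolding cos_kernel_def [abs_def] by (intro integrable_continuous_interval continuous_intros) auto
    fix x :: real assume x: "x \<in> {1..2}"
    then have "cos x \<le> cos 1" using pi_gt3 by (intro cos_monotone_0_pi_le) auto
    moreover have "2 powr (- \<eta> - 1) \<le> x powr (- \<eta> - 1)" using x assms by (intro powr_mono2') auto
    ultimately show "?c \<le> cos_kernel \<eta> x"
      unfolding cos_kernel_def using c1 by (intro mult_mono) auto
  qed auto
  also have "\<dots> \<le> cos_integral \<eta>"
    unfolding cos_integral_def
  proof (rule integral_subset_le)
    show "cos_kernel \<eta> integrable_on {1..2}"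
      unfolding cos_kernel_def [abs_def] by (intro integrable_continuous_interval continuous_intros) auto
  qed (use cos_kernel_integrable[OF assms] cos_kernel_nonneg in auto)
  finally show ?thesis .
qed

lemma lipschitz_at_cos_integral:
  assumes "0 < \<eta>" "\<eta> < 2"
  shows "lipschitz_at cos_integral \<eta>"
proof -
  \<comment> \<open>A quarter of the distance to the ends of (0, 2): the dominating kernels have
    parameters \<open>\<eta> - 2 * \<delta>\<close> and \<open>\<eta> + 2 * \<delta>\<close>, which
    must stay inside.\<close>
  define \<delta> where "\<delta> = min \<eta> (2 - \<eta>) / 4"
  have \<delta>: "0 < \<delta>" "0 < \<eta> - 2 * \<delta>" "\<eta> + 2 * \<delta> < 2" using assms by (auto simp: \<delta>_def min_def field_simps)
  define K where "K = 6 / \<delta> * (cos_integral (\<eta> + 2 * \<delta>) + cos_integral (\<eta> - 2 * \<delta>))"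
  have "\<bar>cos_integral \<zeta> - cos_integral \<eta>\<bar> \<le> K * \<bar>\<zeta> - \<eta>\<bar>" if \<zeta>: "\<bar>\<zeta> - \<eta>\<bar> < \<delta>" for \<zeta>
  proof -
    define c where "c = \<bar>\<zeta> - \<eta>\<bar> * (6 / \<delta>)"
    have i: "cos_kernel \<zeta> integrable_on {0..}" "cos_kernel \<eta> integrable_on {0..}"
      "cos_kernel (\<eta> + 2 * \<delta>) integrable_on {0..}" "cos_kernel (\<eta> - 2 * \<delta>) integrable_on {0..}"
      using \<zeta> \<delta> assms by (auto intro!: cos_kernel_integrable simp: abs_if split: if_splits)
    have "cos_integral \<zeta> - cos_integral \<eta> = integral {0..} (\<lambda>x. cos_kernel \<zeta> x - cos_kernel \<eta> x)"
      unfolding cos_integral_def by (rule integral_diff[symmetric]) (use i in auto)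
    also have "norm \<dots> \<le> integral {0..} (\<lambda>x. c * (cos_kernel (\<eta> + 2 * \<delta>) x + cos_kernel (\<eta> - 2 * \<delta>) x))"
    proof (rule integral_norm_bound_integral)
      fix x :: real assume x: "x \<in> {0..}"
      show "norm (cos_kernel \<zeta> x - cos_kernel \<eta> x) \<le> c * (cos_kernel (\<eta> + 2 * \<delta>) x + cos_kernel (\<eta> - 2 * \<delta>) x)"
      proof (cases "x = 0")
        case False
        have "norm (cos_kernel \<zeta> x - cos_kernel \<eta> x) = (1 - cos x) * \<bar>x powr (- \<zeta> - 1) - x powr (- \<eta> - 1)\<bar>"
          by (simp add: cos_kernel_def abs_mult flip: right_diff_distrib)
        also have "\<dots> \<le> (1 - cos x) * (\<bar>(- \<zeta> - 1) - (- \<eta> - 1)\<bar> * (6 / \<delta>) *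
            (x powr ((- \<eta> - 1) - 2 * \<delta>) + x powr ((- \<eta> - 1) + 2 * \<delta>)))"
          using x False \<zeta> \<delta> by (intro mult_left_mono abs_powr_diff_le) auto
        also have "\<dots> = c * (cos_kernel (\<eta> + 2 * \<delta>) x + cos_kernel (\<eta> - 2 * \<delta>) x)"
        proof -
          have e: "(- \<eta> - 1) - 2 * \<delta> = - (\<eta> + 2 * \<delta>) - 1" "(- \<eta> - 1) + 2 * \<delta> = - (\<eta> - 2 * \<delta>) - 1"
            "\<bar>(- \<zeta> - 1) - (- \<eta> - 1)\<bar> = \<bar>\<zeta> - \<eta>\<bar>" by auto
          show ?thesis unfolding e cos_kernel_def c_def by (simp only: distrib_left mult_ac)
        qed
        finally show ?thesis .
      qed (simp add: cos_kernel_def)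
    qed (use i in \<open>auto intro!: integrable_diff integrable_on_mult_right integrable_add\<close>)
    also have "\<dots> = K * \<bar>\<zeta> - \<eta>\<bar>"
      using i by (simp add: K_def c_def cos_integral_def integral_add)
    finally show ?thesis by simp
  qed
  then show ?thesis
    unfolding lipschitz_at_def eventually_nhds_metric dist_real_def using \<delta>(1) by blast
qed

text \<open>Integration by parts: \<open>F\<close> vanishes at 0 and at infinity, so its derivative
  integrates to 0 over the half-line. Choosing \<open>1 - cos\<close> rather than
  \<open>- cos\<close> makes \<open>F\<close> of order \<open>x powr (2 - \<eta>)\<close> at
  0.\<close>

lemma sin_powr_has_integral:
  assumes "0 < \<eta>" "\<eta> < 2"
  shows "((\<lambda>x. x powr (- \<eta>) * sin x) has_integral \<eta> * cos_integral \<eta>) {0..}"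
proof -
  define F where "F x = (1 - cos x) * x powr (- \<eta>)" for x :: real
  define F' where "F' x = x powr (- \<eta>) * sin x - \<eta> * cos_kernel \<eta> x" for x
  have F_le: "\<bar>F x\<bar> \<le> x powr (2 - \<eta>)" if "0 \<le> x" for x
  proof -
    have "\<bar>F x\<bar> = F x" by (simp add: F_def)
    also have "F x \<le> x\<^sup>2 / 2 * x powr (- \<eta>)"
      unfolding F_def by (intro mult_right_mono one_minus_cos_le) auto
    also have "\<dots> \<le> x\<^sup>2 * x powr (- \<eta>)" by (intro mult_right_mono) auto
    also have "\<dots> = x powr (2 - \<eta>)"
      using that by (cases "x = 0") (auto simp flip: powr_numeral powr_add)
    finally show ?thesis .
  qed
  have cont: "continuous_on {0..y} F" for y
    unfolding continuous_on_def
  proof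
    fix x assume x: "x \<in> {0..y}"
    show "(F \<longlongrightarrow> F x) (at x within {0..y})"
    \<comment> \<open>The factor \<open>x powr (- \<eta>)\<close> is unbounded near 0, so continuity
      of the product there comes from the bound \<open>F_le\<close>.\<close>
    proof (cases "x = 0")
      case True
      have "continuous_on {0..y} (\<lambda>x. x powr (2 - \<eta>))"
        using assms by (intro continuous_on_powr' continuous_intros) auto
      then have "((\<lambda>x. x powr (2 - \<eta>)) \<longlongrightarrow> 0) (at 0 within {0..y})"
        using x True unfolding continuous_on_def by force
      moreover have "\<forall>\<^sub>F x in at 0 within {0..y}. norm (F x) \<le> x powr (2 - \<eta>)"
        unfolding eventually_at_filter by (rule always_eventually) (use F_le in auto)
      ultimately have "(F \<longlongrightarrow> 0) (at 0 within {0..y})" by (rule Lim_null_comparison[rotated])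
      then show ?thesis using True by (simp add: F_def)
    next
      case False
      then have "isCont F x" unfolding F_def [abs_def] by (intro continuous_intros) auto
      then show ?thesis using continuous_at_imp_continuous_at_within continuous_within by blast
    qed
  qed
  have der: "(F has_vector_derivative F' x) (at x)" if "0 < x" for x
  proof -
    have "(F has_real_derivative sin x * x powr (- \<eta>) + (1 - cos x) * (- \<eta> * x powr (- \<eta> - 1))) (at x)"
      unfolding F_def [abs_def] using that by (auto intro!: derivative_eq_intros)
    then show ?thesis
      by (simp add: F'_def cos_kernel_def has_real_derivative_iff_has_vector_derivative algebra_simps)
  qed
  have FTC: "(F' has_integral F y) {0..y}" if "0 \<le> y" for y
    using fundamental_theorem_of_calculus_interior[OF that cont der] by (auto simp: F_def)
  have "(F' has_integral 0) {0..}"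
    \<comment> \<open>The improper integral as a limit over boxes: a box around a large ball meets
      the half-line in \<open>{0..b}\<close>, where the integral is the boundary term
      \<open>F b\<close>, at most \<open>2 * b powr (- \<eta>)\<close>.\<close>
    unfolding has_integral_alt'
  proof (intro conjI allI impI)
    fix a b :: real
    have "F' integrable_on {0..} \<inter> cbox a b"
    proof (cases "0 \<le> b")
      case True
      then have "F' integrable_on {0..b}" using FTC by blast
      then have "F' integrable_on {max 0 a..b}" by (rule integrable_on_subinterval) auto
      also have "{max 0 a..b} = {0..} \<inter> cbox a b" by auto
      finally show ?thesis .
    next
      case False
      then have "{0..} \<inter> cbox a b = {}" by auto
      then show ?thesis by (simp only: integrable_on_empty)
    qed
    then show "(\<lambda>x. if x \<in> {0..} then F' x else 0) integrable_on cbox a b"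
      by (simp only: integrable_restrict_Int)
  next
    fix e :: real assume e: "0 < e"
    have "((\<lambda>b. 2 * b powr (- \<eta>)) \<longlongrightarrow> 2 * 0) at_top"
      using assms by (intro tendsto_mult tendsto_const tendsto_neg_powr filterlim_ident) auto
    then have "\<forall>\<^sub>F b in at_top. 2 * b powr (- \<eta>) < e" using e by (intro order_tendstoD) auto
    then obtain B where B: "\<And>b. b \<ge> B \<Longrightarrow> 2 * b powr (- \<eta>) < e" by (auto simp: eventually_at_top_linorder)
    have "norm (integral (cbox a b) (\<lambda>x. if x \<in> {0..} then F' x else 0) - 0) < e"
      if ab: "ball 0 (max 1 B) \<subseteq> cbox a b" for a b :: real
    proof -
      have a: "a \<le> 0" using ab by (auto simp: subset_eq)
      have b: "c \<le> b" if "0 \<le> c" "c < max 1 B" for c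
        using ab that by (auto simp: subset_eq dest!: spec[of _ c])
      then have "0 \<le> b" by force
      \<comment> \<open>The ball is open, so its radius is reached only as a limit of points known
        to lie in the box.\<close>
      have bB: "max 1 B \<le> b" by (rule dense_le_bounded[of 0]) (use b in auto)
      have "integral (cbox a b) (\<lambda>x. if x \<in> {0..} then F' x else 0) = integral ({0..} \<inter> cbox a b) F'"
        by (rule integral_restrict_Int)
      also have "{0..} \<inter> cbox a b = {0..b}" using a by auto
      also have "integral \<dots> F' = F b" using FTC[OF \<open>0 \<le> b\<close>] by (rule integral_unique)
      also have "\<bar>F b\<bar> \<le> 2 * b powr (- \<eta>)"
        unfolding F_def abs_mult using cos_ge_minus_one[of b] by (intro mult_mono) auto
      ultimately show ?thesis using B[of b] bB by simp
    qed
    then show "\<exists>B>0. \<forall>a b. ball 0 B \<subseteq> cbox a b \<longrightarrow>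
        norm (integral (cbox a b) (\<lambda>x. if x \<in> {0..} then F' x else 0) - 0) < e"
      by (intro exI[of _ "max 1 B"]) auto
  qed
  moreover have "((\<lambda>x. \<eta> * cos_kernel \<eta> x) has_integral \<eta> * cos_integral \<eta>) {0..}"
    unfolding cos_integral_def
    by (intro has_integral_mult_right integrable_integral cos_kernel_integrable assms)
  ultimately have "((\<lambda>x. F' x + \<eta> * cos_kernel \<eta> x) has_integral 0 + \<eta> * cos_integral \<eta>) {0..}"
    by (rule has_integral_add)
  then show ?thesis by (simp add: F'_def)
qed

lemma C_const_eq:
  assumes "0 < \<eta>" "\<eta> < 2"
  shows "C_const \<eta> = inverse (\<eta> * cos_integral \<eta>)"
proof -
  \<comment> \<open>The domains differ in the point 0, where the integrand is 0; the functions
    extended by 0 coincide.\<close>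
  have "integral {0<..} (\<lambda>x. x powr (- \<eta>) * sin x) = integral {0..} (\<lambda>x. x powr (- \<eta>) * sin x)"
    unfolding integral_restrict_UNIV[of "{0<..}", symmetric] integral_restrict_UNIV[of "{0..}", symmetric]
    by (rule arg_cong[where f="integral UNIV"]) auto
  also have "\<dots> = \<eta> * cos_integral \<eta>"
    using sin_powr_has_integral[OF assms] by (rule integral_unique)
  finally show ?thesis by (simp add: C_const_def)
qed

lemma C_const_pos: "0 < \<eta> \<Longrightarrow> \<eta> < 2 \<Longrightarrow> 0 < C_const \<eta>"
  using cos_integral_pos[of \<eta>] by (simp add: C_const_eq)

text \<open>In exponential form the function is composed of differentiable maps and the cosine
  integral. That form is valid only on (0, 2), whence the passage through a neighbourhood at the
  end.\<close>

lemma lipschitz_at_C_const_powr: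
  assumes "0 < \<eta>" "\<eta> < 2"
  shows "lipschitz_at (\<lambda>\<eta>. C_const \<eta> powr (1 / \<eta>)) \<eta>"
proof -
  have J: "0 < cos_integral \<eta>" using cos_integral_pos assms by auto
  have "lipschitz_at (\<lambda>\<eta>. \<eta> * cos_integral \<eta>) \<eta>"
    by (intro lipschitz_at_mult lipschitz_at_cos_integral assms lipschitz_at_differentiable)
       (auto intro!: derivative_eq_intros)
  then have "lipschitz_at (\<lambda>\<eta>. - ln (\<eta> * cos_integral \<eta>)) \<eta>"
    by (rule lipschitz_at_compose)
       (use J assms in \<open>auto intro!: lipschitz_at_differentiable derivative_eq_intros\<close>)
  moreover have "lipschitz_at (\<lambda>\<eta>. 1 / \<eta>) \<eta>"
    by (rule lipschitz_at_differentiable) (use assms in \<open>auto intro!: derivative_eq_intros\<close>)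
  ultimately have "lipschitz_at (\<lambda>\<eta>. 1 / \<eta> * - ln (\<eta> * cos_integral \<eta>)) \<eta>"
    by (rule lipschitz_at_mult[rotated])
  then have "lipschitz_at (\<lambda>\<eta>. exp (1 / \<eta> * - ln (\<eta> * cos_integral \<eta>))) \<eta>"
    by (rule lipschitz_at_compose) (auto intro!: lipschitz_at_differentiable derivative_eq_intros)
  moreover have "\<forall>\<^sub>F \<eta> in nhds \<eta>. exp (1 / \<eta> * - ln (\<eta> * cos_integral \<eta>)) = C_const \<eta> powr (1 / \<eta>)"
  proof (rule eventually_nhds_in_open[THEN eventually_mono, of "{0<..<2}"])
    fix \<zeta> :: real assume "\<zeta> \<in> {0<..<2}"
    then have "C_const \<zeta> = inverse (\<zeta> * cos_integral \<zeta>)" "0 < \<zeta>" "0 < cos_integral \<zeta>"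
      using C_const_eq cos_integral_pos by auto
    then show "exp (1 / \<zeta> * - ln (\<zeta> * cos_integral \<zeta>)) = C_const \<zeta> powr (1 / \<zeta>)"
      by (simp add: powr_def ln_inverse ln_mult del: inverse_mult_distrib)
  qed (use assms in auto)
  ultimately show ?thesis by (simp add: lipschitz_at_cong)
qed

section \<open>The driving sequences\<close>

context prob_space
begin

lemma iid_signs_measurable [measurable_dest]:
  "iid_signs M \<gamma> \<Longrightarrow> \<gamma> i \<in> borel_measurable M"
  by (auto simp: iid_signs_def indep_vars_def)

lemma iid_signs_AE:
  assumes "iid_signs M \<gamma>"
  shows "AE \<omega> in M. \<gamma> i \<omega> = 1 \<or> \<gamma> i \<omega> = -1"
proof -
  note [measurable] = iid_signs_measurable[OF assms]
  have "prob {\<omega>\<in>space M. \<gamma> i \<omega> = 1 \<or> \<gamma> i \<omega> = -1}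
      = prob ({\<omega>\<in>space M. \<gamma> i \<omega> = 1} \<union> {\<omega>\<in>space M. \<gamma> i \<omega> = -1})"
    by (rule arg_cong[where f=prob]) auto
  also have "\<dots> = prob {\<omega>\<in>space M. \<gamma> i \<omega> = 1} + prob {\<omega>\<in>space M. \<gamma> i \<omega> = -1}"
    by (rule finite_measure_Union) auto
  also have "\<dots> = 1"
  proof -
    have "prob {\<omega>\<in>space M. \<gamma> i \<omega> = 1} = 1/2" "prob {\<omega>\<in>space M. \<gamma> i \<omega> = -1} = 1/2"
      using assms unfolding iid_signs_def by blast+
    then show ?thesis by simp
  qed
  finally show ?thesis by (subst (asm) prob_Collect_eq_1) auto
qed

lemma iid_signs_prob:
  assumes "iid_signs M \<gamma>" and [measurable]: "A \<in> sets borel"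
  shows "prob {\<omega>\<in>space M. \<gamma> i \<omega> \<in> A} = (indicator A 1 + indicator A (-1)) / 2"
proof -
  note [measurable] = iid_signs_measurable[OF assms(1)]
  have "prob {\<omega>\<in>space M. \<gamma> i \<omega> \<in> A}
      = prob ({\<omega>\<in>space M. \<gamma> i \<omega> = 1 \<and> 1 \<in> A} \<union> {\<omega>\<in>space M. \<gamma> i \<omega> = -1 \<and> -1 \<in> A})"
    by (rule finite_measure_eq_AE) (use iid_signs_AE[OF assms(1), of i] in \<open>auto elim!: eventually_mono\<close>)
  also have "\<dots> = prob {\<omega>\<in>space M. \<gamma> i \<omega> = 1 \<and> 1 \<in> A} + prob {\<omega>\<in>space M. \<gamma> i \<omega> = -1 \<and> -1 \<in> A}"
    by (rule finite_measure_Union) auto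
  also have "\<dots> = (indicator A 1 + indicator A (-1)) / 2"
    using assms by (auto simp: iid_signs_def indicator_def)
  finally show ?thesis .
qed

text \<open>Independence makes the law of the whole sequence the product of its marginals, and each
  marginal is symmetric; flipping any set of coordinates thus changes no factor.\<close>

lemma sign_space_distr:
  assumes \<gamma>: "iid_signs M \<gamma>"
  shows "sign_space (distr M (PiM UNIV (\<lambda>_. borel)) (\<lambda>\<omega> i. \<gamma> i \<omega>))"
proof -
  note [measurable] = iid_signs_measurable[OF \<gamma>]
  define L where "L = distr M (PiM UNIV (\<lambda>_. borel)) (\<lambda>\<omega> i. \<gamma> i \<omega>)"
  have m [measurable]: "(\<lambda>\<omega> i. \<gamma> i \<omega>) \<in> M \<rightarrow>\<^sub>M PiM UNIV (\<lambda>_. borel)"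
    by (rule measurable_PiM_single') auto
  have sets: "sets L = sets (PiM UNIV (\<lambda>_. borel))" by (simp add: L_def)
  have law: "distr M (PiM UNIV (\<lambda>_. borel)) (\<lambda>\<omega> i. \<sigma> i * \<gamma> i \<omega>) = L"
    if \<sigma>: "\<And>i. \<sigma> i = 1 \<or> \<sigma> i = -1" for \<sigma>
  proof -
    have indep: "indep_vars (\<lambda>_. borel) (\<lambda>i \<omega>. \<tau> i * \<gamma> i \<omega>) UNIV" for \<tau>
    proof -
      have "indep_vars (\<lambda>_. borel) \<gamma> UNIV" using \<gamma> by (simp add: iid_signs_def)
      then show ?thesis by (rule indep_vars_compose2[where Y="\<lambda>i x. \<tau> i * x"]) simp
    qed
    have pm: "distr M (PiM UNIV (\<lambda>_. borel)) (\<lambda>\<omega> i. \<tau> i * \<gamma> i \<omega>)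
        = PiM UNIV (\<lambda>i. distr M borel (\<lambda>\<omega>. \<tau> i * \<gamma> i \<omega>))" for \<tau>
      using indep_vars_iff_distr_eq_PiM[of UNIV "\<lambda>i \<omega>. \<tau> i * \<gamma> i \<omega>" "\<lambda>_. borel", THEN iffD1, OF _ _ indep]
      by (simp add: restrict_def)
    have "distr M borel (\<lambda>\<omega>. \<sigma> i * \<gamma> i \<omega>) = distr M borel (\<lambda>\<omega>. 1 * \<gamma> i \<omega>)" for i
    proof (rule measure_eqI)
      fix A assume "A \<in> sets (distr M borel (\<lambda>\<omega>. \<sigma> i * \<gamma> i \<omega>))"
      then have A: "A \<in> sets borel" by simp
      then have A': "uminus -` A \<in> sets borel"
        using measurable_sets[OF borel_measurable_uminus[OF measurable_ident], of A] by simp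
      have "prob {\<omega>\<in>space M. \<sigma> i * \<gamma> i \<omega> \<in> A} = prob {\<omega>\<in>space M. \<gamma> i \<omega> \<in> A}"
        using \<sigma>[of i] iid_signs_prob[OF \<gamma> A, of i] iid_signs_prob[OF \<gamma> A', of i]
        by (auto simp: indicator_def)
      then show "emeasure (distr M borel (\<lambda>\<omega>. \<sigma> i * \<gamma> i \<omega>)) A = emeasure (distr M borel (\<lambda>\<omega>. 1 * \<gamma> i \<omega>)) A"
        using A by (simp add: emeasure_distr emeasure_eq_measure vimage_def Int_def conj_commute)
    qed simp
    then show ?thesis using pm[of \<sigma>] pm[of "\<lambda>_. 1"] by (simp add: L_def)
  qed
  interpret L: prob_space L unfolding L_def by (rule prob_space_distr) simp
  have "sign_space L"
  proof
    show "sets L = sets (PiM UNIV (\<lambda>_. borel))" by (rule sets)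
    show "distr L L (\<lambda>x i. \<sigma> i * x i) = L" if \<sigma>: "\<And>i. \<sigma> i = 1 \<or> \<sigma> i = -1" for \<sigma>
    proof -
      have fm: "(\<lambda>x i. \<sigma> i * x i) \<in> PiM UNIV (\<lambda>_. borel) \<rightarrow>\<^sub>M PiM UNIV (\<lambda>_. borel)"
        by (rule measurable_PiM_single') auto
      have "distr L L (\<lambda>x i. \<sigma> i * x i) = distr L (PiM UNIV (\<lambda>_. borel)) (\<lambda>x i. \<sigma> i * x i)"
        by (rule distr_cong) (auto simp: sets)
      also have "\<dots> = distr M (PiM UNIV (\<lambda>_. borel)) (\<lambda>\<omega> i. \<sigma> i * \<gamma> i \<omega>)"
        unfolding L_def by (subst distr_distr[OF fm m]) (simp add: comp_def)
      finally show ?thesis using law[OF \<sigma>] by simp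
    qed
    show "AE x in L. \<forall>i. x i = 1 \<or> x i = -1"
      unfolding L_def AE_all_countable
    proof
      fix i
      show "AE x in distr M (PiM UNIV (\<lambda>_. borel)) (\<lambda>\<omega> i. \<gamma> i \<omega>). x i = 1 \<or> x i = -1"
        by (subst AE_distr_iff) (use iid_signs_AE[OF \<gamma>] in auto)
    qed
  qed
  then show ?thesis by (simp add: L_def)
qed

section \<open>Linear growth of the arrival times\<close>

lemma arrival_eq_sum_waiting_time: "\<Gamma> i \<omega> = (\<Sum>j\<le>i. waiting_time \<Gamma> j \<omega>)"
  by (induction i) (auto simp: waiting_time_def)

lemma unit_poisson_arrivals_measurable:
  assumes "unit_poisson_arrivals M \<Gamma>"
  shows "\<Gamma> i \<in> borel_measurable M"
proof -
  have [measurable]: "waiting_time \<Gamma> i \<in> borel_measurable M" for i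
    using assms by (auto simp: unit_poisson_arrivals_def iid_law_def indep_vars_def)
  have "(\<lambda>\<omega>. \<Sum>j\<le>i. waiting_time \<Gamma> j \<omega>) \<in> borel_measurable M" by measurable
  also have "(\<lambda>\<omega>. \<Sum>j\<le>i. waiting_time \<Gamma> j \<omega>) = \<Gamma> i"
    using arrival_eq_sum_waiting_time[of \<Gamma> i] by auto
  finally show ?thesis .
qed

text \<open>Exponential tilting: \<open>exp (s * x)\<close> times the density of rate 1 is
  \<open>1 / (1 - s)\<close> times the density of rate \<open>1 - s\<close>, which has mass
  1.\<close>

lemma nn_integral_exp_exponential:
  assumes "s < 1"
  shows "(\<integral>\<^sup>+x. ennreal (exp (s * x)) \<partial>density lborel (exponential_density 1)) = ennreal (1 / (1 - s))"
proof -
  interpret E: prob_space "density lborel (exponential_density (1 - s))"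
    using assms by (intro prob_space_exponential_density) auto
  have "(\<integral>\<^sup>+x. ennreal (exp (s * x)) \<partial>density lborel (exponential_density 1))
      = (\<integral>\<^sup>+x. ennreal (exponential_density 1 x) * ennreal (exp (s * x)) \<partial>lborel)"
    by (subst nn_integral_density) auto
  also have "\<dots> = (\<integral>\<^sup>+x. ennreal (1 / (1 - s)) * ennreal (exponential_density (1 - s) x) \<partial>lborel)"
  proof (rule nn_integral_cong)
    fix x :: real
    have "exp (- x * 1) * exp (s * x) = exp (- x * (1 - s))"
      by (simp add: algebra_simps flip: exp_add)
    then have "exponential_density 1 x * exp (s * x) = 1 / (1 - s) * exponential_density (1 - s) x"
      using assms by (simp add: exponential_density_def)
    then show "ennreal (exponential_density 1 x) * ennreal (exp (s * x))
        = ennreal (1 / (1 - s)) * ennreal (exponential_density (1 - s) x)"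
      using assms by (simp only: ennreal_mult''[symmetric] exp_ge_zero exponential_density_nonneg diff_gt_0_iff_gt)
  qed
  also have "\<dots> = ennreal (1 / (1 - s)) * emeasure (density lborel (exponential_density (1 - s))) UNIV"
    by (subst nn_integral_cmult) (auto simp: emeasure_density)
  also have "\<dots> = ennreal (1 / (1 - s))" using E.emeasure_space_1 by simp
  finally show ?thesis .
qed

text \<open>Positive \<open>s\<close> gives the upper tail of \<open>\<Gamma> i\<close>, negative \<open>s\<close> the lower tail.\<close>

lemma arrival_Chernoff:
  assumes \<Gamma>: "unit_poisson_arrivals M \<Gamma>" and s: "s < 1"
  shows "prob {\<omega>\<in>space M. s * x \<le> s * \<Gamma> i \<omega>} \<le> (1 / (1 - s)) ^ Suc i * exp (- s * x)"
proof -
  note [measurable] = unit_poisson_arrivals_measurable[OF \<Gamma>]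
  have W: "indep_vars (\<lambda>_. density lborel (exponential_density 1)) (waiting_time \<Gamma>) UNIV"
    and dW: "distr M (density lborel (exponential_density 1)) (waiting_time \<Gamma> j) = density lborel (exponential_density 1)" for j
    using \<Gamma> by (auto simp: unit_poisson_arrivals_def iid_law_def)
  have mW [measurable]: "waiting_time \<Gamma> j \<in> M \<rightarrow>\<^sub>M density lborel (exponential_density 1)" for j
    using W by (auto simp: indep_vars_def)
  have mW' [measurable]: "waiting_time \<Gamma> j \<in> borel_measurable M" for j
    using mW[of j] by simp
  have "emeasure M {\<omega>\<in>space M. s * x \<le> s * \<Gamma> i \<omega>}
      \<le> emeasure M {\<omega>\<in>space M. 1 \<le> ennreal (exp (- s * x)) * ennreal (exp (s * \<Gamma> i \<omega>))}"
    by (intro emeasure_mono) (auto simp: ennreal_mult'[symmetric] mult_exp_exp simp flip: ennreal_1)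
  also have "\<dots> \<le> ennreal (exp (- s * x)) * (\<integral>\<^sup>+\<omega>. ennreal (exp (s * \<Gamma> i \<omega>)) * indicator (space M) \<omega> \<partial>M)"
    by (rule nn_integral_Markov_inequality) auto
  also have "(\<integral>\<^sup>+\<omega>. ennreal (exp (s * \<Gamma> i \<omega>)) * indicator (space M) \<omega> \<partial>M)
      = (\<integral>\<^sup>+\<omega>. (\<Prod>j\<le>i. ennreal (exp (s * waiting_time \<Gamma> j \<omega>))) \<partial>M)"
    by (intro nn_integral_cong)
       (simp add: arrival_eq_sum_waiting_time[of \<Gamma> i] sum_distrib_left exp_sum prod_ennreal)
  also have "\<dots> = (\<Prod>j\<le>i. \<integral>\<^sup>+\<omega>. ennreal (exp (s * waiting_time \<Gamma> j \<omega>)) \<partial>M)"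
  proof (rule indep_vars_nn_integral)
    show "indep_vars (\<lambda>_. borel) (\<lambda>j \<omega>. ennreal (exp (s * waiting_time \<Gamma> j \<omega>))) {..i}"
      using indep_vars_subset[OF W, of "{..i}"] by (rule indep_vars_compose2) auto
  qed auto
  also have "\<dots> = (\<Prod>j\<le>i. \<integral>\<^sup>+y. ennreal (exp (s * y)) \<partial>distr M (density lborel (exponential_density 1)) (waiting_time \<Gamma> j))"
    by (intro prod.cong refl) (subst nn_integral_distr, auto)
  also have "\<dots> = ennreal ((1 / (1 - s)) ^ Suc i)"
    unfolding dW nn_integral_exp_exponential[OF s] using s by (simp add: ennreal_power del: power_Suc)
  also have "ennreal (exp (- s * x)) * \<dots> = ennreal ((1 / (1 - s)) ^ Suc i * exp (- s * x))"
    using s by (simp add: ennreal_mult'[symmetric] mult.commute del: power_Suc)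
  finally show ?thesis
    using s by (subst (asm) emeasure_eq_measure) (subst (asm) ennreal_le_iff, auto)
qed

text \<open>Levels \<open>x i\<close> that grow linearly turn the Chernoff bound into a geometric
  sequence, and Borel--Cantelli applies. The sign of \<open>s\<close> decides which side is
  excluded.\<close>

lemma AE_arrival_Chernoff:
  fixes x :: "nat \<Rightarrow> real"
  assumes \<Gamma>: "unit_poisson_arrivals M \<Gamma>" and s: "s < 1"
    and q: "0 \<le> q" "q < 1" "\<And>i. (1 / (1 - s)) ^ Suc i * exp (- s * x i) = q ^ Suc i"
  shows "AE \<omega> in M. \<forall>\<^sub>F i in sequentially. \<not> s * x i \<le> s * \<Gamma> i \<omega>"
proof -
  note [measurable] = unit_poisson_arrivals_measurable[OF \<Gamma>]
  have "AE \<omega> in M. \<forall>\<^sub>F i in sequentially. \<omega> \<in> space M - {\<omega>\<in>space M. s * x i \<le> s * \<Gamma> i \<omega>}"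
  proof (rule borel_cantelli_AE1)
    show "summable (\<lambda>i. prob {\<omega>\<in>space M. s * x i \<le> s * \<Gamma> i \<omega>})"
    proof (rule summable_comparison_test')
      show "summable (\<lambda>i. q ^ Suc i)" using q by (subst summable_Suc_iff) (auto intro: summable_geometric)
      show "norm (prob {\<omega>\<in>space M. s * x i \<le> s * \<Gamma> i \<omega>}) \<le> q ^ Suc i" for i
        using arrival_Chernoff[OF \<Gamma> s, of "x i" i] q(3)[of i] by simp
    qed
  qed (auto simp: emeasure_eq_measure)
  then show ?thesis by eventually_elim (auto elim!: eventually_mono)
qed

text \<open>The constants leave room around the true rate 1 for simple tilts: \<open>s = 1/2\<close>
  gives the ratio \<open>2 * exp (- 2)\<close> above, and \<open>s = - 1\<close> the ratio
  \<open>exp (1 / 2) / 2\<close> below, both less than 1.\<close>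

lemma AE_arrivals_linear:
  fixes \<Gamma> :: "nat \<Rightarrow> 'a \<Rightarrow> real"
  assumes \<Gamma>: "unit_poisson_arrivals M \<Gamma>"
  shows "AE \<omega> in M. \<forall>\<^sub>F i in sequentially. Suc i / 2 \<le> \<Gamma> i \<omega> \<and> \<Gamma> i \<omega> \<le> 4 * Suc i"
proof -
  note [measurable] = unit_poisson_arrivals_measurable[OF \<Gamma>]
  have "AE \<omega> in M. \<forall>\<^sub>F i in sequentially. \<not> (1 / 2) * (4 * real (Suc i)) \<le> (1 / 2) * \<Gamma> i \<omega>"
  proof (rule AE_arrival_Chernoff[OF \<Gamma>, where q="2 * exp (- 2)"])
    have "(2::real) < exp 2" using exp_ge_add_one_self[of 2] by simp
    then show "2 * exp (- 2) < (1::real)" by (simp add: exp_minus field_simps)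
    show "(1 / (1 - 1 / 2)) ^ Suc i * exp (- (1 / 2) * (4 * real (Suc i))) = (2 * exp (- 2) :: real) ^ Suc i" for i
      using exp_of_nat_mult[of "Suc i" "-2 :: real"] by (simp add: power_mult_distrib mult.commute del: power_Suc of_nat_Suc)
  qed auto
  moreover have "AE \<omega> in M. \<forall>\<^sub>F i in sequentially. \<not> (- 1) * (real (Suc i) / 2) \<le> (- 1) * \<Gamma> i \<omega>"
  proof (rule AE_arrival_Chernoff[OF \<Gamma>, where q="exp (1 / 2) / 2"])
    have "exp (1 / 2) ^ 2 < (2::real) ^ 2" using exp_le by (simp add: power2_eq_square mult_exp_exp)
    then have "exp (1 / 2) < (2::real)" by (rule power2_less_imp_less) simp
    then show "exp (1 / 2) / 2 < (1::real)" by simp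
    show "(1 / (1 - - 1)) ^ Suc i * exp (- (- 1) * (real (Suc i) / 2)) = (exp (1 / 2) / 2 :: real) ^ Suc i" for i
      using exp_of_nat_mult[of "Suc i" "1 / 2 :: real"] by (simp add: power_divide mult.commute del: power_Suc of_nat_Suc)
  qed auto
  ultimately show ?thesis
  proof eventually_elim
    case (elim \<omega>)
    then show ?case by eventually_elim auto
  qed
qed

lemma prob_arrivals_linear_tendsto:
  fixes \<Gamma> :: "nat \<Rightarrow> 'a \<Rightarrow> real"
  assumes \<Gamma>: "unit_poisson_arrivals M \<Gamma>"
  shows "(\<lambda>n. prob {\<omega>\<in>space M. \<forall>i\<ge>n. Suc i / 2 \<le> \<Gamma> i \<omega> \<and> \<Gamma> i \<omega> \<le> 4 * Suc i}) \<longlonglongrightarrow> 1"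
proof -
  note [measurable] = unit_poisson_arrivals_measurable[OF \<Gamma>]
  define E where "E n = {\<omega>\<in>space M. \<forall>i\<in>{n..}. Suc i / 2 \<le> \<Gamma> i \<omega> \<and> \<Gamma> i \<omega> \<le> 4 * Suc i}" for n
  have [measurable]: "E n \<in> events" for n unfolding E_def by measurable
  have "(\<lambda>n. prob (E n)) \<longlonglongrightarrow> prob (\<Union>n. E n)"
    by (rule finite_Lim_measure_incseq) (auto simp: incseq_def E_def)
  also have "prob (\<Union>n. E n) = 1"
  proof (rule prob_eq_1[THEN iffD2])
    show "AE \<omega> in M. \<omega> \<in> (\<Union>n. E n)"
      using AE_arrivals_linear[OF \<Gamma>] AE_space
      by eventually_elim (auto simp: E_def eventually_sequentially)
  qed auto
  finally show ?thesis by (simp add: E_def atLeast_def)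
qed

section \<open>Counts and sums over independent marks\<close>

text \<open>Markov's inequality for 2 to the power of minus the count. \<open>Y i\<close> is 1/2 on
  \<open>B i\<close> and 1 elsewhere, so by independence the expectation is a product of factors
  \<open>1 - measure \<mu> (B i) / 2\<close>, each at most an exponential.\<close>

lemma prob_count_lt_le:
  assumes V: "iid_law M \<mu> V" and B [measurable]: "\<And>i. B i \<in> sets \<mu>"
  shows "prob {\<omega>\<in>space M. card {i. i < n \<and> V i \<omega> \<in> B i} < N} \<le> 2 ^ N * exp (- (\<Sum>i<n. measure \<mu> (B i)) / 2)"
proof -
  have V1: "indep_vars (\<lambda>_. \<mu>) V UNIV" and dV: "distr M \<mu> (V i) = \<mu>" for i
    using V by (auto simp: iid_law_def)
  have mV [measurable]: "V i \<in> M \<rightarrow>\<^sub>M \<mu>" for i using V1 by (auto simp: indep_vars_def)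
  interpret \<mu>: prob_space \<mu> using prob_space_distr[OF mV[of 0]] by (simp add: dV)
  define Y where "Y i v = 1 - indicator (B i) v / (2::real)" for i v
  have [measurable]: "Y i \<in> borel_measurable \<mu>" for i unfolding Y_def [abs_def] by measurable
  have Y01: "0 \<le> Y i v" "Y i v \<le> 1" for i v by (auto simp: Y_def indicator_def)
  have card: "(\<Prod>i<n. Y i (V i \<omega>)) = (1 / 2) ^ card {i. i < n \<and> V i \<omega> \<in> B i}" for \<omega>
  proof -
    have "(\<Prod>i<n. Y i (V i \<omega>)) = (\<Prod>i<n. if V i \<omega> \<in> B i then 1 / 2 else 1)"
      by (intro prod.cong) (auto simp: Y_def)
    also have "\<dots> = (1 / 2) ^ card {i. i < n \<and> V i \<omega> \<in> B i}"
      by (subst prod.If_cases) (auto simp: Int_def)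
    finally show ?thesis .
  qed
  have int: "integrable M (\<lambda>\<omega>. Y i (V i \<omega>))" for i
    by (rule integrable_const_bound[where B=1]) (use Y01 in auto)
  have indep: "indep_vars (\<lambda>_. borel) (\<lambda>i \<omega>. Y i (V i \<omega>)) {..<n}"
    using indep_vars_subset[OF V1, of "{..<n}"] by (rule indep_vars_compose2) auto
  have EY: "expectation (\<lambda>\<omega>. Y i (V i \<omega>)) = 1 - measure \<mu> (B i) / 2" for i
  proof -
    have "expectation (\<lambda>\<omega>. Y i (V i \<omega>)) = (\<integral>v. Y i v \<partial>distr M \<mu> (V i))"
      by (subst integral_distr) auto
    also have "\<dots> = 1 - measure \<mu> (B i) / 2"
      unfolding dV Y_def by (subst Bochner_Integration.integral_diff)
        (auto simp: \<mu>.emeasure_eq_measure \<mu>.prob_space)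
    finally show ?thesis .
  qed
  have "prob {\<omega>\<in>space M. card {i. i < n \<and> V i \<omega> \<in> B i} < N}
      \<le> prob {\<omega>\<in>space M. (1 / 2) ^ N \<le> (\<Prod>i<n. Y i (V i \<omega>))}"
  proof (rule finite_measure_mono)
    show "{\<omega>\<in>space M. card {i. i < n \<and> V i \<omega> \<in> B i} < N} \<subseteq> {\<omega>\<in>space M. (1 / 2) ^ N \<le> (\<Prod>i<n. Y i (V i \<omega>))}"
      unfolding card by (auto intro!: power_decreasing)
  qed measurable
  also have "\<dots> \<le> expectation (\<lambda>\<omega>. \<Prod>i<n. Y i (V i \<omega>)) / (1 / 2) ^ N"
    by (intro integral_Markov_inequality_measure[where A="{}"] indep_vars_integrable indep int)
       (auto intro!: prod_nonneg Y01)
  also have "expectation (\<lambda>\<omega>. \<Prod>i<n. Y i (V i \<omega>)) = (\<Prod>i<n. 1 - measure \<mu> (B i) / 2)"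
    by (subst indep_vars_lebesgue_integral[OF _ indep int]) (auto simp: EY)
  also have "\<dots> \<le> (\<Prod>i<n. exp (- measure \<mu> (B i) / 2))"
  proof (rule prod_mono)
    fix i
    show "0 \<le> 1 - measure \<mu> (B i) / 2 \<and> 1 - measure \<mu> (B i) / 2 \<le> exp (- measure \<mu> (B i) / 2)"
      using \<mu>.prob_le_1[of "B i"] exp_ge_add_one_self[of "- measure \<mu> (B i) / 2"]
      by (intro conjI) linarith+
  qed
  also have "\<dots> = exp (- (\<Sum>i<n. measure \<mu> (B i)) / 2)"
    by (simp add: exp_sum sum_negf sum_divide_distrib flip: exp_sum)
  finally show ?thesis by (simp add: divide_right_mono power_one_over field_simps)
qed

end

text \<open>The tail of the series is compared blockwise with \<open>\<Sum>k. k powr - q\<close>, using blocks of length \<open>\<lfloor>z\<rfloor> + 1\<close>.\<close>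

lemma sum_min_powr_le:
  fixes q z :: real
  assumes q: "1 < q" and z: "0 \<le> z"
  shows "(\<Sum>i<n. min 1 ((z / real (Suc i)) powr q)) \<le> (1 + (\<Sum>k. real k powr - q)) * (z + 1)"
proof -
  define m where "m = nat \<lfloor>z\<rfloor> + 1"
  define t where "t i = min 1 ((z / real (Suc i)) powr q)" for i
  \<comment> \<open>Block 0 is controlled by the truncation at 1. It needs its own value, since
    \<open>0 powr - q\<close> is 0 and the series contributes nothing there.\<close>
  define g where "g k = (if k = 0 then 1 else real k powr - q)" for k :: nat
  have m: "z \<le> real m" "real m \<le> z + 1" "0 < m" using z unfolding m_def by linarith+
  have summ: "summable (\<lambda>k. real k powr - q)" using q by (simp add: summable_real_powr_iff)
  have t_nonneg: "0 \<le> t i" for i by (simp add: t_def)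
  have t_le: "t i \<le> g k" if i: "k * m \<le> i" for i k
  proof (cases "k = 0")
    case False
    have "z / real (Suc i) \<le> real m / real (k * m)"
      using m False of_nat_mono[OF i, where ?'a=real] z by (intro frac_le) auto
    also have "\<dots> = 1 / real k" using m by simp
    finally have "(z / real (Suc i)) powr q \<le> (1 / real k) powr q"
      using z q by (intro powr_mono2) auto
    also have "\<dots> = real k powr - q" by (simp add: powr_divide powr_minus_divide)
    finally show ?thesis using False by (simp add: t_def g_def)
  qed (simp add: t_def g_def)
  have "(\<Sum>i<n. t i) \<le> (\<Sum>i<n * m. t i)"
    using m t_nonneg by (intro sum_mono2) auto
  also have "\<dots> = (\<Sum>k<n. \<Sum>i=k * m..<k * m + m. t i)"
    by (rule sum.nat_group[symmetric])
  also have "\<dots> \<le> (\<Sum>k<n. \<Sum>i=k * m..<k * m + m. g k)"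
    by (intro sum_mono t_le) auto
  also have "\<dots> = real m * (\<Sum>k<n. g k)" by (simp add: sum_distrib_left)
  also have "(\<Sum>k<n. g k) \<le> (\<Sum>k<n. (if k = 0 then 1 else 0) + real k powr - q)"
    by (intro sum_mono) (auto simp: g_def)
  also have "\<dots> \<le> 1 + (\<Sum>k<n. real k powr - q)"
    by (simp add: sum.distrib)
  also have "(\<Sum>k<n. real k powr - q) \<le> (\<Sum>k. real k powr - q)"
    by (rule sum_le_suminf[OF summ]) auto
  also have "real m * (1 + (\<Sum>k. real k powr - q)) \<le> (z + 1) * (1 + (\<Sum>k. real k powr - q))"
    using m suminf_nonneg[OF summ] by (intro mult_right_mono) auto
  finally show ?thesis using m by (simp add: t_def mult.commute mult_left_mono)
qed

text \<open>Only a first moment of \<open>z\<close> is available, although the power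
  \<open>q\<close> exceeds 1. Truncating the terms at 1 makes the expected sum linear in that
  moment.\<close>

lemma (in prob_space) AE_summable_iid_powr:
  fixes z :: "'b \<Rightarrow> real"
  assumes V: "iid_law M \<mu> V" and z [measurable]: "z \<in> borel_measurable \<mu>" and z0: "\<And>v. v \<in> space \<mu> \<Longrightarrow> 0 \<le> z v"
    and fin: "(\<integral>\<^sup>+v. ennreal (z v) \<partial>\<mu>) < \<infinity>" and q: "1 < q"
  shows "AE \<omega> in M. summable (\<lambda>i. (z (V i \<omega>) / real (Suc i)) powr q)"
proof -
  have dV: "distr M \<mu> (V i) = \<mu>" for i
    using V by (auto simp: iid_law_def)
  have mV [measurable]: "V i \<in> M \<rightarrow>\<^sub>M \<mu>" for i using V by (auto simp: iid_law_def indep_vars_def)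
  interpret \<mu>: prob_space \<mu> using prob_space_distr[OF mV[of 0]] by (simp add: dV)
  define t where "t i v = min 1 ((z v / real (Suc i)) powr q)" for i v
  define C where "C = 1 + (\<Sum>k. real k powr - q)"
  have C: "0 \<le> C" using q suminf_nonneg[of "\<lambda>k. real k powr - q"] by (simp add: C_def summable_real_powr_iff)
  have [measurable]: "t i \<in> borel_measurable \<mu>" for i unfolding t_def [abs_def] by measurable
  have "(\<integral>\<^sup>+\<omega>. (\<Sum>i. ennreal (t i (V i \<omega>))) \<partial>M) = (\<Sum>i. \<integral>\<^sup>+\<omega>. ennreal (t i (V i \<omega>)) \<partial>M)"
    by (rule nn_integral_suminf) simp
  also have "\<dots> = (\<Sum>i. \<integral>\<^sup>+v. ennreal (t i v) \<partial>\<mu>)"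
  proof (rule suminf_cong)
    fix i
    have "(\<integral>\<^sup>+\<omega>. ennreal (t i (V i \<omega>)) \<partial>M) = (\<integral>\<^sup>+v. ennreal (t i v) \<partial>distr M \<mu> (V i))"
      by (simp add: nn_integral_distr)
    then show "(\<integral>\<^sup>+\<omega>. ennreal (t i (V i \<omega>)) \<partial>M) = (\<integral>\<^sup>+v. ennreal (t i v) \<partial>\<mu>)" by (simp only: dV)
  qed
  also have "\<dots> = (\<integral>\<^sup>+v. (\<Sum>i. ennreal (t i v)) \<partial>\<mu>)"
    by (rule nn_integral_suminf[symmetric]) simp
  also have "\<dots> \<le> (\<integral>\<^sup>+v. ennreal C * (ennreal (z v) + 1) \<partial>\<mu>)"
  proof (rule nn_integral_mono)
    fix v assume v: "v \<in> space \<mu>"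
    show "(\<Sum>i. ennreal (t i v)) \<le> ennreal C * (ennreal (z v) + 1)"
    proof (rule suminf_le_const[OF summableI])
      fix n
      have "(\<Sum>i<n. ennreal (t i v)) = ennreal (\<Sum>i<n. t i v)"
        by (rule sum_ennreal) (simp add: t_def)
      also have "\<dots> \<le> ennreal (C * (z v + 1))"
        using sum_min_powr_le[OF q z0[OF v], of n] by (intro ennreal_leI) (simp add: t_def C_def)
      also have "\<dots> = ennreal C * (ennreal (z v) + 1)"
        using C z0[OF v] by (simp add: ennreal_mult flip: ennreal_1 ennreal_plus)
      finally show "(\<Sum>i<n. ennreal (t i v)) \<le> ennreal C * (ennreal (z v) + 1)" .
    qed
  qed
  also have "\<dots> = ennreal C * ((\<integral>\<^sup>+v. ennreal (z v) \<partial>\<mu>) + 1)"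
    by (simp add: nn_integral_cmult nn_integral_add \<mu>.emeasure_space_1)
  also have "\<dots> < \<infinity>" using fin by (simp add: ennreal_mult_less_top)
  finally have "AE \<omega> in M. (\<Sum>i. ennreal (t i (V i \<omega>))) \<noteq> \<infinity>"
    by (intro nn_integral_PInf_AE) auto
  then show ?thesis
  proof eventually_elim
    case (elim \<omega>)
    then have s: "summable (\<lambda>i. t i (V i \<omega>))"
      by (intro summable_suminf_not_top) (auto simp: t_def)
    \<comment> \<open>Terms of a convergent series are eventually below 1, and there the truncation
      is inactive.\<close>
    have "\<forall>\<^sub>F i in sequentially. t i (V i \<omega>) < 1"
      using summable_LIMSEQ_zero[OF s] by (intro order_tendstoD) auto
    then have "\<forall>\<^sub>F i in sequentially. norm ((z (V i \<omega>) / real (Suc i)) powr q) \<le> t i (V i \<omega>)"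
      by eventually_elim (auto simp: t_def)
    then show ?case using s by (rule summable_comparison_test_ev)
  qed
qed

section \<open>The product law of signs and coefficients\<close>

text \<open>Independence of three sigma-algebras is regrouped into two blocks, the signs against the
  sigma-algebra generated by arrival times and marks together. The latter makes the pair of
  sequences measurable into the product space.\<close>

lemma driving_sequences_prob_Int:
  fixes M :: "'w measure" and \<mu> :: "'e measure"
  assumes drv: "driving_sequences M \<mu> \<Gamma> V \<gamma>"
    and [measurable]: "\<And>i. \<Gamma> i \<in> borel_measurable M" "\<And>i. V i \<in> M \<rightarrow>\<^sub>M \<mu>" "\<And>i. \<gamma> i \<in> borel_measurable M"
    and A: "A \<in> sets (PiM UNIV (\<lambda>_. borel))"
    and B: "B \<in> sets (PiM UNIV (\<lambda>_. borel) \<Otimes>\<^sub>M PiM UNIV (\<lambda>_. \<mu>))"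
  shows "measure M ((\<lambda>\<omega> i. \<gamma> i \<omega>) -` A \<inter> space M \<inter> ((\<lambda>\<omega>. (\<lambda>i. \<Gamma> i \<omega>, \<lambda>i. V i \<omega>)) -` B \<inter> space M))
    = measure M ((\<lambda>\<omega> i. \<gamma> i \<omega>) -` A \<inter> space M) * measure M ((\<lambda>\<omega>. (\<lambda>i. \<Gamma> i \<omega>, \<lambda>i. V i \<omega>)) -` B \<inter> space M)"
proof -
  interpret prob_space M using drv by (simp add: driving_sequences_def)
  define E where "E k = [events_of_sequence M borel \<Gamma>, events_of_sequence M \<mu> V, events_of_sequence M borel \<gamma>] ! k" for k
  \<comment> \<open>\<open>True\<close> names the block of the signs, at list position 2;
    \<open>False\<close> names the block of positions 0 and 1.\<close>
  define I where "I b = (if b then {2} else {0, 1::nat})" for b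
  have E: "E 0 = events_of_sequence M borel \<Gamma>" "E (Suc 0) = events_of_sequence M \<mu> V" "E 2 = events_of_sequence M borel \<gamma>"
    by (simp_all add: E_def numeral_2_eq_2)
  have un: "(\<Union>b\<in>UNIV. I b) = {..<3}" by (auto simp: I_def UNIV_bool)
  have "indep_sets E (\<Union>b\<in>UNIV. I b)"
    using drv unfolding un driving_sequences_def E_def [abs_def] by blast
  then have ind: "indep_sets (\<lambda>b. sigma_sets (space M) (\<Union>i\<in>I b. E i)) UNIV"
  proof (rule indep_sets_collect_sigma)
    show "Int_stable (E i)" if "b \<in> UNIV" "i \<in> I b" for b i
      using that unfolding Int_stable_def
      by (auto simp: I_def E events_of_sequence_def split: if_splits)
    show "disjoint_family_on I UNIV" by (auto simp: disjoint_family_on_def I_def)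
  qed
  define S where "S = sigma (space M) (E 0 \<union> E (Suc 0))"
  have mm: "(\<lambda>\<omega> i. \<Gamma> i \<omega>) \<in> M \<rightarrow>\<^sub>M PiM UNIV (\<lambda>_. borel)" "(\<lambda>\<omega> i. V i \<omega>) \<in> M \<rightarrow>\<^sub>M PiM UNIV (\<lambda>_. \<mu>)"
    by (auto intro!: measurable_PiM_single' intro: measurable_space[OF assms(3)])
  have sub: "E 0 \<union> E (Suc 0) \<subseteq> Pow (space M)"
    by (auto simp: E events_of_sequence_def dest!: sets.sets_into_space)
  have sS: "space S = space M" "sets S = sigma_sets (space M) (E 0 \<union> E (Suc 0))"
    using sub by (auto simp: S_def)
  have mS: "X \<in> S \<rightarrow>\<^sub>M PiM UNIV (\<lambda>_. N)"
    if "sets (vimage_algebra (space M) X (PiM UNIV (\<lambda>_. N))) \<subseteq> sets S" "X \<in> M \<rightarrow>\<^sub>M PiM UNIV (\<lambda>_. N)"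
    for X :: "'w \<Rightarrow> nat \<Rightarrow> 'x" and N :: "'x measure"
  proof (rule measurableI)
    show "X \<omega> \<in> space (PiM UNIV (\<lambda>_. N))" if "\<omega> \<in> space S" for \<omega>
      using measurable_space[OF \<open>X \<in> M \<rightarrow>\<^sub>M _\<close>] that by (simp add: sS)
    fix A :: "(nat \<Rightarrow> 'x) set" assume "A \<in> sets (PiM UNIV (\<lambda>_. N))"
    then have "X -` A \<inter> space M \<in> sets (vimage_algebra (space M) X (PiM UNIV (\<lambda>_. N)))"
      by (rule in_vimage_algebra)
    then show "X -` A \<inter> space S \<in> sets S" using that by (auto simp: sS)
  qed
  have "(\<lambda>\<omega> i. \<Gamma> i \<omega>) \<in> S \<rightarrow>\<^sub>M PiM UNIV (\<lambda>_. borel)" "(\<lambda>\<omega> i. V i \<omega>) \<in> S \<rightarrow>\<^sub>M PiM UNIV (\<lambda>_. \<mu>)"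
    by (intro mS mm, force simp: sS E events_of_sequence_def)+
  then have "(\<lambda>\<omega>. (\<lambda>i. \<Gamma> i \<omega>, \<lambda>i. V i \<omega>)) \<in> S \<rightarrow>\<^sub>M (PiM UNIV (\<lambda>_. borel) \<Otimes>\<^sub>M PiM UNIV (\<lambda>_. \<mu>))"
    by (rule measurable_Pair)
  from measurable_sets[OF this B] have BS: "(\<lambda>\<omega>. (\<lambda>i. \<Gamma> i \<omega>, \<lambda>i. V i \<omega>)) -` B \<inter> space M \<in> sigma_sets (space M) (\<Union>i\<in>I False. E i)"
    by (simp add: sS I_def)
  have "(\<lambda>\<omega> i. \<gamma> i \<omega>) -` A \<inter> space M \<in> E 2"
    unfolding E events_of_sequence_def by (rule in_vimage_algebra[OF A])
  then have AS: "(\<lambda>\<omega> i. \<gamma> i \<omega>) -` A \<inter> space M \<in> sigma_sets (space M) (\<Union>i\<in>I True. E i)"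
    by (simp add: I_def sigma_sets.Basic)
  show ?thesis
    using indep_setsD[OF ind, of UNIV "\<lambda>b. if b then (\<lambda>\<omega> i. \<gamma> i \<omega>) -` A \<inter> space M
        else (\<lambda>\<omega>. (\<lambda>i. \<Gamma> i \<omega>, \<lambda>i. V i \<omega>)) -` B \<inter> space M"] AS BS
    by (simp add: UNIV_bool Int_commute mult.commute)
qed

text \<open>Conditioning on arrival times and marks in the form of Fubini. The joint law agrees with
  the product of the two laws on rectangles, hence everywhere.\<close>

lemma emeasure_driving_sequences:
  assumes drv: "driving_sequences M \<mu> \<Gamma> V \<gamma>"
    and [measurable]: "\<And>i. \<Gamma> i \<in> borel_measurable M" "\<And>i. V i \<in> M \<rightarrow>\<^sub>M \<mu>" "\<And>i. \<gamma> i \<in> borel_measurable M"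
    and D [measurable]: "D \<in> sets (PiM UNIV (\<lambda>_. borel) \<Otimes>\<^sub>M (PiM UNIV (\<lambda>_. borel) \<Otimes>\<^sub>M PiM UNIV (\<lambda>_. \<mu>)))"
  shows "emeasure M {\<omega>\<in>space M. (\<lambda>i. \<gamma> i \<omega>, \<lambda>i. \<Gamma> i \<omega>, \<lambda>i. V i \<omega>) \<in> D}
    = (\<integral>\<^sup>+\<omega>. emeasure (distr M (PiM UNIV (\<lambda>_. borel)) (\<lambda>\<omega> i. \<gamma> i \<omega>)) {x. (x, \<lambda>i. \<Gamma> i \<omega>, \<lambda>i. V i \<omega>) \<in> D} \<partial>M)"
proof -
  interpret prob_space M using drv by (simp add: driving_sequences_def)
  define L where "L = distr M (PiM UNIV (\<lambda>_. borel)) (\<lambda>\<omega> i. \<gamma> i \<omega>)"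
  define R where "R = PiM (UNIV :: nat set) (\<lambda>_. borel :: real measure) \<Otimes>\<^sub>M PiM (UNIV :: nat set) (\<lambda>_. \<mu>)"
  define q where "q \<omega> = (\<lambda>i. \<Gamma> i \<omega>, \<lambda>i. V i \<omega>)" for \<omega>
  define Q where "Q = distr M R q"
  have m1 [measurable]: "(\<lambda>\<omega> i. \<gamma> i \<omega>) \<in> M \<rightarrow>\<^sub>M PiM UNIV (\<lambda>_. borel)"
    by (rule measurable_PiM_single') auto
  have m2 [measurable]: "q \<in> M \<rightarrow>\<^sub>M R"
    unfolding q_def [abs_def] R_def
    by (intro measurable_Pair measurable_PiM_single') (auto intro: measurable_space[OF assms(3)])
  interpret L: prob_space L unfolding L_def by (rule prob_space_distr) simp
  interpret Q: prob_space Q unfolding Q_def by (rule prob_space_distr) simp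
  interpret LQ: pair_prob_space L Q ..
  have D' [measurable]: "D \<in> sets (PiM UNIV (\<lambda>_. borel) \<Otimes>\<^sub>M R)" using D by (simp add: R_def)
  have sLQ: "sets (L \<Otimes>\<^sub>M Q) = sets (PiM UNIV (\<lambda>_. borel) \<Otimes>\<^sub>M R)"
    by (intro sets_pair_measure_cong) (simp_all add: L_def Q_def)
  have DLQ [measurable]: "D \<in> sets (L \<Otimes>\<^sub>M Q)" using D' sLQ by simp
  have mj: "(\<lambda>\<omega>. (\<lambda>i. \<gamma> i \<omega>, q \<omega>)) \<in> M \<rightarrow>\<^sub>M (PiM UNIV (\<lambda>_. borel) \<Otimes>\<^sub>M R)"
    using m1 m2 by (rule measurable_Pair)
  have joint: "L \<Otimes>\<^sub>M Q = distr M (PiM UNIV (\<lambda>_. borel) \<Otimes>\<^sub>M R) (\<lambda>\<omega>. (\<lambda>i. \<gamma> i \<omega>, q \<omega>))"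
  proof (rule pair_measure_eqI)
    fix A B assume "A \<in> sets L" "B \<in> sets Q"
    then have AB [measurable]: "A \<in> sets (PiM UNIV (\<lambda>_. borel))" "B \<in> sets R" by (simp_all add: L_def Q_def)
    have "emeasure (distr M (PiM UNIV (\<lambda>_. borel) \<Otimes>\<^sub>M R) (\<lambda>\<omega>. (\<lambda>i. \<gamma> i \<omega>, q \<omega>))) (A \<times> B)
        = emeasure M ((\<lambda>\<omega> i. \<gamma> i \<omega>) -` A \<inter> space M \<inter> (q -` B \<inter> space M))"
      by (subst emeasure_distr[OF mj]) (auto intro!: arg_cong[where f="emeasure M"])
    also have "\<dots> = emeasure M ((\<lambda>\<omega> i. \<gamma> i \<omega>) -` A \<inter> space M) * emeasure M (q -` B \<inter> space M)"
      using driving_sequences_prob_Int[OF drv assms(2,3,4), of A B] AB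
      by (simp add: emeasure_eq_measure ennreal_mult'[symmetric] R_def q_def [abs_def])
    finally show "emeasure L A * emeasure Q B
        = emeasure (distr M (PiM UNIV (\<lambda>_. borel) \<Otimes>\<^sub>M R) (\<lambda>\<omega>. (\<lambda>i. \<gamma> i \<omega>, q \<omega>))) (A \<times> B)"
      by (simp add: L_def Q_def emeasure_distr)
  qed (use L.sigma_finite_measure_axioms Q.sigma_finite_measure_axioms sLQ in auto)
  have "emeasure M {\<omega>\<in>space M. (\<lambda>i. \<gamma> i \<omega>, q \<omega>) \<in> D} = emeasure (L \<Otimes>\<^sub>M Q) D"
    unfolding joint by (subst emeasure_distr[OF mj D']) (auto intro!: arg_cong[where f="emeasure M"])
  also have "\<dots> = (\<integral>\<^sup>+y. emeasure L ((\<lambda>x. (x, y)) -` D) \<partial>Q)"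
    by (rule LQ.emeasure_pair_measure_alt2[OF DLQ])
  also have "\<dots> = (\<integral>\<^sup>+\<omega>. emeasure L ((\<lambda>x. (x, q \<omega>)) -` D) \<partial>M)"
    unfolding Q_def
  proof (rule nn_integral_distr[OF m2])
    have "(\<lambda>y. emeasure L ((\<lambda>x. (x, y)) -` D)) \<in> borel_measurable Q"
      by (rule LQ.measurable_emeasure_Pair2[OF DLQ])
    then show "(\<lambda>y. emeasure L ((\<lambda>x. (x, y)) -` D)) \<in> borel_measurable (distr M R q)"
      by (simp add: Q_def)
  qed
  finally show ?thesis by (simp add: q_def L_def vimage_def)
qed

section \<open>Coefficients of the increment\<close>

lemma eventually_le_powr_at_right_0:
  fixes p \<epsilon> C :: real
  assumes "0 < p" "0 < \<epsilon>"
  shows "\<forall>\<^sub>F r in at_right 0. C * r powr p < \<epsilon>"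
proof -
  have "((\<lambda>r. r powr p) \<longlongrightarrow> 0 powr p) (at_right 0)"
    using assms by (intro tendsto_powr' tendsto_const) (auto intro: eventually_at_right_less eventually_mono simp: eventually_at_filter)
  then have "((\<lambda>r. C * r powr p) \<longlongrightarrow> C * 0) (at_right 0)"
    using assms by (intro tendsto_mult tendsto_const) simp
  then show ?thesis using assms by (intro order_tendstoD) auto
qed

lemma lipschitz_at_right:
  assumes "lipschitz_at \<phi> t"
  obtains K where "0 \<le> K" "\<forall>\<^sub>F r in at_right 0. \<bar>\<phi> (t + r) - \<phi> t\<bar> \<le> K * r"
proof -
  obtain K where K: "\<forall>\<^sub>F y in nhds t. \<bar>\<phi> y - \<phi> t\<bar> \<le> K * \<bar>y - t\<bar>"
    using assms by (auto simp: lipschitz_at_def)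
  have "((\<lambda>r. t + r) \<longlongrightarrow> t + 0) (at_right 0)"
    by (intro tendsto_intros)
  then have "\<forall>\<^sub>F r in at_right 0. \<bar>\<phi> (t + r) - \<phi> t\<bar> \<le> K * \<bar>t + r - t\<bar>"
    by (intro eventually_compose_filterlim[OF K]) simp
  moreover have "\<forall>\<^sub>F r::real in at_right 0. 0 < r" by (rule eventually_at_right_less)
  ultimately have "\<forall>\<^sub>F r in at_right 0. \<bar>\<phi> (t + r) - \<phi> t\<bar> \<le> \<bar>K\<bar> * r"
  proof eventually_elim
    case (elim r)
    have "K * r \<le> \<bar>K\<bar> * r" using elim by (intro mult_right_mono) auto
    with elim show ?case by (smt (verit))
  qed
  then show ?thesis using that[of "\<bar>K\<bar>"] by simp
qed

text \<open>Writing \<open>f\<^sub>1 = F (t + r) x\<close> and \<open>f\<^sub>0 = F t x\<close>, the jump \<open>\<kappa> t * (f\<^sub>1 - f\<^sub>0)\<close> of order \<open>r powr H\<close> dominates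
  the effect of moving \<open>\<kappa>\<close> and \<open>\<alpha>\<close>, which is of order \<open>r * ln (1 / r)\<close>, because \<open>H < 1\<close>.\<close>

lemma coefficient_lower_bound:
  fixes \<alpha> \<kappa> :: "real \<Rightarrow> real" and t c H \<beta> K :: real
  assumes \<alpha>: "0 < \<alpha> t" "lipschitz_at \<alpha> t" and \<kappa>: "\<kappa> t \<noteq> 0" "lipschitz_at \<kappa> t"
    and c: "0 < c" and H: "H < 1" and K: "0 \<le> K" and \<beta>: "0 < \<eta>" "\<beta> = H + 1 / \<alpha> t + \<eta>"
  shows "\<forall>\<^sub>F r in at_right 0. \<forall>L f\<^sub>0 f\<^sub>1. r powr (1 + \<alpha> t * \<eta> / 2) \<le> L \<and> L \<le> 1 \<and> \<bar>f\<^sub>1\<bar> \<le> K \<and> c * r powr H \<le> \<bar>f\<^sub>1 - f\<^sub>0\<bar> \<longrightarrow>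
    r powr \<beta> \<le> \<bar>\<kappa> (t + r) * L powr (1 / \<alpha> (t + r)) * f\<^sub>1 - \<kappa> t * L powr (1 / \<alpha> t) * f\<^sub>0\<bar>"
proof -
  define \<theta> where "\<theta> = 1 + \<alpha> t * \<eta> / 2"
  have \<theta>: "0 < \<theta>" using \<alpha> \<beta> by (simp add: \<theta>_def add_pos_nonneg)
  \<comment> \<open>The power of \<open>r\<close> sacrificed to the logarithm. The error is of order
    \<open>r powr (1 - \<delta>)\<close>, and \<open>\<delta> + H \<le> 1 - \<delta>\<close> leaves
    a factor \<open>r powr \<delta>\<close> to make it small against the jump.\<close>
  define \<delta> where "\<delta> = min (1 / 2) ((1 - H) / 2)"
  have \<delta>: "0 < \<delta>" "\<delta> < 1" "\<delta> + H \<le> 1 - \<delta>" using H by (auto simp: \<delta>_def min_def field_simps)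
  obtain K1 where K1: "0 \<le> K1" "\<forall>\<^sub>F r in at_right 0. \<bar>\<kappa> (t + r) - \<kappa> t\<bar> \<le> K1 * r"
    using lipschitz_at_right[OF \<kappa>(2)] .
  have "lipschitz_at (\<lambda>s. 1 / \<alpha> s) t"
    by (rule lipschitz_at_compose[OF \<alpha>(2)])
       (use \<alpha> in \<open>auto intro!: lipschitz_at_differentiable derivative_eq_intros\<close>)
  then obtain K2 where K2: "0 \<le> K2" "\<forall>\<^sub>F r in at_right 0. \<bar>1 / \<alpha> (t + r) - 1 / \<alpha> t\<bar> \<le> K2 * r"
    by (rule lipschitz_at_right)
  define C where "C = K * (3 * K1 + 4 * \<bar>\<kappa> t\<bar> * K2 * \<theta> / \<delta>)"
  have ev1: "\<forall>\<^sub>F r in at_right 0. C * r powr \<delta> < \<bar>\<kappa> t\<bar> * c / 2"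
    using \<delta> \<kappa> c by (intro eventually_le_powr_at_right_0) auto
  have ev2: "\<forall>\<^sub>F r in at_right 0. K2 * \<theta> / \<delta> * r powr (1 - \<delta>) < 1"
    using \<delta> by (intro eventually_le_powr_at_right_0) auto
  have ev3: "\<forall>\<^sub>F r in at_right 0. 1 * r powr (\<eta> / 2) < \<bar>\<kappa> t\<bar> * c / 2"
    using \<kappa> c \<beta> by (intro eventually_le_powr_at_right_0) auto
  have r01: "\<forall>\<^sub>F r::real in at_right 0. 0 < r \<and> r < 1"
    using eventually_at_right_field[of "\<lambda>r. 0 < r \<and> r < (1::real)" 0] by (auto intro: exI[of _ 1])
  show ?thesis
    using K1(2) K2(2) ev1 ev2 ev3 r01
  proof eventually_elim
    case (elim r)
    then have r: "0 < r" "r < 1" by auto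
    show ?case
    proof (intro allI impI, elim conjE)
      fix L f\<^sub>0 f\<^sub>1
      assume L: "r powr (1 + \<alpha> t * \<eta> / 2) \<le> L" "L \<le> 1"
        and f: "\<bar>f\<^sub>1\<bar> \<le> K" "c * r powr H \<le> \<bar>f\<^sub>1 - f\<^sub>0\<bar>"
      have L0: "0 < L" using L(1) r by (metis less_le_trans powr_gt_zero less_irrefl)
      \<comment> \<open>The change of exponent multiplies \<open>L powr (1 / \<alpha> t)\<close> by
        \<open>exp (D * ln L)\<close>. Here \<open>D\<close> is O(r), and as \<open>L\<close> lies
        between a power of \<open>r\<close> and 1, its logarithm is O(ln (1 / r)); the factor is
        close to 1.\<close>
      define D where "D = 1 / \<alpha> (t + r) - 1 / \<alpha> t"
      have lnr: "- ln r \<le> r powr - \<delta> / \<delta>"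
        using r \<delta> ln_le_minus_one[of "r powr - \<delta>"] by (simp add: ln_powr field_simps)
      have "\<theta> * ln r \<le> ln L"
        using L(1) r L0 by (metis \<theta>_def ln_powr ln_le_cancel_iff powr_gt_zero less_irrefl)
      then have lnL: "\<bar>ln L\<bar> \<le> \<theta> * (r powr - \<delta> / \<delta>)"
        using L(2) L0 mult_left_mono[OF lnr, of \<theta>] \<theta> \<delta> by (auto simp: abs_if)
      have rr: "r * r powr - \<delta> = r powr (1 - \<delta>)"
        using r powr_add[of r 1 "- \<delta>"] by simp
      have DL: "\<bar>D * ln L\<bar> \<le> K2 * \<theta> / \<delta> * r powr (1 - \<delta>)"
      proof -
        have "\<bar>D * ln L\<bar> \<le> (K2 * r) * (\<theta> * (r powr - \<delta> / \<delta>))"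
          unfolding abs_mult using elim(2) lnL K2 r by (intro mult_mono) (auto simp: D_def)
        also have "\<dots> = K2 * \<theta> / \<delta> * (r * r powr - \<delta>)" by simp
        finally show ?thesis by (simp only: rr)
      qed
      then have DL1: "\<bar>D * ln L\<bar> \<le> 1" using elim(4) by linarith
      then have exp3: "exp (D * ln L) \<le> 3" using exp_le exp_le_cancel_iff[of "D * ln L" 1] by linarith
      have exp1: "\<bar>exp (D * ln L) - 1\<bar> \<le> 4 * \<bar>D * ln L\<bar>"
      proof -
        have "\<bar>exp (D * ln L) - 1\<bar> \<le> \<bar>D * ln L\<bar> * (exp (D * ln L) + 1)"
          using abs_exp_diff_le[of "D * ln L" 0] by simp
        also have "\<dots> \<le> \<bar>D * ln L\<bar> * 4" using exp3 by (intro mult_left_mono) auto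
        finally show ?thesis by simp
      qed
      \<comment> \<open>\<open>k\<close> collects everything that moves with the second argument, so
        the bracket is \<open>\<kappa> t * (f\<^sub>1 - f\<^sub>0) + (k - \<kappa> t) *
        f\<^sub>1\<close>: the jump plus an error.\<close>
      define k where "k = \<kappa> (t + r) * exp (D * ln L)"
      have k: "\<bar>k - \<kappa> t\<bar> \<le> (3 * K1 + 4 * \<bar>\<kappa> t\<bar> * K2 * \<theta> / \<delta>) * r powr (1 - \<delta>)"
      proof -
        have "k - \<kappa> t = (\<kappa> (t + r) - \<kappa> t) * exp (D * ln L) + \<kappa> t * (exp (D * ln L) - 1)"
          by (simp add: k_def algebra_simps)
        then have "\<bar>k - \<kappa> t\<bar> \<le> \<bar>\<kappa> (t + r) - \<kappa> t\<bar> * exp (D * ln L) + \<bar>\<kappa> t\<bar> * \<bar>exp (D * ln L) - 1\<bar>"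
          using abs_triangle_ineq[of "(\<kappa> (t + r) - \<kappa> t) * exp (D * ln L)" "\<kappa> t * (exp (D * ln L) - 1)"]
          by (simp add: abs_mult)
        also have "\<dots> \<le> K1 * r * 3 + \<bar>\<kappa> t\<bar> * (4 * (K2 * \<theta> / \<delta> * r powr (1 - \<delta>)))"
          using elim(1) exp3 exp1 DL K1 r by (intro add_mono mult_mono) auto
        also have "K1 * r * 3 \<le> K1 * r powr (1 - \<delta>) * 3"
          using powr_mono'[of "1 - \<delta>" 1 r] r \<delta> K1 by (intro mult_right_mono mult_left_mono) auto
        finally show ?thesis by (simp add: algebra_simps)
      qed
      have err: "\<bar>(k - \<kappa> t) * f\<^sub>1\<bar> \<le> \<bar>\<kappa> t\<bar> * c / 2 * r powr H"
      proof -
        have "\<bar>(k - \<kappa> t) * f\<^sub>1\<bar> \<le> (3 * K1 + 4 * \<bar>\<kappa> t\<bar> * K2 * \<theta> / \<delta>) * r powr (1 - \<delta>) * K"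
          unfolding abs_mult using k f K by (intro mult_mono) auto
        also have "\<dots> = C * r powr (1 - \<delta>)" by (simp add: C_def)
        also have "\<dots> \<le> C * r powr (\<delta> + H)"
          using powr_mono'[OF \<delta>(3), of r] r K K1 K2 \<theta> \<delta> by (intro mult_left_mono) (auto simp: C_def)
        also have "\<dots> = C * r powr \<delta> * r powr H" by (simp add: powr_add)
        also have "\<dots> \<le> \<bar>\<kappa> t\<bar> * c / 2 * r powr H" using elim(3) by (intro mult_right_mono) auto
        finally show ?thesis .
      qed
      have main: "\<bar>\<kappa> t\<bar> * c / 2 * r powr H \<le> \<bar>k * f\<^sub>1 - \<kappa> t * f\<^sub>0\<bar>"
      proof -
        have "\<bar>\<kappa> t\<bar> * (c * r powr H) \<le> \<bar>\<kappa> t * (f\<^sub>1 - f\<^sub>0)\<bar>"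
          unfolding abs_mult using f by (intro mult_left_mono) auto
        also have "\<kappa> t * (f\<^sub>1 - f\<^sub>0) = (k * f\<^sub>1 - \<kappa> t * f\<^sub>0) - (k - \<kappa> t) * f\<^sub>1" by (simp add: algebra_simps)
        also have "\<bar>\<dots>\<bar> \<le> \<bar>k * f\<^sub>1 - \<kappa> t * f\<^sub>0\<bar> + \<bar>(k - \<kappa> t) * f\<^sub>1\<bar>" by (rule abs_triangle_ineq4)
        finally show ?thesis using err by simp
      qed
      \<comment> \<open>The three parts of \<open>\<beta>\<close> are paid for separately: the first
        by the lower bound on \<open>L\<close>, \<open>\<eta> / 2\<close> by the constant
        \<open>\<bar>\<kappa> t\<bar> * c / 2\<close>, and \<open>H\<close> by the jump.\<close>
      have "r powr \<beta> = r powr ((1 + \<alpha> t * \<eta> / 2) * (1 / \<alpha> t)) * (r powr (\<eta> / 2) * r powr H)"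
      proof -
        have "\<beta> = (1 + \<alpha> t * \<eta> / 2) * (1 / \<alpha> t) + (\<eta> / 2 + H)"
          using \<alpha> by (simp add: \<beta> add_divide_distrib distrib_right)
        then show ?thesis by (simp only: powr_add)
      qed
      also have "r powr ((1 + \<alpha> t * \<eta> / 2) * (1 / \<alpha> t)) \<le> L powr (1 / \<alpha> t)"
        using L(1) \<alpha> by (subst powr_powr[symmetric]) (intro powr_mono2, auto)
      also have "r powr (\<eta> / 2) * r powr H \<le> \<bar>\<kappa> t\<bar> * c / 2 * r powr H"
        using elim(5) by (intro mult_right_mono) auto
      also have "\<dots> \<le> \<bar>k * f\<^sub>1 - \<kappa> t * f\<^sub>0\<bar>" by (rule main)
      finally have "r powr \<beta> \<le> L powr (1 / \<alpha> t) * \<bar>k * f\<^sub>1 - \<kappa> t * f\<^sub>0\<bar>"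
        by (simp add: mult_left_mono mult_right_mono)
      also have "\<dots> = \<bar>\<kappa> (t + r) * L powr (1 / \<alpha> (t + r)) * f\<^sub>1 - \<kappa> t * L powr (1 / \<alpha> t) * f\<^sub>0\<bar>"
      proof -
        have "L powr (1 / \<alpha> (t + r)) = L powr (1 / \<alpha> t) * exp (D * ln L)"
          using L0 by (simp add: powr_def D_def algebra_simps flip: exp_add)
        then have "\<kappa> (t + r) * L powr (1 / \<alpha> (t + r)) * f\<^sub>1 - \<kappa> t * L powr (1 / \<alpha> t) * f\<^sub>0
            = L powr (1 / \<alpha> t) * (k * f\<^sub>1 - \<kappa> t * f\<^sub>0)"
          by (simp add: k_def algebra_simps)
        then show ?thesis by (simp add: abs_mult)
      qed
      finally show "r powr \<beta> \<le> \<bar>\<kappa> (t + r) * L powr (1 / \<alpha> (t + r)) * f\<^sub>1 - \<kappa> t * L powr (1 / \<alpha> t) * f\<^sub>0\<bar>" .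
    qed
  qed
qed

text \<open>For fixed x the admissible indices fill an integer interval from
  \<open>2 * \<rho> x\<close> to \<open>\<rho> x * T / 4\<close>; rounding and the discarded initial
  indices cost at most \<open>n\<^sub>0 + 2\<close>. Integrating over E brings in the integral of
  \<open>\<rho>\<close>. The factors 4 and 2 match the linear bounds on the arrival times, so that
  \<open>\<rho> x / \<Gamma> i\<close> lies between \<open>1 / T\<close> and 1.\<close>

lemma expected_count_lower_bound:
  fixes \<rho> :: "'e \<Rightarrow> real" and T m M\<^sub>0 :: real and n\<^sub>0 :: nat
  assumes \<mu>: "prob_space \<mu>" and \<rho> [measurable]: "\<rho> \<in> borel_measurable \<mu>" and \<rho>0: "\<And>x. x \<in> space \<mu> \<Longrightarrow> 0 < \<rho> x"
    and E [measurable]: "E \<in> sets \<mu>" and T: "8 < T" and m: "0 \<le> m" "ennreal m \<le> (\<integral>\<^sup>+x\<in>E. ennreal (\<rho> x) \<partial>\<mu>)"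
    and M\<^sub>0: "0 \<le> M\<^sub>0" "M\<^sub>0 + (n\<^sub>0 + 2) < (T / 4 - 2) * m"
  shows "\<exists>n. M\<^sub>0 \<le> (\<Sum>i<n. measure \<mu> {x\<in>E. n\<^sub>0 \<le> i \<and> 4 * real (Suc i) \<le> \<rho> x * T \<and> 2 * \<rho> x \<le> real (Suc i)})"
proof -
  interpret prob_space \<mu> by (rule \<mu>)
  define B where "B i = {x\<in>E. n\<^sub>0 \<le> i \<and> 4 * real (Suc i) \<le> \<rho> x * T \<and> 2 * \<rho> x \<le> real (Suc i)}" for i
  have Bm [measurable]: "B i \<in> events" for i
  proof -
    have "B i = E \<inter> {x\<in>space \<mu>. n\<^sub>0 \<le> i \<and> 4 * real (Suc i) \<le> \<rho> x * T \<and> 2 * \<rho> x \<le> real (Suc i)}"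
      using sets.sets_into_space[OF E] by (auto simp: B_def)
    also have "\<dots> \<in> events" by measurable
    finally show ?thesis .
  qed
  have count: "ennreal (\<rho> x * (T / 4 - 2)) \<le> (\<Sum>i. indicator (B i) x) + ennreal (n\<^sub>0 + 2)" if x: "x \<in> E" for x
  proof -
    have \<rho>x: "0 < \<rho> x" using \<rho>0 x sets.sets_into_space[OF E] by auto
    define I where "I = {nat \<lceil>2 * \<rho> x\<rceil> + n\<^sub>0..<nat \<lfloor>\<rho> x * T / 4\<rfloor>}"
    have I: "x \<in> B i" if "i \<in> I" for i
    proof -
      have "2 * \<rho> x \<le> real i" using that unfolding I_def by (simp add: nat_le_iff) linarith
      moreover have "real (Suc i) \<le> \<rho> x * T / 4"
      proof -
        have "int (Suc i) \<le> \<lfloor>\<rho> x * T / 4\<rfloor>" using that unfolding I_def by auto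
        then show ?thesis by linarith
      qed
      ultimately show ?thesis using x that by (auto simp: B_def I_def)
    qed
    have card: "\<rho> x * (T / 4 - 2) \<le> real (card I) + (n\<^sub>0 + 2)"
    proof -
      have 1: "real (nat \<lceil>2 * \<rho> x\<rceil>) \<le> 2 * \<rho> x + 1" using \<rho>x by linarith
      have 2: "\<rho> x * T / 4 - 1 \<le> real (nat \<lfloor>\<rho> x * T / 4\<rfloor>)" by linarith
      have "real (nat \<lfloor>\<rho> x * T / 4\<rfloor>) - (real (nat \<lceil>2 * \<rho> x\<rceil>) + n\<^sub>0) \<le> real (card I)"
        unfolding I_def by simp
      then show ?thesis using 1 2 by (simp add: algebra_simps)
    qed
    have "ennreal (\<rho> x * (T / 4 - 2)) \<le> ennreal (real (card I) + (n\<^sub>0 + 2))"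
      by (rule ennreal_leI[OF card])
    also have "\<dots> = ennreal (real (card I)) + ennreal (n\<^sub>0 + 2)" by (subst ennreal_plus) auto
    also have "ennreal (real (card I)) = (\<Sum>i\<in>I. indicator (B i) x)"
      using I by (simp add: ennreal_of_nat_eq_real_of_nat)
    also have "\<dots> \<le> (\<Sum>i. indicator (B i) x)"
      by (rule sum_le_suminf) (auto simp: I_def)
    finally show ?thesis by (simp add: add_right_mono)
  qed
  have "ennreal ((T / 4 - 2) * m) \<le> ennreal (T / 4 - 2) * (\<integral>\<^sup>+x\<in>E. ennreal (\<rho> x) \<partial>\<mu>)"
    using T m by (simp add: ennreal_mult mult_left_mono)
  also have "\<dots> = (\<integral>\<^sup>+x. ennreal (T / 4 - 2) * (ennreal (\<rho> x) * indicator E x) \<partial>\<mu>)"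
    by (simp add: nn_integral_cmult)
  also have "\<dots> \<le> (\<integral>\<^sup>+x. (\<Sum>i. indicator (B i) x) + ennreal (n\<^sub>0 + 2) \<partial>\<mu>)"
  proof (rule nn_integral_mono)
    fix x assume "x \<in> space \<mu>"
    show "ennreal (T / 4 - 2) * (ennreal (\<rho> x) * indicator E x) \<le> (\<Sum>i. indicator (B i) x) + ennreal (n\<^sub>0 + 2)"
      using count[of x] T \<rho>0[OF \<open>x \<in> space \<mu>\<close>] by (cases "x \<in> E") (auto simp: ennreal_mult[symmetric] mult.commute)
  qed
  also have "\<dots> = (\<Sum>i. emeasure \<mu> (B i)) + ennreal (n\<^sub>0 + 2)"
    by (simp add: nn_integral_add nn_integral_suminf emeasure_space_1)
  finally have le: "ennreal ((T / 4 - 2) * m) \<le> (\<Sum>i. ennreal (prob (B i))) + ennreal (n\<^sub>0 + 2)"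
    by (simp add: emeasure_eq_measure)
  show ?thesis
  \<comment> \<open>The full series of measures may be infinite; a finite \<open>n\<close> is
    obtained by refuting a common bound on all partial sums.\<close>
  proof (rule ccontr)
    assume "\<nexists>n. M\<^sub>0 \<le> (\<Sum>i<n. measure \<mu> {x\<in>E. n\<^sub>0 \<le> i \<and> 4 * real (Suc i) \<le> \<rho> x * T \<and> 2 * \<rho> x \<le> real (Suc i)})"
    then have "(\<Sum>i<n. prob (B i)) \<le> M\<^sub>0" for n by (auto simp: B_def not_le less_imp_le)
    then have "(\<Sum>i<n. ennreal (prob (B i))) \<le> ennreal M\<^sub>0" for n
      by (simp add: sum_ennreal ennreal_leI)
    then have "(\<Sum>i. ennreal (prob (B i))) \<le> ennreal M\<^sub>0" by (intro suminf_le_const[OF summableI])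
    then have "ennreal ((T / 4 - 2) * m) \<le> ennreal M\<^sub>0 + ennreal (n\<^sub>0 + 2)"
      using le by (meson add_right_mono order_trans)
    also have "\<dots> = ennreal (M\<^sub>0 + (n\<^sub>0 + 2))" using M\<^sub>0 by (subst ennreal_plus) auto
    finally show False using M\<^sub>0 by (subst (asm) ennreal_le_iff) auto
  qed
qed

section \<open>Increments of the field\<close>

text \<open>The coefficient of a sign without the prefactor. Weight 1 gives the finite case and a
  general \<open>\<rho>\<close> the sigma-finite one.\<close>

definition series_term ::
    "real \<Rightarrow> ('e \<Rightarrow> real) \<Rightarrow> ('e \<Rightarrow> real) \<Rightarrow> real \<Rightarrow> 'e \<Rightarrow> real" where
  "series_term a G \<rho> g v = g powr (- 1 / a) * \<rho> v powr (1 / a) * G v"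

lemma series_term_eq:
  "0 < g \<Longrightarrow> 0 < \<rho> v \<Longrightarrow> series_term a G \<rho> g v = (\<rho> v / g) powr (1 / a) * G v"
  by (simp add: series_term_def powr_divide powr_minus_divide)

text \<open>Exhibits the square as the power \<open>2 / a\<close>, larger than 1 when
  \<open>a < 2\<close>, of a quantity whose numerator has finite mean; this is the form accepted by
  the summability lemma for independent marks.\<close>

lemma series_term_sq:
  assumes "0 < g" "0 < \<rho> v" "0 < a"
  shows "(series_term a G \<rho> g v)\<^sup>2 = (\<rho> v * \<bar>G v\<bar> powr a / g) powr (2 / a)"
proof -
  have "(\<rho> v * \<bar>G v\<bar> powr a / g) powr (2 / a) = (\<rho> v / g) powr (2 / a) * (\<bar>G v\<bar> powr a) powr (2 / a)"
    using assms by (subst powr_mult[symmetric]) auto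
  also have "(\<bar>G v\<bar> powr a) powr (2 / a) = (G v)\<^sup>2"
    using assms by (cases "G v = 0") (auto simp: powr_powr)
  also have "(\<rho> v / g) powr (2 / a) = ((\<rho> v / g) powr (1 / a))\<^sup>2"
    using assms by (simp add: power2_eq_square flip: powr_add)
  finally show ?thesis using assms by (simp add: series_term_eq power_mult_distrib)
qed

lemma driving_sequencesD:
  assumes "driving_sequences M \<mu> \<Gamma> V \<gamma>"
  shows "prob_space M" "unit_poisson_arrivals M \<Gamma>" "iid_law M \<mu> V" "iid_signs M \<gamma>"
  using assms by (auto simp: driving_sequences_def)

text \<open>Replacing \<open>\<Gamma> i\<close> by \<open>Suc i / 2\<close> costs only the factor
  \<open>2 powr (2 / a)\<close>, and then the sum involves independent marks alone.\<close>

lemma AE_summable_series_term_sq: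
  assumes drv: "driving_sequences M \<mu> \<Gamma> V \<gamma>"
    and \<rho> [measurable]: "\<rho> \<in> borel_measurable \<mu>" and \<rho>0: "\<And>v. v \<in> space \<mu> \<Longrightarrow> 0 < \<rho> v"
    and a: "0 < a" "a < 2" and G [measurable]: "G \<in> borel_measurable \<mu>"
    and fin: "(\<integral>\<^sup>+v. ennreal (\<rho> v * \<bar>G v\<bar> powr a) \<partial>\<mu>) < \<infinity>"
  shows "AE \<omega> in M. summable (\<lambda>i. (series_term a G \<rho> (\<Gamma> i \<omega>) (V i \<omega>))\<^sup>2)"
proof -
  interpret prob_space M using drv by (rule driving_sequencesD)
  have mV: "V i \<in> M \<rightarrow>\<^sub>M \<mu>" for i
    using driving_sequencesD(3)[OF drv] by (auto simp: iid_law_def indep_vars_def)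
  have "AE \<omega> in M. summable (\<lambda>i. (\<rho> (V i \<omega>) * \<bar>G (V i \<omega>)\<bar> powr a / real (Suc i)) powr (2 / a))"
    by (rule AE_summable_iid_powr[OF driving_sequencesD(3)[OF drv]])
       (use fin a less_imp_le[OF \<rho>0] in auto)
  then show ?thesis
    using AE_arrivals_linear[OF driving_sequencesD(2)[OF drv]] AE_space
  proof eventually_elim
    case (elim \<omega>)
    have \<rho>V: "0 < \<rho> (V i \<omega>)" for i using \<rho>0 measurable_space[OF mV] elim by auto
    have "summable (\<lambda>i. 2 powr (2 / a) * (\<rho> (V i \<omega>) * \<bar>G (V i \<omega>)\<bar> powr a / real (Suc i)) powr (2 / a))"
      using elim by (intro summable_mult)
    moreover have "\<forall>\<^sub>F i in sequentially. norm ((series_term a G \<rho> (\<Gamma> i \<omega>) (V i \<omega>))\<^sup>2)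
        \<le> 2 powr (2 / a) * (\<rho> (V i \<omega>) * \<bar>G (V i \<omega>)\<bar> powr a / real (Suc i)) powr (2 / a)"
      using elim(2)
    proof eventually_elim
      case (elim i)
      have \<Gamma>: "0 < \<Gamma> i \<omega>" using elim by (smt (verit) of_nat_0_less_iff zero_less_Suc half_gt_zero)
      have "norm ((series_term a G \<rho> (\<Gamma> i \<omega>) (V i \<omega>))\<^sup>2) = (\<rho> (V i \<omega>) * \<bar>G (V i \<omega>)\<bar> powr a / \<Gamma> i \<omega>) powr (2 / a)"
        using series_term_sq[OF \<Gamma>, of \<rho> "V i \<omega>" a G] \<rho>V a(1) by simp
      also have "\<dots> \<le> (\<rho> (V i \<omega>) * \<bar>G (V i \<omega>)\<bar> powr a / (Suc i / 2)) powr (2 / a)"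
        using elim \<Gamma> a less_imp_le[OF \<rho>V[of i]]
        by (intro powr_mono2 divide_left_mono) auto
      also have "\<rho> (V i \<omega>) * \<bar>G (V i \<omega>)\<bar> powr a / (Suc i / 2) = 2 * (\<rho> (V i \<omega>) * \<bar>G (V i \<omega>)\<bar> powr a / Suc i)"
        by simp
      also have "\<dots> powr (2 / a) = 2 powr (2 / a) * (\<rho> (V i \<omega>) * \<bar>G (V i \<omega>)\<bar> powr a / Suc i) powr (2 / a)"
        by (rule powr_mult)
      finally show ?case .
    qed
    ultimately show ?case by (rule summable_comparison_test_ev[rotated])
  qed
qed

text \<open>Three sources of failure, one per summand: the signs cancel although N coefficients are
  large, the arrival times violate their linear bounds after \<open>n\<^sub>0\<close>, or fewer than
  N marks fall into their sets. Empty \<open>B i\<close> before \<open>n\<^sub>0\<close> keep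
  uncontrolled arrival times out of the count.\<close>

lemma prob_increment_lt_le:
  fixes k k' \<epsilon> :: real and \<Gamma> :: "nat \<Rightarrow> 'w \<Rightarrow> real"
  assumes drv: "driving_sequences M \<mu> \<Gamma> V \<gamma>"
    and \<rho> [measurable]: "\<rho> \<in> borel_measurable \<mu>" and \<rho>0: "\<And>v. v \<in> space \<mu> \<Longrightarrow> 0 < \<rho> v"
    and a: "0 < a" "a < 2" and G [measurable]: "G \<in> borel_measurable \<mu>"
    and fin: "(\<integral>\<^sup>+v. ennreal (\<rho> v * \<bar>G v\<bar> powr a) \<partial>\<mu>) < \<infinity>"
    and a': "0 < a'" "a' < 2" and G' [measurable]: "G' \<in> borel_measurable \<mu>"
    and fin': "(\<integral>\<^sup>+v. ennreal (\<rho> v * \<bar>G' v\<bar> powr a') \<partial>\<mu>) < \<infinity>"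
    and \<epsilon>: "0 < \<epsilon>" and B [measurable]: "\<And>i. B i \<in> sets \<mu>" and B0: "\<And>i. i < n\<^sub>0 \<Longrightarrow> B i = {}"
    and large: "\<And>i (g::real) v. v \<in> B i \<Longrightarrow> Suc i / 2 \<le> g \<Longrightarrow> g \<le> 4 * Suc i \<Longrightarrow>
      \<epsilon> \<le> \<bar>k' * ((\<rho> v / g) powr (1 / a') * G' v) - k * ((\<rho> v / g) powr (1 / a) * G v)\<bar>"
  shows "measure M {\<omega>\<in>space M. \<bar>k' * (\<Sum>i. \<gamma> i \<omega> * series_term a' G' \<rho> (\<Gamma> i \<omega>) (V i \<omega>))
        - k * (\<Sum>i. \<gamma> i \<omega> * series_term a G \<rho> (\<Gamma> i \<omega>) (V i \<omega>))\<bar> < \<epsilon>}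
    \<le> (N choose (N div 2)) / 2 ^ N
      + (1 - measure M {\<omega>\<in>space M. \<forall>i\<ge>n\<^sub>0. Suc i / 2 \<le> \<Gamma> i \<omega> \<and> \<Gamma> i \<omega> \<le> 4 * Suc i})
      + 2 ^ N * exp (- (\<Sum>i<n. measure \<mu> (B i)) / 2)"
proof -
  interpret prob_space M using drv by (rule driving_sequencesD)
  have [measurable]: "V i \<in> M \<rightarrow>\<^sub>M \<mu>" for i
    using driving_sequencesD(3)[OF drv] by (auto simp: iid_law_def indep_vars_def)
  have [measurable]: "\<Gamma> i \<in> borel_measurable M" for i
    using driving_sequencesD(2)[OF drv] by (rule unit_poisson_arrivals_measurable)
  have [measurable]: "\<gamma> i \<in> borel_measurable M" for i
    using driving_sequencesD(4)[OF drv] by (rule iid_signs_measurable)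
  define L where "L = distr M (PiM UNIV (\<lambda>_. borel)) (\<lambda>\<omega> i. \<gamma> i \<omega>)"
  interpret L: sign_space L unfolding L_def using driving_sequencesD(4)[OF drv] by (rule sign_space_distr)
  define \<psi> where "\<psi> = real (N choose (N div 2)) / 2 ^ N"
  define \<Delta> where "\<Delta> x g v = k' * (\<Sum>i. x i * series_term a' G' \<rho> (g i) (v i))
      - k * (\<Sum>i. x i * series_term a G \<rho> (g i) (v i))" for x g :: "nat \<Rightarrow> real" and v
  define S where "S = PiM (UNIV :: nat set) (\<lambda>_. borel :: real measure) \<Otimes>\<^sub>M
      (PiM (UNIV :: nat set) (\<lambda>_. borel :: real measure) \<Otimes>\<^sub>M PiM (UNIV :: nat set) (\<lambda>_. \<mu>))"
  define D where "D = {z \<in> space S. \<bar>\<Delta> (fst z) (fst (snd z)) (snd (snd z))\<bar> < \<epsilon>}"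
  have [measurable]: "D \<in> sets S"
    unfolding D_def \<Delta>_def series_term_def S_def by measurable
  define lin where "lin = {\<omega>\<in>space M. \<forall>i\<in>{n\<^sub>0..}. Suc i / 2 \<le> \<Gamma> i \<omega> \<and> \<Gamma> i \<omega> \<le> 4 * Suc i}"
  define cnt where "cnt = {\<omega>\<in>space M. card {i. i < n \<and> V i \<omega> \<in> B i} < N}"
  have lin [measurable]: "lin \<in> events" unfolding lin_def by measurable
  have cnt [measurable]: "cnt \<in> events"
  proof -
    have "card {i. i < n \<and> V i \<omega> \<in> B i} = (\<Sum>i<n. if V i \<omega> \<in> B i then 1 else 0)" for \<omega>
      by (simp add: sum.If_cases Int_def)
    then show ?thesis unfolding cnt_def by simp
  qed
  have good: "emeasure L {x. (x, \<lambda>i. \<Gamma> i \<omega>, \<lambda>i. V i \<omega>) \<in> D} \<le> ennreal \<psi>"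
    if \<omega>: "\<omega> \<in> lin" "\<omega> \<notin> cnt"
      and s: "summable (\<lambda>i. (series_term a G \<rho> (\<Gamma> i \<omega>) (V i \<omega>))\<^sup>2)"
      and s': "summable (\<lambda>i. (series_term a' G' \<rho> (\<Gamma> i \<omega>) (V i \<omega>))\<^sup>2)" for \<omega>
  proof -
    have sp: "\<omega> \<in> space M" using \<omega> by (simp add: lin_def)
    have Vsp: "V i \<omega> \<in> space \<mu>" for i using sp by (rule measurable_space[rotated]) measurable
    define A where "A i = k' * series_term a' G' \<rho> (\<Gamma> i \<omega>) (V i \<omega>) - k * series_term a G \<rho> (\<Gamma> i \<omega>) (V i \<omega>)" for i
    \<comment> \<open>Both series converge for almost every choice of signs, so their difference is
      a single Rademacher series; with divergent series \<open>suminf\<close> would not be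
      additive.\<close>
    have AE1: "AE x in L. summable (\<lambda>i. x i * A i) \<and> \<Delta> x (\<lambda>i. \<Gamma> i \<omega>) (\<lambda>i. V i \<omega>) = (\<Sum>i. x i * A i)"
      using L.AE_summable_signs[OF s] L.AE_summable_signs[OF s']
    proof eventually_elim
      case (elim x)
      from sums_diff[OF sums_mult[OF summable_sums[OF elim(2)], of k'] sums_mult[OF summable_sums[OF elim(1)], of k]]
      have "(\<lambda>i. x i * A i) sums \<Delta> x (\<lambda>i. \<Gamma> i \<omega>) (\<lambda>i. V i \<omega>)"
        by (simp add: A_def \<Delta>_def algebra_simps)
      then show ?case by (auto simp: sums_iff)
    qed
    have "N \<le> card {i. i < n \<and> V i \<omega> \<in> B i}" using \<omega> sp by (simp add: cnt_def)
    \<comment> \<open>Exactly N of the good indices are kept, so that the bound depends on N and not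
      on the outcome.\<close>
    then obtain I where I: "I \<subseteq> {i. i < n \<and> V i \<omega> \<in> B i}" "card I = N" "finite I"
      using obtain_subset_with_card_n by blast
    have "\<epsilon> \<le> \<bar>A i\<bar>" if "i \<in> I" for i
    proof -
      have Bi: "V i \<omega> \<in> B i" using I that by auto
      then have "n\<^sub>0 \<le> i" using B0[of i] by (cases "i < n\<^sub>0") auto
      then have g: "Suc i / 2 \<le> \<Gamma> i \<omega>" "\<Gamma> i \<omega> \<le> 4 * Suc i" using \<omega> by (auto simp: lin_def)
      then have "0 < \<Gamma> i \<omega>" by (smt (verit) of_nat_0_less_iff zero_less_Suc half_gt_zero)
      then show ?thesis
        using large[OF Bi g] \<rho>0[OF Vsp[of i]] by (simp add: A_def series_term_eq)
    qed
    then have "L.prob {x. \<bar>\<Sum>i. x i * A i\<bar> < \<epsilon>} \<le> \<psi>"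
      using L.prob_suminf_lt_le[OF I(3) \<epsilon>, of A] AE1 I(2) by (auto simp: \<psi>_def elim!: eventually_mono)
    moreover have "emeasure L {x. (x, \<lambda>i. \<Gamma> i \<omega>, \<lambda>i. V i \<omega>) \<in> D} = emeasure L {x\<in>space L. \<bar>\<Sum>i. x i * A i\<bar> < \<epsilon>}"
    proof (rule emeasure_eq_AE)
      show "AE x in L. (x \<in> {x. (x, \<lambda>i. \<Gamma> i \<omega>, \<lambda>i. V i \<omega>) \<in> D}) = (x \<in> {x\<in>space L. \<bar>\<Sum>i. x i * A i\<bar> < \<epsilon>})"
        using AE1 by eventually_elim (auto simp: D_def S_def space_pair_measure space_PiM Vsp)
      have "(\<lambda>x. (x, \<lambda>i. \<Gamma> i \<omega>, \<lambda>i. V i \<omega>)) \<in> L \<rightarrow>\<^sub>M S"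
        unfolding S_def
        by (intro measurable_Pair measurable_const)
           (auto simp: space_pair_measure space_PiM Vsp measurable_cong_sets[OF L.sets_L refl])
      from measurable_sets[OF this \<open>D \<in> sets S\<close>]
      show "{x. (x, \<lambda>i. \<Gamma> i \<omega>, \<lambda>i. V i \<omega>) \<in> D} \<in> sets L" by (simp add: vimage_def)
    qed measurable
    ultimately show ?thesis by (simp add: L.emeasure_eq_measure ennreal_leI)
  qed
  have s1: "AE \<omega> in M. summable (\<lambda>i. (series_term a G \<rho> (\<Gamma> i \<omega>) (V i \<omega>))\<^sup>2)"
    by (rule AE_summable_series_term_sq[OF drv \<rho> _ a G fin]) (rule \<rho>0)
  have s2: "AE \<omega> in M. summable (\<lambda>i. (series_term a' G' \<rho> (\<Gamma> i \<omega>) (V i \<omega>))\<^sup>2)"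
    by (rule AE_summable_series_term_sq[OF drv \<rho> _ a' G' fin']) (rule \<rho>0)
  have "emeasure M {\<omega>\<in>space M. (\<lambda>i. \<gamma> i \<omega>, \<lambda>i. \<Gamma> i \<omega>, \<lambda>i. V i \<omega>) \<in> D}
      = (\<integral>\<^sup>+\<omega>. emeasure L {x. (x, \<lambda>i. \<Gamma> i \<omega>, \<lambda>i. V i \<omega>) \<in> D} \<partial>M)"
    unfolding L_def using \<open>D \<in> sets S\<close> by (intro emeasure_driving_sequences[OF drv]) (auto simp: S_def)
  also have "\<dots> \<le> (\<integral>\<^sup>+\<omega>. ennreal \<psi> + indicator ((space M - lin) \<union> cnt) \<omega> \<partial>M)"
  proof (rule nn_integral_mono_AE)
    show "AE \<omega> in M. emeasure L {x. (x, \<lambda>i. \<Gamma> i \<omega>, \<lambda>i. V i \<omega>) \<in> D} \<le> ennreal \<psi> + indicator ((space M - lin) \<union> cnt) \<omega>"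
      using s1 s2 AE_space
    proof eventually_elim
      case (elim \<omega>)
      show ?case
      proof (cases "\<omega> \<in> lin \<and> \<omega> \<notin> cnt")
        case True
        then show ?thesis using good[of \<omega>] elim by (simp add: add_increasing2)
      next
        case False
        then have "indicator ((space M - lin) \<union> cnt) \<omega> = (1 :: ennreal)" using elim by (auto simp: indicator_def)
        then show ?thesis using L.emeasure_space_le_1 L.emeasure_le_1 by (simp add: add_increasing)
      qed
    qed
  qed
  also have "\<dots> = ennreal \<psi> + emeasure M ((space M - lin) \<union> cnt)"
    by (subst nn_integral_add) (auto simp: emeasure_space_1)
  also have "\<dots> = ennreal (\<psi> + prob ((space M - lin) \<union> cnt))"
    by (simp add: emeasure_eq_measure ennreal_plus \<psi>_def)
  finally have "prob {\<omega>\<in>space M. (\<lambda>i. \<gamma> i \<omega>, \<lambda>i. \<Gamma> i \<omega>, \<lambda>i. V i \<omega>) \<in> D} \<le> \<psi> + prob ((space M - lin) \<union> cnt)"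
    unfolding emeasure_eq_measure by (subst (asm) ennreal_le_iff) (auto simp: \<psi>_def)
  also have "{\<omega>\<in>space M. (\<lambda>i. \<gamma> i \<omega>, \<lambda>i. \<Gamma> i \<omega>, \<lambda>i. V i \<omega>) \<in> D} = {\<omega>\<in>space M. \<bar>\<Delta> (\<lambda>i. \<gamma> i \<omega>) (\<lambda>i. \<Gamma> i \<omega>) (\<lambda>i. V i \<omega>)\<bar> < \<epsilon>}"
  proof -
    have "V i \<omega> \<in> space \<mu>" if "\<omega> \<in> space M" for i \<omega> using that by (rule measurable_space[rotated]) measurable
    then show ?thesis by (auto simp: D_def S_def space_pair_measure space_PiM)
  qed
  also have "prob ((space M - lin) \<union> cnt) \<le> (1 - prob lin) + 2 ^ N * exp (- (\<Sum>i<n. measure \<mu> (B i)) / 2)"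
  proof -
    have "prob ((space M - lin) \<union> cnt) \<le> prob (space M - lin) + prob cnt" by (rule measure_Un_le) auto
    moreover have "prob cnt \<le> 2 ^ N * exp (- (\<Sum>i<n. measure \<mu> (B i)) / 2)"
      unfolding cnt_def by (rule prob_count_lt_le[OF driving_sequencesD(3)[OF drv] B])
    ultimately show ?thesis by (simp add: prob_compl)
  qed
  finally show ?thesis by (simp add: \<psi>_def \<Delta>_def lin_def atLeast_def add.assoc)
qed

section \<open>From convergence in probability to the pointwise exponent\<close>

text \<open>The event that all \<open>E k\<close> with \<open>k \<ge> n\<close> occur is contained
  in each of them, hence null. No rate of convergence enters.\<close>

lemma (in prob_space) AE_not_eventually:
  assumes [measurable]: "\<And>k. E k \<in> events" and lim: "(\<lambda>k. prob (E k)) \<longlonglongrightarrow> 0"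
  shows "AE \<omega> in M. \<not> (\<forall>\<^sub>F k in sequentially. \<omega> \<in> E k)"
proof -
  have "AE \<omega> in M. \<omega> \<notin> (\<Inter>k\<in>{n..}. E k)" for n
  proof -
    have m: "(\<Inter>k\<in>{n..}. E k) \<in> events" by measurable
    have "prob (\<Inter>k\<in>{n..}. E k) \<le> prob (E k)" if "k \<ge> n" for k
      using that by (intro finite_measure_mono) auto
    then have "prob (\<Inter>k\<in>{n..}. E k) \<le> 0"
      by (intro LIMSEQ_le_const[OF lim]) auto
    then have "prob (\<Inter>k\<in>{n..}. E k) = 0" using measure_nonneg[of M "\<Inter>k\<in>{n..}. E k"] by linarith
    then show ?thesis
      by (intro AE_I[OF _ _ m]) (auto simp: emeasure_eq_measure)
  qed
  then have "AE \<omega> in M. \<forall>n. \<omega> \<notin> (\<Inter>k\<in>{n..}. E k)" unfolding AE_all_countable by blast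
  then show ?thesis by eventually_elim (auto simp: eventually_sequentially)
qed

text \<open>The order of choices matters: \<open>e\<close> determines N, \<open>n\<^sub>0\<close>
  and then \<open>M\<^sub>0\<close>, so that each failure costs less than e / 3. The radius
  \<open>r\<close> comes last, when the expected count has to exceed these fixed quantities.\<close>

lemma prob_field_increment_tendsto_0:
  fixes \<alpha> \<kappa> :: "real \<Rightarrow> real" and t c c' H K \<eta> \<beta> :: real and \<Gamma> \<gamma> :: "nat \<Rightarrow> 'w \<Rightarrow> real"
    and F :: "real \<Rightarrow> 'e \<Rightarrow> real"
  assumes drv: "driving_sequences M \<mu> \<Gamma> V \<gamma>"
    and \<rho> [measurable]: "\<rho> \<in> borel_measurable \<mu>" and \<rho>0: "\<And>v. v \<in> space \<mu> \<Longrightarrow> 0 < \<rho> v"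
    and \<alpha>: "0 < \<alpha> t" "\<alpha> t < 2" "lipschitz_at \<alpha> t" and \<kappa>: "\<kappa> t \<noteq> 0" "lipschitz_at \<kappa> t"
    and F: "\<forall>\<^sub>F s in nhds t. F s \<in> borel_measurable \<mu> \<and>
      (\<integral>\<^sup>+v. ennreal (\<rho> v * \<bar>F s v\<bar> powr \<alpha> s) \<partial>\<mu>) < \<infinity> \<and> (\<forall>v\<in>space \<mu>. \<bar>F s v\<bar> \<le> K)"
    and c: "0 < c" "0 < c'" and H: "H < 1"
    and E: "\<forall>\<^sub>F r in at_right 0. \<exists>E\<in>sets \<mu>. ennreal (c' * r) \<le> (\<integral>\<^sup>+v\<in>E. ennreal (\<rho> v) \<partial>\<mu>) \<and>
      (\<forall>v\<in>E. c * r powr H \<le> \<bar>F (t + r) v - F t v\<bar>)"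
    and \<beta>: "0 < \<eta>" "\<beta> = H + 1 / \<alpha> t + \<eta>"
    and Z: "Z = (\<lambda>s \<omega>. \<kappa> s * (\<Sum>i. \<gamma> i \<omega> * series_term (\<alpha> s) (F s) \<rho> (\<Gamma> i \<omega>) (V i \<omega>)))"
  shows "((\<lambda>r. measure M {\<omega>\<in>space M. \<bar>Z (t + r) \<omega> - Z t \<omega>\<bar> < r powr \<beta>}) \<longlongrightarrow> 0) (at_right 0)"
proof (rule order_tendstoI)
  interpret prob_space M using drv by (rule driving_sequencesD)
  have mV [measurable]: "V i \<in> M \<rightarrow>\<^sub>M \<mu>" for i
    using driving_sequencesD(3)[OF drv] by (auto simp: iid_law_def indep_vars_def)
  have dV: "distr M \<mu> (V 0) = \<mu>" using driving_sequencesD(3)[OF drv] by (auto simp: iid_law_def)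
  have \<mu>: "prob_space \<mu>" using prob_space_distr[OF mV[of 0]] by (simp add: dV)
  show "\<forall>\<^sub>F r in at_right 0. e < prob {\<omega>\<in>space M. \<bar>Z (t + r) \<omega> - Z t \<omega>\<bar> < r powr \<beta>}" if "e < 0" for e
    using that by (auto intro!: always_eventually elim: less_le_trans)
  fix e :: real assume e: "0 < e"
  define \<theta> where "\<theta> = 1 + \<alpha> t * \<eta> / 2"
  have \<theta>: "1 < \<theta>" using \<alpha> \<beta> by (simp add: \<theta>_def)
  have "\<forall>\<^sub>F N in sequentially. real (N choose (N div 2)) / 2 ^ N < e / 3"
    using e by (intro order_tendstoD[OF middle_binomial_ratio_tendsto_0]) auto
  then obtain N where N: "real (N choose (N div 2)) / 2 ^ N < e / 3" by (auto simp: eventually_sequentially)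
  have "\<forall>\<^sub>F n in sequentially. 1 - e / 3 < prob {\<omega>\<in>space M. \<forall>i\<ge>n. Suc i / 2 \<le> \<Gamma> i \<omega> \<and> \<Gamma> i \<omega> \<le> 4 * Suc i}"
    using e by (intro order_tendstoD[OF prob_arrivals_linear_tendsto[OF driving_sequencesD(2)[OF drv]]]) auto
  then obtain n\<^sub>0 where n\<^sub>0: "1 - e / 3 < prob {\<omega>\<in>space M. \<forall>i\<ge>n\<^sub>0. Suc i / 2 \<le> \<Gamma> i \<omega> \<and> \<Gamma> i \<omega> \<le> 4 * Suc i}"
    by (auto simp: eventually_sequentially)
  \<comment> \<open>Chosen so that an expected count of \<open>M\<^sub>0\<close> brings
    \<open>2 ^ N * exp (- M\<^sub>0 / 2)\<close> below e / 3.\<close>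
  define M\<^sub>0 where "M\<^sub>0 = 2 * \<bar>ln (e / 3 / 2 ^ N)\<bar> + 1"
  have M\<^sub>0: "0 \<le> M\<^sub>0" "2 ^ N * exp (- x / 2) < e / 3" if "M\<^sub>0 \<le> x" for x
  proof -
    have "- x / 2 < ln (e / 3 / 2 ^ N)" using that by (simp add: M\<^sub>0_def abs_if split: if_splits)
    then have "exp (- x / 2) < e / 3 / 2 ^ N"
      using e by (metis exp_less_mono exp_ln divide_pos_pos zero_less_numeral zero_less_power)
    then show "2 ^ N * exp (- x / 2) < e / 3" by (simp add: field_simps)
  qed (simp add: M\<^sub>0_def)
  have at_r: "filterlim (\<lambda>r. t + r) (nhds t) (at_right 0)"
    using tendsto_add[OF tendsto_const[of t] tendsto_ident_at[of 0 "{0<..}"]] by simp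
  have T1: "\<forall>\<^sub>F r in at_right 0. 8 * r powr \<theta> < 1"
    using \<theta> by (intro eventually_le_powr_at_right_0) auto
  \<comment> \<open>The inequality \<open>big\<close> below, multiplied by
    \<open>r powr (\<theta> - 1)\<close>, which is the inverse of \<open>T * r\<close>.\<close>
  have T2: "\<forall>\<^sub>F r in at_right 0. (M\<^sub>0 + n\<^sub>0 + 2 + 2 * c') * r powr (\<theta> - 1) < c' / 4"
    using \<theta> c by (intro eventually_le_powr_at_right_0) auto
  have r01: "\<forall>\<^sub>F r::real in at_right 0. 0 < r \<and> r < 1"
    using eventually_at_right_field[of "\<lambda>r. 0 < r \<and> r < (1::real)" 0] by (auto intro: exI[of _ 1])
  have K0: "0 \<le> \<bar>K\<bar>" by simp
  have \<alpha>ev: "\<forall>\<^sub>F s in nhds t. 0 < \<alpha> s \<and> \<alpha> s < 2"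
    using order_tendstoD[OF lipschitz_at_tendsto[OF \<alpha>(3)]] \<alpha>(1,2) by (intro eventually_conj) auto
  have Ft: "F t \<in> borel_measurable \<mu>" "(\<integral>\<^sup>+v. ennreal (\<rho> v * \<bar>F t v\<bar> powr \<alpha> t) \<partial>\<mu>) < \<infinity>"
    using eventually_nhds_x_imp_x[OF F] by auto
  show "\<forall>\<^sub>F r in at_right 0. prob {\<omega>\<in>space M. \<bar>Z (t + r) \<omega> - Z t \<omega>\<bar> < r powr \<beta>} < e"
    using E T1 T2 r01 eventually_compose_filterlim[OF F at_r] eventually_compose_filterlim[OF \<alpha>ev at_r]
      coefficient_lower_bound[OF \<alpha>(1,3) \<kappa> c(1) H K0 \<beta>]
  proof eventually_elim
    case (elim r)
    then have r: "0 < r" "r < 1" by auto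
    obtain E where Em: "E \<in> sets \<mu>" and mE: "ennreal (c' * r) \<le> (\<integral>\<^sup>+v\<in>E. ennreal (\<rho> v) \<partial>\<mu>)"
      and EF: "\<And>v. v \<in> E \<Longrightarrow> c * r powr H \<le> \<bar>F (t + r) v - F t v\<bar>" using elim(1) by auto
    \<comment> \<open>The inverse of the threshold, so that
      \<open>\<rho> v / g \<ge> r powr \<theta>\<close> reads
      \<open>g \<le> \<rho> v * T\<close>.\<close>
    define T where "T = r powr - \<theta>"
    have T: "8 < T" using elim(2) r by (simp add: T_def powr_minus field_simps)
    have rT: "T * r * r powr (\<theta> - 1) = 1"
      using r powr_add[of r "- \<theta> + 1" "\<theta> - 1"] powr_add[of r "- \<theta>" 1] by (simp add: T_def)
    have big: "M\<^sub>0 + (n\<^sub>0 + 2) < (T / 4 - 2) * (c' * r)"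
    proof -
      have "(M\<^sub>0 + n\<^sub>0 + 2 + 2 * c') * r powr (\<theta> - 1) < c' / 4 * (T * r * r powr (\<theta> - 1))"
        using elim(3) by (simp only: rT)
      then have "(M\<^sub>0 + n\<^sub>0 + 2 + 2 * c') * r powr (\<theta> - 1) < (T / 4 * c' * r) * r powr (\<theta> - 1)"
        by (simp add: mult_ac)
      then have "M\<^sub>0 + n\<^sub>0 + 2 + 2 * c' < T / 4 * c' * r"
        using r by (subst (asm) mult_less_cancel_right_pos) auto
      moreover have "2 * c' * r \<le> 2 * c'" using r c by simp
      ultimately show ?thesis by (simp add: algebra_simps)
    qed
    define B where "B i = {v\<in>E. n\<^sub>0 \<le> i \<and> 4 * real (Suc i) \<le> \<rho> v * T \<and> 2 * \<rho> v \<le> real (Suc i)}" for i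
    have Esp: "v \<in> space \<mu>" if "v \<in> E" for v using sets.sets_into_space[OF Em] that by auto
    have Bm: "B i \<in> sets \<mu>" for i
    proof -
      note [measurable] = Em
      have "B i = E \<inter> {v\<in>space \<mu>. n\<^sub>0 \<le> i \<and> 4 * real (Suc i) \<le> \<rho> v * T \<and> 2 * \<rho> v \<le> real (Suc i)}"
        using Esp by (auto simp: B_def)
      also have "\<dots> \<in> sets \<mu>" by measurable
      finally show ?thesis .
    qed
    obtain n where n: "M\<^sub>0 \<le> (\<Sum>i<n. measure \<mu> (B i))"
      using expected_count_lower_bound[OF \<mu> \<rho> \<rho>0 Em T _ mE M\<^sub>0(1)[OF order_refl] big] r c
      by (auto simp: B_def)
    have "prob {\<omega>\<in>space M. \<bar>Z (t + r) \<omega> - Z t \<omega>\<bar> < r powr \<beta>}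
        \<le> (N choose (N div 2)) / 2 ^ N
          + (1 - prob {\<omega>\<in>space M. \<forall>i\<ge>n\<^sub>0. Suc i / 2 \<le> \<Gamma> i \<omega> \<and> \<Gamma> i \<omega> \<le> 4 * Suc i})
          + 2 ^ N * exp (- (\<Sum>i<n. measure \<mu> (B i)) / 2)"
      unfolding Z
    proof (rule prob_increment_lt_le[OF drv \<rho> \<rho>0 \<alpha>(1,2) Ft])
      show "B i = {}" if "i < n\<^sub>0" for i using that by (auto simp: B_def)
      fix i and g :: real and v assume v: "v \<in> B i" and g: "Suc i / 2 \<le> g" "g \<le> 4 * Suc i"
      have g0: "0 < g" using g by (smt (verit) of_nat_0_less_iff zero_less_Suc half_gt_zero)
      have "r powr (1 + \<alpha> t * \<eta> / 2) \<le> \<rho> v / g"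
      proof -
        have "g \<le> \<rho> v * T" using v g by (simp add: B_def)
        then have "r powr \<theta> * g \<le> r powr \<theta> * (\<rho> v * T)" by (intro mult_left_mono) auto
        also have "\<dots> = \<rho> v" using r by (simp add: T_def powr_minus)
        finally show ?thesis using g0 by (simp add: \<theta>_def pos_le_divide_eq)
      qed
      moreover have "\<rho> v / g \<le> 1" using v g g0 by (simp add: B_def)
      moreover have "\<bar>F (t + r) v\<bar> \<le> \<bar>K\<bar>" using elim(5) v Esp by (force simp: B_def)
      moreover have "c * r powr H \<le> \<bar>F (t + r) v - F t v\<bar>" using v EF by (simp add: B_def)
      ultimately show "r powr \<beta> \<le> \<bar>\<kappa> (t + r) * ((\<rho> v / g) powr (1 / \<alpha> (t + r)) * F (t + r) v)
          - \<kappa> t * ((\<rho> v / g) powr (1 / \<alpha> t) * F t v)\<bar>"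
        using elim(7) by (simp add: mult.assoc)
    qed (use elim r Bm in auto)
    also have "\<dots> < e / 3 + e / 3 + e / 3"
      using N n\<^sub>0 M\<^sub>0(2)[OF n] by linarith
    finally show ?case by simp
  qed
qed

text \<open>Countably many exponents \<open>H + 1 / \<alpha> t + 1 / Suc n\<close> suffice. Almost
  surely each is violated infinitely often along one fixed sequence of radii, and every larger
  candidate exceeds one of them.\<close>

theorem pointwise_holder_exponent_series_le:
  fixes \<alpha> \<kappa> :: "real \<Rightarrow> real" and t c c' H K :: real and \<Gamma> \<gamma> :: "nat \<Rightarrow> 'w \<Rightarrow> real"
    and F :: "real \<Rightarrow> 'e \<Rightarrow> real"
  assumes drv: "driving_sequences M \<mu> \<Gamma> V \<gamma>"
    and \<rho> [measurable]: "\<rho> \<in> borel_measurable \<mu>" and \<rho>0: "\<And>v. v \<in> space \<mu> \<Longrightarrow> 0 < \<rho> v"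
    and \<alpha>: "0 < \<alpha> t" "\<alpha> t < 2" "lipschitz_at \<alpha> t" and \<kappa>: "\<kappa> t \<noteq> 0" "lipschitz_at \<kappa> t"
    and F: "\<forall>\<^sub>F s in nhds t. F s \<in> borel_measurable \<mu> \<and>
      (\<integral>\<^sup>+v. ennreal (\<rho> v * \<bar>F s v\<bar> powr \<alpha> s) \<partial>\<mu>) < \<infinity> \<and> (\<forall>v\<in>space \<mu>. \<bar>F s v\<bar> \<le> K)"
    and c: "0 < c" "0 < c'" and H: "H < 1"
    and E: "\<forall>\<^sub>F r in at_right 0. \<exists>E\<in>sets \<mu>. ennreal (c' * r) \<le> (\<integral>\<^sup>+v\<in>E. ennreal (\<rho> v) \<partial>\<mu>) \<and>
      (\<forall>v\<in>E. c * r powr H \<le> \<bar>F (t + r) v - F t v\<bar>)"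
    and Z: "Z = (\<lambda>s \<omega>. \<kappa> s * (\<Sum>i. \<gamma> i \<omega> * series_term (\<alpha> s) (F s) \<rho> (\<Gamma> i \<omega>) (V i \<omega>)))"
  shows "AE \<omega> in M. pointwise_holder_exponent (\<lambda>s. Z s \<omega>) t \<le> ereal (H + 1 / \<alpha> t)"
proof -
  interpret prob_space M using drv by (rule driving_sequencesD)
  have [measurable]: "V i \<in> M \<rightarrow>\<^sub>M \<mu>" for i
    using driving_sequencesD(3)[OF drv] by (auto simp: iid_law_def indep_vars_def)
  have [measurable]: "\<Gamma> i \<in> borel_measurable M" for i
    using driving_sequencesD(2)[OF drv] by (rule unit_poisson_arrivals_measurable)
  have [measurable]: "\<gamma> i \<in> borel_measurable M" for i
    using driving_sequencesD(4)[OF drv] by (rule iid_signs_measurable)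
  \<comment> \<open>The radii are kept inside a neighbourhood where \<open>F\<close> is measurable,
    so that the small-increment events are measurable.\<close>
  obtain d where d: "0 < d" "\<And>s. \<bar>s - t\<bar> < d \<Longrightarrow> F s \<in> borel_measurable \<mu>"
    using F unfolding eventually_nhds_metric dist_real_def by blast
  define r where "r k = d / 2 / real (Suc k)" for k
  have r0: "0 < r k" and rd: "r k < d" for k
  proof -
    show "0 < r k" using d by (simp add: r_def)
    have "r k \<le> d / 2 / 1" unfolding r_def using d by (intro divide_left_mono) auto
    also have "\<dots> < d" using d by simp
    finally show "r k < d" .
  qed
  have Zm: "Z s \<in> borel_measurable M" if "\<bar>s - t\<bar> < d" for s
  proof -
    note [measurable] = d(2)[OF that]
    show ?thesis unfolding Z series_term_def by measurable
  qed
  have r_lim0: "r \<longlonglongrightarrow> 0"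
  proof -
    have "(\<lambda>k. d / 2 * inverse (real (Suc k))) \<longlonglongrightarrow> d / 2 * 0"
      by (intro tendsto_mult tendsto_const LIMSEQ_inverse_real_of_nat)
    then show ?thesis unfolding r_def by (simp only: divide_inverse mult_zero_right)
  qed
  have r_lim: "filterlim r (at_right 0) sequentially" "filterlim r (at 0) sequentially"
    unfolding filterlim_at using r_lim0 r0 by (auto simp: less_imp_neq[THEN not_sym] intro!: always_eventually)
  define h where "h = H + 1 / \<alpha> t"
  define \<beta> where "\<beta> n = h + 1 / real (Suc n)" for n
  have "AE \<omega> in M. \<forall>n. \<not> (\<forall>\<^sub>F k in sequentially. \<omega> \<in> {\<omega>\<in>space M. \<bar>Z (t + r k) \<omega> - Z t \<omega>\<bar> < r k powr \<beta> n})"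
    unfolding AE_all_countable
  proof
    fix n
    show "AE \<omega> in M. \<not> (\<forall>\<^sub>F k in sequentially. \<omega> \<in> {\<omega>\<in>space M. \<bar>Z (t + r k) \<omega> - Z t \<omega>\<bar> < r k powr \<beta> n})"
    proof (rule AE_not_eventually)
      fix k
      have [measurable]: "Z (t + r k) \<in> borel_measurable M" "Z t \<in> borel_measurable M"
        using rd[of k] r0[of k] d by (auto intro!: Zm)
      show "{\<omega>\<in>space M. \<bar>Z (t + r k) \<omega> - Z t \<omega>\<bar> < r k powr \<beta> n} \<in> events" by measurable
    next
      have "((\<lambda>r. prob {\<omega>\<in>space M. \<bar>Z (t + r) \<omega> - Z t \<omega>\<bar> < r powr \<beta> n}) \<longlongrightarrow> 0) (at_right 0)"
        by (rule prob_field_increment_tendsto_0[OF drv \<rho> \<rho>0 \<alpha> \<kappa> F c H E _ _ Z, where \<eta>="1 / real (Suc n)"])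
           (auto simp: \<beta>_def h_def)
      from filterlim_compose[OF this r_lim(1)]
      show "(\<lambda>k. prob {\<omega>\<in>space M. \<bar>Z (t + r k) \<omega> - Z t \<omega>\<bar> < r k powr \<beta> n}) \<longlonglongrightarrow> 0" .
    qed
  qed
  then show ?thesis
    using AE_space
  proof eventually_elim
    case (elim \<omega>)
    have "b \<le> h" if lim: "((\<lambda>r. \<bar>Z (t + r) \<omega> - Z t \<omega>\<bar> / \<bar>r\<bar> powr b) \<longlongrightarrow> 0) (at 0)" for b
    proof (rule ccontr)
      assume "\<not> b \<le> h"
      then obtain n :: nat where n: "1 / real (Suc n) < b - h" using nat_approx_posE[of "b - h"] by auto
      have "(\<lambda>k. \<bar>Z (t + r k) \<omega> - Z t \<omega>\<bar> / \<bar>r k\<bar> powr b) \<longlonglongrightarrow> 0"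
        by (rule filterlim_compose[OF lim r_lim(2)])
      then have "\<forall>\<^sub>F k in sequentially. \<bar>Z (t + r k) \<omega> - Z t \<omega>\<bar> / \<bar>r k\<bar> powr b < 1"
        by (intro order_tendstoD) auto
      moreover have "\<forall>\<^sub>F k in sequentially. r k < 1" using r_lim0 by (intro order_tendstoD) auto
      ultimately have "\<forall>\<^sub>F k in sequentially. \<omega> \<in> {\<omega>\<in>space M. \<bar>Z (t + r k) \<omega> - Z t \<omega>\<bar> < r k powr \<beta> n}"
      proof eventually_elim
        case (elim k)
        have "\<bar>Z (t + r k) \<omega> - Z t \<omega>\<bar> < r k powr b"
          using elim(1) r0[of k] by (simp add: field_simps)
        also have "\<dots> \<le> r k powr \<beta> n"
          using n elim(2) r0[of k] by (intro powr_mono') (auto simp: \<beta>_def)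
        finally show ?case using \<open>\<omega> \<in> space M\<close> by simp
      qed
      then show False using elim(1) by blast
    qed
    then show ?case
      unfolding pointwise_holder_exponent_def h_def by (intro Sup_least) auto
  qed
qed

section \<open>The jump sets\<close>

lemma ennreal_mult_inverse_le_iff:
  assumes "0 < u" "0 \<le> K"
  shows "ennreal (1 / u) * X \<le> ennreal K \<longleftrightarrow> X \<le> ennreal (K * u)"
proof (cases X)
  case (real x)
  then show ?thesis using assms by (simp add: ennreal_mult[symmetric] field_simps)
qed (use assms in \<open>auto simp: ennreal_mult_top top_unique\<close>)

lemma ennreal_le_cancel_affine:
  assumes "ennreal a \<le> ennreal b * X + ennreal c" "0 < b" "0 \<le> c"
  shows "ennreal ((a - c) / b) \<le> X"
proof (cases X)
  case (real x)
  then have "ennreal a \<le> ennreal (b * x + c)"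
    using assms by (simp add: ennreal_mult[symmetric])
  then have "a \<le> b * x + c \<or> a \<le> 0" using real assms by (subst (asm) ennreal_le_iff2) auto
  then have "(a - c) / b \<le> x"
  proof
    assume "a \<le> 0"
    then have "(a - c) / b \<le> 0" using assms by (intro divide_nonpos_pos) auto
    then show ?thesis using real by linarith
  qed (use assms in \<open>simp add: field_simps\<close>)
  then show ?thesis using real by (simp add: ennreal_leI)
qed simp

text \<open>A function bounded by \<open>A\<close> whose square has a large integral is at least \<open>b\<close> on a large set, since
  \<open>\<phi>\<^sup>2 \<le> b powr (2 - p) * \<bar>\<phi>\<bar> powr p\<close> elsewhere.\<close>

lemma emeasure_large_values_ge:
  fixes \<phi> :: "'e \<Rightarrow> real"
  assumes \<phi> [measurable]: "\<phi> \<in> borel_measurable m" and A: "0 < A" "\<And>x. x \<in> space m \<Longrightarrow> \<bar>\<phi> x\<bar> \<le> A"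
    and p: "0 < p" "p < 2" and b: "0 < b"
    and I: "0 \<le> I" "(\<integral>\<^sup>+x. ennreal (\<bar>\<phi> x\<bar> powr p) \<partial>m) \<le> ennreal I"
    and S: "ennreal S \<le> (\<integral>\<^sup>+x. ennreal ((\<phi> x)\<^sup>2) \<partial>m)"
  shows "ennreal ((S - b powr (2 - p) * I) / A\<^sup>2) \<le> emeasure m {x\<in>space m. b \<le> \<bar>\<phi> x\<bar>}"
proof (rule ennreal_le_cancel_affine)
  let ?E = "{x\<in>space m. b \<le> \<bar>\<phi> x\<bar>}"
  have "ennreal S \<le> (\<integral>\<^sup>+x. ennreal ((\<phi> x)\<^sup>2) \<partial>m)" by (rule S)
  also have "\<dots> \<le> (\<integral>\<^sup>+x. ennreal (A\<^sup>2) * indicator ?E x + ennreal (b powr (2 - p)) * ennreal (\<bar>\<phi> x\<bar> powr p) \<partial>m)"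
  proof (rule nn_integral_mono)
    fix x assume x: "x \<in> space m"
    show "ennreal ((\<phi> x)\<^sup>2) \<le> ennreal (A\<^sup>2) * indicator ?E x + ennreal (b powr (2 - p)) * ennreal (\<bar>\<phi> x\<bar> powr p)"
    proof (cases "b \<le> \<bar>\<phi> x\<bar>")
      case True
      have "(\<phi> x)\<^sup>2 \<le> A\<^sup>2" using A(2)[OF x] A(1) by (simp add: abs_le_square_iff[symmetric])
      then show ?thesis using True x by (simp add: add_increasing2 ennreal_leI)
    next
      case False
      have "(\<phi> x)\<^sup>2 = \<bar>\<phi> x\<bar> powr (2 - p) * \<bar>\<phi> x\<bar> powr p"
        by (cases "\<phi> x = 0") (auto simp flip: powr_add)
      also have "\<dots> \<le> b powr (2 - p) * \<bar>\<phi> x\<bar> powr p"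
        using False p by (intro mult_right_mono powr_mono2) auto
      finally show ?thesis using False by (simp add: ennreal_leI flip: ennreal_mult)
    qed
  qed
  also have "\<dots> = ennreal (A\<^sup>2) * emeasure m ?E + ennreal (b powr (2 - p)) * (\<integral>\<^sup>+x. ennreal (\<bar>\<phi> x\<bar> powr p) \<partial>m)"
    by (simp add: nn_integral_add nn_integral_cmult)
  also have "\<dots> \<le> ennreal (A\<^sup>2) * emeasure m ?E + ennreal (b powr (2 - p)) * ennreal I"
    by (intro add_left_mono mult_left_mono I) auto
  finally show "ennreal S \<le> ennreal (A\<^sup>2) * emeasure m ?E + ennreal (b powr (2 - p) * I)"
    using I by (simp add: ennreal_mult)
qed (use A I in auto)

lemma abs_diff_le_deriv_bound:
  fixes f :: "real \<Rightarrow> real"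
  assumes U: "is_interval U" "s \<in> U" "t \<in> U" and f: "\<And>v. v \<in> U \<Longrightarrow> f differentiable (at v)"
    and K: "\<And>v. v \<in> U \<Longrightarrow> \<bar>deriv f v\<bar> \<le> K"
  shows "\<bar>f s - f t\<bar> \<le> K * \<bar>s - t\<bar>"
proof -
  have "norm (f s - f t) \<le> K * norm (s - t)"
  proof (rule field_differentiable_bound[of U f "deriv f"])
    show "convex U" using U by (simp add: is_interval_convex)
    show "(f has_field_derivative deriv f v) (at v within U)" if "v \<in> U" for v
      using f[OF that] by (auto intro: has_field_derivative_at_within simp: DERIV_deriv_iff_real_differentiable)
  qed (use U K in auto)
  then show ?thesis by simp
qed

text \<open>At scale \<open>r powr H\<close> the difference in the first argument is bounded, has
  p-th moment O(r) and second moment at least \<open>S / 2 * r\<close>, which forces large values on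
  a set of measure of order \<open>r\<close>. Moving the second argument to \<open>t + r\<close>
  costs at most \<open>K * r\<close>, negligible since \<open>H < 1\<close>; half of the threshold
  survives.\<close>

lemma eventually_diagonal_jumps:
  fixes f :: "real \<Rightarrow> real \<Rightarrow> 'e \<Rightarrow> real" and g :: "real \<Rightarrow> real"
  assumes U: "open U" "is_interval U" "t \<in> U"
    and f: "\<And>s u. s \<in> U \<Longrightarrow> u \<in> U \<Longrightarrow> f s u \<in> borel_measurable m"
    and H: "H < 1"
    and diff: "\<And>s. s \<in> U \<Longrightarrow> AE x in m. \<forall>v\<in>U. (\<lambda>w. f s w x) differentiable (at v)"
    and K: "\<And>u v x. u \<in> U \<Longrightarrow> v \<in> U \<Longrightarrow> x \<in> space m \<Longrightarrow> \<bar>deriv_snd f v u x\<bar> \<le> K"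
    and A: "0 < A" "\<forall>\<^sub>F r in at_right 0. \<forall>x\<in>space m. 1 / r powr H * \<bar>f (t + r) t x - f t t x\<bar> \<le> A"
    and p: "0 < p" "p < 2" and I: "0 < I" "\<forall>\<^sub>F r in at_right 0.
      ennreal (1 / r powr (1 + p * H)) * (\<integral>\<^sup>+x. ennreal (\<bar>f (t + r) t x - f t t x\<bar> powr p) \<partial>m) \<le> ennreal I"
    and S: "0 < S" "((\<lambda>r. ennreal (1 / r powr (1 + 2 * H)) *
      (\<integral>\<^sup>+x. ennreal ((f (t + r) t x - f t t x)\<^sup>2) \<partial>m)) \<longlongrightarrow> ennreal S) (at_right 0)"
  obtains c c' where "0 < c" "0 < c'" "\<forall>\<^sub>F r in at_right 0. \<exists>E\<in>sets m. ennreal (c' * r) \<le> emeasure m E \<and>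
      (\<forall>x\<in>E. c * r powr H \<le> \<bar>f (t + r) (t + r) x - f t t x\<bar>)"
proof -
  \<comment> \<open>Solves \<open>b powr (2 - p) * I = S / 4\<close>: values below the threshold
    then use up half of the available \<open>S / 2\<close>, and the rest divided by
    \<open>A\<^sup>2\<close> is \<open>c'\<close>.\<close>
  define b where "b = (S / (4 * I)) powr (1 / (2 - p))"
  have b: "0 < b" "b powr (2 - p) * I = S / 4" using S I p by (simp_all add: b_def powr_powr)
  define c' where "c' = S / (4 * A\<^sup>2)"
  have c': "0 < c'" using S A by (simp add: c'_def)
  have "((\<lambda>r. t + r) \<longlongrightarrow> t + 0) (at_right 0)" by (intro tendsto_intros)
  then have tU: "\<forall>\<^sub>F r in at_right 0. t + r \<in> U" using U by (auto intro: topological_tendstoD)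
  have S2: "\<forall>\<^sub>F r in at_right 0. ennreal (S / 2) < ennreal (1 / r powr (1 + 2 * H)) *
      (\<integral>\<^sup>+x. ennreal ((f (t + r) t x - f t t x)\<^sup>2) \<partial>m)"
    using S by (intro order_tendstoD[OF S(2)]) (simp add: ennreal_less_iff)
  have KH: "\<forall>\<^sub>F r in at_right 0. K * r powr (1 - H) < b / 2"
    using b H by (intro eventually_le_powr_at_right_0) auto
  have "\<forall>\<^sub>F r::real in at_right 0. 0 < r" by (rule eventually_at_right_less)
  with tU A(2) I(2) S2 KH
  have "\<forall>\<^sub>F r in at_right 0. \<exists>E\<in>sets m. ennreal (c' * r) \<le> emeasure m E \<and>
      (\<forall>x\<in>E. b / 2 * r powr H \<le> \<bar>f (t + r) (t + r) x - f t t x\<bar>)"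
  proof eventually_elim
    case (elim r)
    then have r: "0 < r" and trU: "t + r \<in> U" by auto
    define \<phi> where "\<phi> x = f (t + r) t x - f t t x" for x
    have \<phi>m [measurable]: "\<phi> \<in> borel_measurable m"
      unfolding \<phi>_def [abs_def] using f trU U by (intro borel_measurable_diff) auto
    obtain N where N: "N \<in> null_sets m" "{x\<in>space m. \<not> (\<forall>v\<in>U. (\<lambda>w. f (t + r) w x) differentiable (at v))} \<subseteq> N"
      using diff[OF trU] by (auto simp: eventually_ae_filter)
    define E where "E = {x\<in>space m. b * r powr H \<le> \<bar>\<phi> x\<bar>}"
    have Em: "E \<in> sets m" unfolding E_def by measurable
    have "ennreal ((S / 2 * r powr (1 + 2 * H) - (b * r powr H) powr (2 - p) * (I * r powr (1 + p * H))) / (A * r powr H)\<^sup>2)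
        \<le> emeasure m E"
      unfolding E_def
    proof (rule emeasure_large_values_ge[OF \<phi>m _ _ p])
      show "\<bar>\<phi> x\<bar> \<le> A * r powr H" if "x \<in> space m" for x
        using elim(2) that r by (simp add: \<phi>_def field_simps)
      show "(\<integral>\<^sup>+x. ennreal (\<bar>\<phi> x\<bar> powr p) \<partial>m) \<le> ennreal (I * r powr (1 + p * H))"
        using elim(3) r I by (subst (asm) ennreal_mult_inverse_le_iff) (auto simp: \<phi>_def)
      show "ennreal (S / 2 * r powr (1 + 2 * H)) \<le> (\<integral>\<^sup>+x. ennreal ((\<phi> x)\<^sup>2) \<partial>m)"
      proof (rule ccontr)
        assume "\<not> ?thesis"
        then have "(\<integral>\<^sup>+x. ennreal ((\<phi> x)\<^sup>2) \<partial>m) \<le> ennreal (S / 2 * r powr (1 + 2 * H))" by simp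
        then have "ennreal (1 / r powr (1 + 2 * H)) * (\<integral>\<^sup>+x. ennreal ((\<phi> x)\<^sup>2) \<partial>m) \<le> ennreal (S / 2)"
          using r S by (subst ennreal_mult_inverse_le_iff) auto
        then show False using elim(4) by (simp add: \<phi>_def)
      qed
    qed (use A I r b in auto)
    also have "(S / 2 * r powr (1 + 2 * H) - (b * r powr H) powr (2 - p) * (I * r powr (1 + p * H))) / (A * r powr H)\<^sup>2 = c' * r"
    proof -
      have "(b * r powr H) powr (2 - p) * (I * r powr (1 + p * H))
          = (b powr (2 - p) * I) * ((r powr H) powr (2 - p) * r powr (1 + p * H))"
        using b by (simp add: powr_mult)
      also have "(r powr H) powr (2 - p) * r powr (1 + p * H) = r powr (1 + 2 * H)"
        by (simp add: powr_powr algebra_simps flip: powr_add)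
      finally have 1: "(b * r powr H) powr (2 - p) * (I * r powr (1 + p * H)) = S / 4 * r powr (1 + 2 * H)"
        by (simp only: b)
      have 2: "r powr (1 + 2 * H) = r * (r powr H)\<^sup>2"
      proof -
        have "r powr (1 + 2 * H) = r powr (1 + (H + H))" by simp
        also have "\<dots> = r powr 1 * (r powr H * r powr H)" by (simp only: powr_add)
        finally show ?thesis using r by (simp add: power2_eq_square)
      qed
      show ?thesis unfolding 1 2 using r A by (simp add: c'_def power_mult_distrib)
    qed
    also have "emeasure m E = emeasure m (E - N)"
      using N(1) Em by (simp add: emeasure_Diff_null_set)
    finally have "ennreal (c' * r) \<le> emeasure m (E - N)" .
    moreover have "b / 2 * r powr H \<le> \<bar>f (t + r) (t + r) x - f t t x\<bar>" if x: "x \<in> E - N" for x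
    proof -
      have xm: "x \<in> space m" using x by (simp add: E_def)
      have "\<bar>f (t + r) (t + r) x - f (t + r) t x\<bar> \<le> K * \<bar>(t + r) - t\<bar>"
      proof (rule abs_diff_le_deriv_bound[OF U(2) trU U(3)])
        show "(\<lambda>w. f (t + r) w x) differentiable (at v)" if "v \<in> U" for v
          using N(2) x xm that by auto
        show "\<bar>deriv (\<lambda>w. f (t + r) w x) v\<bar> \<le> K" if "v \<in> U" for v
          using K[OF that trU xm] by (simp add: deriv_snd_def)
      qed
      also have "\<dots> = K * r powr (1 - H) * r powr H" using r by (simp flip: powr_add)
      also have "\<dots> \<le> b / 2 * r powr H" using elim(5) by (intro mult_right_mono) auto
      finally have "\<bar>f (t + r) (t + r) x - f (t + r) t x\<bar> \<le> b / 2 * r powr H" .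
      moreover have "b * r powr H \<le> \<bar>f (t + r) t x - f t t x\<bar>" using x by (simp add: E_def \<phi>_def)
      ultimately show ?thesis by linarith
    qed
    ultimately show ?case using Em N(1) by (intro bexI[of _ "E - N"]) auto
  qed
  then show ?thesis using that[of "b / 2" c'] b c' by simp
qed

lemma C1_differentiable_on_lipschitz_at:
  fixes \<phi> :: "real \<Rightarrow> real"
  assumes "\<phi> C1_differentiable_on U" "t \<in> U"
  shows "lipschitz_at \<phi> t"
proof -
  obtain D where "(\<phi> has_vector_derivative D t) (at t)"
    using assms by (auto simp: C1_differentiable_on_def)
  then show ?thesis
    by (intro lipschitz_at_differentiable) (simp add: has_real_derivative_iff_has_vector_derivative)
qed

theorem theorem2:
  fixes U :: "real set" and c d t :: real and \<alpha> b h :: "real \<Rightarrow> real"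
    and m :: "'e measure" and \<rho> :: "'e \<Rightarrow> real" and f :: "real \<Rightarrow> real \<Rightarrow> 'e \<Rightarrow> real"
    and M :: "'w measure" and \<Gamma> \<gamma> :: "nat \<Rightarrow> 'w \<Rightarrow> real" and V :: "nat \<Rightarrow> 'w \<Rightarrow> 'e"
    and X :: "real \<Rightarrow> real \<Rightarrow> 'w \<Rightarrow> real" and Y :: "real \<Rightarrow> 'w \<Rightarrow> real"
  assumes U: "open U" "is_interval U" "t \<in> U"
    and \<alpha>: "\<alpha> C1_differentiable_on U" "\<alpha> ` U \<subseteq> {c..d}" "0 < c" "d < 2"
    and b: "b C1_differentiable_on U" "bounded (b ` U)"
    (* not in the source: false without it, since b = 0 gives Y = 0 and exponent \<infinity> *)
    and b_nonzero: "b t \<noteq> 0"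
    and f: "\<And>s u. s \<in> U \<Longrightarrow> u \<in> U \<Longrightarrow> f s u \<in> F_class (\<alpha> u) m"
    and X_and_2: "finite_case U c d \<alpha> b m f M \<Gamma> V \<gamma> X \<or>
      sigma_finite_case U c d \<alpha> b m \<rho> f M \<Gamma> V \<gamma> X"
    and Y: "Y = (\<lambda>s. X s s)"
    (* not in the source: false without it, e.g. f s u x = 1 + (max 0 (s - u - x))^2, \<alpha> constant,
       h = 2 + 1/\<alpha>, m = Lebesgue measure on [0,1], U bounded, b = 1, where Y is constant *)
    and h_bound: "h t < 1 + 1 / \<alpha> t"
    and 1: "\<And>s. s \<in> U \<Longrightarrow> AE x in m. \<forall>v\<in>U. (\<lambda>w. f s w x) differentiable (at v)"
    and 3: "\<exists>K>0. \<forall>u\<in>U. \<forall>v\<in>U. \<forall>x\<in>space m. \<bar>f v u x\<bar> \<le> K \<and> \<bar>deriv_snd f v u x\<bar> \<le> K"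
    and 4: "\<exists>\<epsilon>\<^sub>0 K. 0 < \<epsilon>\<^sub>0 \<and> \<epsilon>\<^sub>0 < 1 \<and> 0 < K \<and>
      (\<forall>r x. 0 < r \<and> r < \<epsilon>\<^sub>0 \<and> t + r \<in> U \<and> x \<in> space m \<longrightarrow>
        1 / r powr (h t - 1 / \<alpha> t) * \<bar>f (t + r) t x - f t t x\<bar> \<le> K)"
    and 5: "\<exists>p. \<alpha> t < p \<and> p < 2 \<and> 1 \<le> p \<and> (\<forall>\<epsilon>>0. \<exists>K>0. \<forall>r. 0 < r \<and> r \<le> \<epsilon> \<and> t + r \<in> U \<longrightarrow>
        ennreal (1 / r powr (1 + p * (h t - 1 / \<alpha> t))) *
          (\<integral>\<^sup>+x. ennreal (\<bar>f (t + r) t x - f t t x\<bar> powr p) \<partial>m) \<le> ennreal K)"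
    and 6: "\<forall>\<epsilon>>0. \<exists>K>0. \<forall>r. 0 < r \<and> r \<le> \<epsilon> \<and> t + r \<in> U \<longrightarrow>
        (\<integral>\<^sup>+x. ennreal (\<bar>f (t + r) t x\<bar>\<^sup>2) \<partial>m) \<le> ennreal K \<and>
        (\<integral>\<^sup>+x. ennreal (\<bar>f (t + r) (t + r) x\<bar>\<^sup>2) \<partial>m) \<le> ennreal K \<and>
        ennreal (1 / r\<^sup>2) *
          (\<integral>\<^sup>+x. ennreal (\<bar>f (t + r) (t + r) x - f (t + r) t x\<bar>\<^sup>2) \<partial>m) \<le> ennreal K"
    and 7: "(INF v\<in>U. \<integral>\<^sup>+x. ennreal ((f v v x)\<^sup>2) \<partial>m) > 0"
    and 8: "\<exists>g :: real \<Rightarrow> real. (\<forall>v\<in>U. 0 < g v) \<and>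
      ((\<lambda>r. ennreal (1 / r powr (1 + 2 * (h t - 1 / \<alpha> t))) *
          (\<integral>\<^sup>+x. ennreal ((f (t + r) t x - f t t x)\<^sup>2) \<partial>m)) \<longlongrightarrow> ennreal (g t)) (at_right 0)"
  shows "AE \<omega> in M. pointwise_holder_exponent (\<lambda>s. Y s \<omega>) t \<le> ereal (h t)"
proof -
  define H where "H = h t - 1 / \<alpha> t"
  have H: "H < 1" using h_bound by (simp add: H_def)
  have \<alpha>U: "c \<le> \<alpha> s" "\<alpha> s \<le> d" "0 < \<alpha> s" "\<alpha> s < 2" if "s \<in> U" for s
    using \<alpha>(2,3,4) that by force+
  have lip\<alpha>: "lipschitz_at \<alpha> t" using C1_differentiable_on_lipschitz_at[OF \<alpha>(1) U(3)] .
  have nhdsU: "\<forall>\<^sub>F s in nhds t. s \<in> U" using U by (intro eventually_nhds_in_open) auto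
  have "((\<lambda>r. t + r) \<longlongrightarrow> t + 0) (at_right 0)" by (intro tendsto_intros)
  then have tU: "\<forall>\<^sub>F r in at_right 0. t + r \<in> U" using U by (auto intro: topological_tendstoD)
  have rpos: "\<forall>\<^sub>F r::real in at_right 0. 0 < r" by (rule eventually_at_right_less)
  have fm: "f s u \<in> borel_measurable m" and ffin: "(\<integral>\<^sup>+x. ennreal (\<bar>f s u x\<bar> powr \<alpha> u) \<partial>m) < \<infinity>"
    if "s \<in> U" "u \<in> U" for s u
    using f[OF that] by (auto simp: F_class_def)
  obtain K where K: "0 < K" "\<And>u v x. u \<in> U \<Longrightarrow> v \<in> U \<Longrightarrow> x \<in> space m \<Longrightarrow> \<bar>f v u x\<bar> \<le> K \<and> \<bar>deriv_snd f v u x\<bar> \<le> K"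
    using 3 by metis
  obtain \<epsilon>\<^sub>0 A where A: "0 < \<epsilon>\<^sub>0" "0 < A" "\<And>r x. 0 < r \<Longrightarrow> r < \<epsilon>\<^sub>0 \<Longrightarrow> t + r \<in> U \<Longrightarrow> x \<in> space m \<Longrightarrow>
      1 / r powr H * \<bar>f (t + r) t x - f t t x\<bar> \<le> A"
    using 4 unfolding H_def by blast
  obtain p where p: "\<alpha> t < p" "p < 2" and p5: "\<forall>\<epsilon>>0. \<exists>K>0. \<forall>r. 0 < r \<and> r \<le> \<epsilon> \<and> t + r \<in> U \<longrightarrow>
      ennreal (1 / r powr (1 + p * H)) * (\<integral>\<^sup>+x. ennreal (\<bar>f (t + r) t x - f t t x\<bar> powr p) \<partial>m) \<le> ennreal K"
    using 5 unfolding H_def by blast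
  obtain I where I: "0 < I" "\<And>r. 0 < r \<Longrightarrow> r \<le> 1 \<Longrightarrow> t + r \<in> U \<Longrightarrow>
      ennreal (1 / r powr (1 + p * H)) * (\<integral>\<^sup>+x. ennreal (\<bar>f (t + r) t x - f t t x\<bar> powr p) \<partial>m) \<le> ennreal I"
    using p5[rule_format, OF zero_less_one] by blast
  obtain g where g: "0 < g t" "((\<lambda>r. ennreal (1 / r powr (1 + 2 * H)) *
      (\<integral>\<^sup>+x. ennreal ((f (t + r) t x - f t t x)\<^sup>2) \<partial>m)) \<longlongrightarrow> ennreal (g t)) (at_right 0)"
    using 8 U(3) unfolding H_def by blast
  have p0: "0 < p" using p \<alpha>U[OF U(3)] by linarith
  have evA: "\<forall>\<^sub>F r in at_right 0. \<forall>x\<in>space m. 1 / r powr H * \<bar>f (t + r) t x - f t t x\<bar> \<le> A"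
  proof -
    have "\<forall>\<^sub>F r in at_right 0. r < \<epsilon>\<^sub>0" using A(1) by (intro order_tendstoD[OF tendsto_ident_at]) auto
    with tU rpos show ?thesis by eventually_elim (use A(3) in auto)
  qed
  have evI: "\<forall>\<^sub>F r in at_right 0. ennreal (1 / r powr (1 + p * H)) *
      (\<integral>\<^sup>+x. ennreal (\<bar>f (t + r) t x - f t t x\<bar> powr p) \<partial>m) \<le> ennreal I"
  proof -
    have "\<forall>\<^sub>F r::real in at_right 0. r < 1" by (intro order_tendstoD[OF tendsto_ident_at]) auto
    with tU rpos show ?thesis by eventually_elim (use I(2) in auto)
  qed
  obtain c\<^sub>1 c\<^sub>2 where c: "0 < c\<^sub>1" "0 < c\<^sub>2" "\<forall>\<^sub>F r in at_right 0. \<exists>E\<in>sets m. ennreal (c\<^sub>2 * r) \<le> emeasure m E \<and>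
      (\<forall>x\<in>E. c\<^sub>1 * r powr H \<le> \<bar>f (t + r) (t + r) x - f t t x\<bar>)"
    by (rule eventually_diagonal_jumps[OF U fm H 1 _ A(2) evA p0 p(2) I(1) evI g]) (use K in blast)+
  define \<kappa> where "\<kappa> s = b s * C_const (\<alpha> s) powr (1 / \<alpha> s)" for s
  have lip\<kappa>: "lipschitz_at \<kappa> t"
    unfolding \<kappa>_def [abs_def]
    by (intro lipschitz_at_mult C1_differentiable_on_lipschitz_at[OF b(1) U(3)]
        lipschitz_at_compose[OF lip\<alpha>, where \<psi>="\<lambda>\<eta>. C_const \<eta> powr (1 / \<eta>)"]
        lipschitz_at_C_const_powr \<alpha>U(3,4) U)
  have \<kappa>0: "\<kappa> t \<noteq> 0"
    using b_nonzero C_const_pos[OF \<alpha>U(3,4)[OF U(3)]] by (simp add: \<kappa>_def)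
  have goal: "H + 1 / \<alpha> t = h t" by (simp add: H_def)
  from X_and_2 show ?thesis
  proof
    assume fin: "finite_case U c d \<alpha> b m f M \<Gamma> V \<gamma> X"
    define \<mu> where "\<mu> = normalized m"
    define e where "e = measure m (space m)"
    interpret m: finite_measure m using fin by (simp add: finite_case_def)
    have drv: "driving_sequences M \<mu> \<Gamma> V \<gamma>" and X: "X = field_finite b \<alpha> m f \<Gamma> V \<gamma>"
      using fin by (auto simp: finite_case_def \<mu>_def)
    interpret M: prob_space M using drv by (rule driving_sequencesD)
    have dV: "V 0 \<in> M \<rightarrow>\<^sub>M \<mu>" "distr M \<mu> (V 0) = \<mu>"
      using driving_sequencesD(3)[OF drv] by (auto simp: iid_law_def M.indep_vars_def)
    interpret \<mu>: prob_space \<mu> using M.prob_space_distr[OF dV(1)] by (simp add: dV(2))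
    have sm1: "sets \<mu> = sets m" by (simp add: \<mu>_def normalized_def)
    note sm = sm1 sets_eq_imp_space_eq[OF sm1]
    have e: "0 < e"
    proof (rule ccontr)
      assume "\<not> 0 < e"
      then have "emeasure m (space m) = 0" by (simp add: e_def m.emeasure_eq_measure zero_less_measure_iff)
      then show False using \<mu>.emeasure_space_1 unfolding sm by (simp add: \<mu>_def normalized_def)
    qed
    have em: "1 / emeasure m (space m) = ennreal (1 / e)"
      using e by (simp add: e_def m.emeasure_eq_measure divide_ennreal flip: ennreal_1)
    have em\<mu>: "emeasure \<mu> B = ennreal (1 / e) * emeasure m B" for B
      by (simp add: \<mu>_def normalized_def em)
    have lip: "lipschitz_at (\<lambda>s. e powr (1 / \<alpha> s)) t"
    proof -
      have "lipschitz_at (\<lambda>s. 1 / \<alpha> s) t"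
        by (rule lipschitz_at_compose[OF lip\<alpha>])
           (use \<alpha>U[OF U(3)] in \<open>auto intro!: lipschitz_at_differentiable derivative_eq_intros\<close>)
      then show ?thesis
        by (rule lipschitz_at_compose) (use e in \<open>auto intro!: lipschitz_at_differentiable derivative_eq_intros\<close>)
    qed
    have "AE \<omega> in M. pointwise_holder_exponent (\<lambda>s. Y s \<omega>) t \<le> ereal (H + 1 / \<alpha> t)"
    proof (rule pointwise_holder_exponent_series_le[OF drv, where \<rho>="\<lambda>_. 1" and F="\<lambda>s. f s s" and K=K
          and c=c\<^sub>1 and c'="c\<^sub>2 / e" and \<kappa>="\<lambda>s. e powr (1 / \<alpha> s) * \<kappa> s"])
      show "lipschitz_at (\<lambda>s. e powr (1 / \<alpha> s) * \<kappa> s) t" by (rule lipschitz_at_mult[OF lip lip\<kappa>])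
      show "\<forall>\<^sub>F s in nhds t. f s s \<in> borel_measurable \<mu> \<and>
          (\<integral>\<^sup>+v. ennreal (1 * \<bar>f s s v\<bar> powr \<alpha> s) \<partial>\<mu>) < \<infinity> \<and> (\<forall>v\<in>space \<mu>. \<bar>f s s v\<bar> \<le> K)"
        using nhdsU
      proof eventually_elim
        case (elim s)
        have [measurable]: "f s s \<in> borel_measurable m" using fm elim by auto
        have "(\<integral>\<^sup>+v. ennreal (\<bar>f s s v\<bar> powr \<alpha> s) \<partial>\<mu>) = ennreal (1 / e) * (\<integral>\<^sup>+v. ennreal (\<bar>f s s v\<bar> powr \<alpha> s) \<partial>m)"
          by (simp add: \<mu>_def normalized_def em nn_integral_scale_measure)
        also have "\<dots> < \<infinity>" using ffin[OF elim elim] by (simp add: ennreal_mult_less_top)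
        finally show ?case using K elim by (simp add: sm measurable_cong_sets[OF sm(1) refl])
      qed
      show "\<forall>\<^sub>F r in at_right 0. \<exists>E\<in>sets \<mu>. ennreal (c\<^sub>2 / e * r) \<le> (\<integral>\<^sup>+v\<in>E. ennreal 1 \<partial>\<mu>) \<and>
          (\<forall>v\<in>E. c\<^sub>1 * r powr H \<le> \<bar>f (t + r) (t + r) v - f t t v\<bar>)"
        using c(3) rpos
      proof eventually_elim
        case (elim r)
        then obtain E where E: "E \<in> sets m" "ennreal (c\<^sub>2 * r) \<le> emeasure m E"
          "\<forall>x\<in>E. c\<^sub>1 * r powr H \<le> \<bar>f (t + r) (t + r) x - f t t x\<bar>" by auto
        have "ennreal (c\<^sub>2 / e * r) = ennreal (1 / e) * ennreal (c\<^sub>2 * r)"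
          using e c elim by (simp flip: ennreal_mult)
        also have "\<dots> \<le> emeasure \<mu> E" unfolding em\<mu> using E(2) by (rule mult_left_mono) simp
        also have "\<dots> = (\<integral>\<^sup>+v\<in>E. ennreal 1 \<partial>\<mu>)" using E(1) by (simp add: sm)
        finally show ?case using E by (auto simp: sm)
      qed
      show "Y = (\<lambda>s \<omega>. e powr (1 / \<alpha> s) * \<kappa> s * (\<Sum>i. \<gamma> i \<omega> * series_term (\<alpha> s) (f s s) (\<lambda>_. 1) (\<Gamma> i \<omega>) (V i \<omega>)))"
        unfolding Y X by (intro ext) (simp add: field_finite_def series_term_def \<kappa>_def e_def mult_ac)
    qed (use \<alpha>U[OF U(3)] lip\<alpha> \<kappa>0 c e H in auto)
    then show ?thesis by (simp only: goal)
  next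
    assume sig: "sigma_finite_case U c d \<alpha> b m \<rho> f M \<Gamma> V \<gamma> X"
    define \<mu> where "\<mu> = density m (\<lambda>x. ennreal (1 / \<rho> x))"
    have \<rho> [measurable]: "\<rho> \<in> borel_measurable m" and \<rho>0: "\<And>x. x \<in> space m \<Longrightarrow> 0 < \<rho> x"
      and drv: "driving_sequences M \<mu> \<Gamma> V \<gamma>" and X: "X = field_sigma_finite b \<alpha> \<rho> f \<Gamma> V \<gamma>"
      using sig by (auto simp: sigma_finite_case_def \<mu>_def)
    have sm: "sets \<mu> = sets m" "space \<mu> = space m" by (simp_all add: \<mu>_def)
    have int: "(\<integral>\<^sup>+v. ennreal (\<rho> v) * G v \<partial>\<mu>) = (\<integral>\<^sup>+v. G v \<partial>m)" if [measurable]: "G \<in> borel_measurable m" for G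
    proof -
      have "(\<integral>\<^sup>+v. ennreal (\<rho> v) * G v \<partial>\<mu>) = (\<integral>\<^sup>+v. ennreal (1 / \<rho> v) * (ennreal (\<rho> v) * G v) \<partial>m)"
        unfolding \<mu>_def by (subst nn_integral_density) auto
      also have "\<dots> = (\<integral>\<^sup>+v. G v \<partial>m)"
      proof (rule nn_integral_cong)
        fix v assume v: "v \<in> space m"
        have "ennreal (1 / \<rho> v) * ennreal (\<rho> v) = 1"
          using \<rho>0[OF v] by (subst ennreal_mult[symmetric]) auto
        then show "ennreal (1 / \<rho> v) * (ennreal (\<rho> v) * G v) = G v" by (simp flip: mult.assoc)
      qed
      finally show ?thesis .
    qed
    have "AE \<omega> in M. pointwise_holder_exponent (\<lambda>s. Y s \<omega>) t \<le> ereal (H + 1 / \<alpha> t)"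
    proof (rule pointwise_holder_exponent_series_le[OF drv, where \<rho>=\<rho> and F="\<lambda>s. f s s" and K=K
          and c=c\<^sub>1 and c'=c\<^sub>2 and \<kappa>=\<kappa>])
      show "\<forall>\<^sub>F s in nhds t. f s s \<in> borel_measurable \<mu> \<and>
          (\<integral>\<^sup>+v. ennreal (\<rho> v * \<bar>f s s v\<bar> powr \<alpha> s) \<partial>\<mu>) < \<infinity> \<and> (\<forall>v\<in>space \<mu>. \<bar>f s s v\<bar> \<le> K)"
        using nhdsU
      proof eventually_elim
        case (elim s)
        have [measurable]: "f s s \<in> borel_measurable m" using fm elim by auto
        have "(\<integral>\<^sup>+v. ennreal (\<rho> v * \<bar>f s s v\<bar> powr \<alpha> s) \<partial>\<mu>) = (\<integral>\<^sup>+v. ennreal (\<rho> v) * ennreal (\<bar>f s s v\<bar> powr \<alpha> s) \<partial>\<mu>)"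
          using \<rho>0 by (intro nn_integral_cong) (simp add: ennreal_mult'' sm)
        also have "\<dots> = (\<integral>\<^sup>+v. ennreal (\<bar>f s s v\<bar> powr \<alpha> s) \<partial>m)" by (rule int) measurable
        finally show ?case using K ffin elim by (simp add: sm measurable_cong_sets[OF sm(1) refl])
      qed
      show "\<forall>\<^sub>F r in at_right 0. \<exists>E\<in>sets \<mu>. ennreal (c\<^sub>2 * r) \<le> (\<integral>\<^sup>+v\<in>E. ennreal (\<rho> v) \<partial>\<mu>) \<and>
          (\<forall>v\<in>E. c\<^sub>1 * r powr H \<le> \<bar>f (t + r) (t + r) v - f t t v\<bar>)"
        using c(3)
      proof eventually_elim
        case (elim r)
        then obtain E where E: "E \<in> sets m" "ennreal (c\<^sub>2 * r) \<le> emeasure m E"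
          "\<forall>x\<in>E. c\<^sub>1 * r powr H \<le> \<bar>f (t + r) (t + r) x - f t t x\<bar>" by auto
        have "(\<integral>\<^sup>+v\<in>E. ennreal (\<rho> v) \<partial>\<mu>) = emeasure m E" using int[of "indicator E"] E(1) by simp
        then show ?case using E by (intro bexI[of _ E]) (simp_all add: sm)
      qed
      show "Y = (\<lambda>s \<omega>. \<kappa> s * (\<Sum>i. \<gamma> i \<omega> * series_term (\<alpha> s) (f s s) \<rho> (\<Gamma> i \<omega>) (V i \<omega>)))"
        unfolding Y X by (intro ext) (simp add: field_sigma_finite_def series_term_def \<kappa>_def mult_ac)
    qed (use \<alpha>U[OF U(3)] lip\<alpha> lip\<kappa> \<kappa>0 c H \<rho>0 in \<open>auto simp: sm measurable_cong_sets[OF sm(1) refl]\<close>)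
    then show ?thesis by (simp only: goal)
  qed
qed

end
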